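(* Fix an integer $n \geq 4$. There is a finite list of $n$-tuples of $n$-dimensional lattice polytopes in $\mathbb{R}^n$ such that every $n$-tuple $P_1,\dots,P_n \subset \mathbb{R}^n$ of $n$-dimensional lattice polytopes with $\mathrm{md}(P_1,\dots,P_n)=1$ is, up to equivalence of $n$-tuples, either a member of this finite list or a tuple for which there is a lattice projection $\varphi \colon \mathbb{R}^n \to \mathbb{R}^{n-1}$ such that $\varphi(P_i) = \Delta_{n-1}$ for all $1 \leq i \leq n$.
   Context: A lattice polytope in $\mathbb{R}^n$ is a polytope with all vertices in $\mathbb{Z}^n$. $\Delta_m = \mathrm{conv}(\mathbf{0},\mathbf{e}_1,\dots,\mathbf{e}_m) \subset \mathbb{R}^m$ is the standard unimodular simplex. An affine lattice-preserving transformation is an affine bijection $U\colon\mathbb{R}^n\to\mathbb{R}^n$ with $U(\mathbb{Z}^n)=\mathbb{Z}^n$. Two $n$-tuples $P_1,\dots,P_n$ and $Q_1,\dots,Q_n$ of lattice polytopes in $\mathbb{R}^n$ are equivalent if there are a permutation $\sigma$ of $\{1,\dots,n\}$, an affine lattice-preserving transformation $U$ and vectors $t_1,\dots,t_n \in \mathbb{Z}^n$ with $P_i = U(Q_{\sigma(i)})+t_i$ for all $i$. A lattice polytope $P\subset\mathbb{R}^n$ is hollow if its interior contains no point of $\mathbb{Z}^n$. The mixed degree $\mathrm{md}(P_1,\dots,P_n)$ of an $n$-tuple of lattice polytopes in $\mathbb{R}^n$ is $n$ if some $P_i$ has an interior lattice point; otherwise it is the smallest integer $0 \leq d \leq n-1$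 such that the Minkowski sum of any choice of $n-d$ polytopes of the tuple (i.e. over any $n-d$ distinct indices) is hollow. A lattice projection is a surjective affine-linear map $\varphi\colon \mathbb{R}^n \to \mathbb{R}^m$ with $\varphi(\mathbb{Z}^n)=\mathbb{Z}^m$. *)

theory Defs
  imports "HOL-Analysis.Analysis" "HOL-Library.Set_Algebras"
begin

definition int_lattice :: "(real ^ 'n) set" where
  "int_lattice = {x. \<forall>i. x $ i \<in> \<int>}"

definition lattice_polytope :: "(real ^ 'n) set \<Rightarrow> bool" where
  "lattice_polytope P \<longleftrightarrow> polytope P \<and> (\<forall>v. v extreme_point_of P \<longrightarrow> v \<in> int_lattice)"

definition full_dim_lattice_polytope :: "(real ^ 'n) set \<Rightarrow> bool" where
  "full_dim_lattice_polytope P \<longleftrightarrow> lattice_polytope P \<and> aff_dim P = int CARD('n)"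

definition unimodular_simplex :: "(real ^ 'm) set" where
  "unimodular_simplex = convex hull (insert 0 (range (\<lambda>i. axis i 1)))"

definition affine_map :: "(real ^ 'n \<Rightarrow> real ^ 'm) \<Rightarrow> bool" where
  "affine_map f \<longleftrightarrow> (\<exists>A c. linear A \<and> f = (\<lambda>x. A x + c))"

definition lattice_preserving :: "(real ^ 'n \<Rightarrow> real ^ 'n) \<Rightarrow> bool" where
  "lattice_preserving U \<longleftrightarrow> affine_map U \<and> bij U \<and> U ` int_lattice = int_lattice"

definition lattice_projection :: "(real ^ 'n \<Rightarrow> real ^ 'm) \<Rightarrow> bool" where
  "lattice_projection \<phi> \<longleftrightarrow> affine_map \<phi> \<and> surj \<phi> \<and> \<phi> ` int_lattice = int_lattice"

(* An n-tuple of subsets of R^n is a family indexed by the coordinate type 'n, which has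
   exactly n elements; permutations of the indices are the bijections of 'n. *)

definition equivalent_tuples ::
    "('n \<Rightarrow> (real ^ 'n) set) \<Rightarrow> ('n \<Rightarrow> (real ^ 'n) set) \<Rightarrow> bool" where
  "equivalent_tuples P Q \<longleftrightarrow>
     (\<exists>\<sigma> U t. bij \<sigma> \<and> lattice_preserving U \<and> (\<forall>i. t i \<in> int_lattice) \<and>
        (\<forall>i. P i = (\<lambda>x. U x + t i) ` Q (\<sigma> i)))"

definition hollow :: "(real ^ 'n) set \<Rightarrow> bool" where
  "hollow P \<longleftrightarrow> interior P \<inter> int_lattice = {}"

(* The sum over I is the Minkowski sum, by the instance of addition for sets in Set_Algebras. *)

definition mixed_degree :: "('n \<Rightarrow> (real ^ 'n) set) \<Rightarrow> nat" where
  "mixed_degree P =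
     (if \<exists>i. \<not> hollow (P i) then CARD('n)
      else LEAST d. d \<le> CARD('n) - 1 \<and>
             (\<forall>I. card I = CARD('n) - d \<longrightarrow> hollow (\<Sum>i\<in>I. P i)))"

end

theory Submission
  imports Defs
begin

text \<open>
Write \<open>P\<^sub>1, \<dots>, P\<^sub>n\<close> for the tuple; mixed degree one makes every sum of \<open>n - 1\<close> of the polytopes hollow.

A hollow lattice polytope containing a sufficiently long chord in a lattice direction \<open>w\<close> stays hollow
modulo \<open>w\<close>: a lattice point in the interior of the shadow can be moved, by simultaneous Diophantine
approximation of its convex coefficients, to one that lies deep inside, where the fibre has length at least one.

If the sum of \<open>n - 1\<close> polytopes is hollow modulo \<open>w\<close>, then modulo \<open>w\<close> they are translates of
one unimodular simplex. Indeed, hollowness allows one polytope after another to be traded for an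
arbitrary difference of its vertices; once a single polytope is left, it has lattice width one. Going back,
inequivalent vertices stay affinely independent in every intermediate quotient, so each polytope is a
simplex with the same edge directions as the others, and the barycentric coordinates are primitive functionals.

If some sum of \<open>n - 1\<close> polytopes has a very long chord, then already the sum of two of them has a long
chord in the same direction. Since \<open>n \<ge> 4\<close>, any third polytope can be added to this pair inside a sum of
\<open>n - 1\<close> polytopes omitting another one, so all \<open>n\<close> polytopes project to the same simplex. If there is
no very long chord, then Dirichlet approximation bounds all determinants of vertex differences,
and in the coordinates of a basis of such differences only finitely many tuples remain.
\<close>

section \<open>Hollow sums and lattice directions\<close>

text \<open>Quotient spaces are never formed. Hollowness modulo a subspace \<open>S\<close> is
  hollowness of \<open>X + S\<close>, and affine independence modulo \<open>S\<close> is tested by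
  relations whose value lies in \<open>S\<close>. No quotient lattice has to be constructed, and one
  induction can lower the number of polytopes while raising the dimension of the factored subspace,
  the total staying \<open>n\<close>. This trade needs one direction \<open>w\<close> to start from.
  A hollow sum of \<open>n - 1\<close> bodies in dimension \<open>n\<close> offers none by itself; a
  long chord does, whence the two cases. Its length has to beat the inverse of the least weight that
  the approximation guarantees, so that a fractional displacement along \<open>w\<close> fits into
  the fibre. This bound depends on \<open>n\<close> only, because Caratheodory's theorem limits the
  number of coefficients. A chord of one sum says nothing about the omitted polytope, so it has to
  be concentrated on few summands. A height function along \<open>w\<close> finds one summand with
  large oscillation; adding the reference simplex to it makes the two ends agree modulo
  \<open>w\<close>, which gives a chord of a pair.\<close>

lemma int_lattice_zero [simp]: "0 \<in> int_lattice"
  by (simp add: int_lattice_def)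

lemma int_lattice_add: "x \<in> int_lattice \<Longrightarrow> y \<in> int_lattice \<Longrightarrow> x + y \<in> int_lattice"
  by (simp add: int_lattice_def)

lemma int_lattice_diff: "x \<in> int_lattice \<Longrightarrow> y \<in> int_lattice \<Longrightarrow> x - y \<in> int_lattice"
  by (simp add: int_lattice_def)

lemma int_lattice_minus: "x \<in> int_lattice \<Longrightarrow> - x \<in> int_lattice"
  by (simp add: int_lattice_def)

lemma int_lattice_scale: "r \<in> \<int> \<Longrightarrow> x \<in> int_lattice \<Longrightarrow> r *\<^sub>R x \<in> int_lattice"
  by (simp add: int_lattice_def)

lemma int_lattice_sum: "(\<And>i. i \<in> I \<Longrightarrow> f i \<in> int_lattice) \<Longrightarrow> (\<Sum>i\<in>I. f i) \<in> int_lattice"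
  by (induction I rule: infinite_finite_induct) (auto intro: int_lattice_add)

lemma int_lattice_axis: "axis i 1 \<in> int_lattice"
  by (simp add: int_lattice_def axis_def)

lemma hollowD: "hollow X \<Longrightarrow> z \<in> interior X \<Longrightarrow> z \<in> int_lattice \<Longrightarrow> False"
  by (auto simp: hollow_def)

lemma hollow_mono: "hollow Y \<Longrightarrow> X \<subseteq> Y \<Longrightarrow> hollow X"
  unfolding hollow_def using interior_mono by blast

section \<open>Interiors of Minkowski sums and trading a polytope for a direction\<close>

lemma interior_plus_subset:
  fixes X Y :: "'a::real_normed_vector set"
  shows "interior X + Y \<subseteq> interior (X + Y)"
proof (rule interior_maximal)
  show "interior X + Y \<subseteq> X + Y"
    by (intro set_plus_mono2 interior_subset order_refl)
  have "interior X + Y = (\<Union>x\<in>interior X. \<Union>y\<in>Y. {x + y})"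
    by (auto simp: set_plus_def)
  then show "open (interior X + Y)"
    using open_sums[of "interior X" Y] by simp
qed

text \<open>Relative interiors of convex sets add, and a subspace is its own relative interior. The
  equality lets a lattice point in the interior of a shadow be lifted to an interior point of
  \<open>X\<close> itself.\<close>

lemma interior_plus_subspace:
  fixes X S :: "'a::euclidean_space set"
  assumes "convex X" "interior X \<noteq> {}" "subspace S"
  shows "interior (X + S) = interior X + S"
proof -
  have "0 \<in> S"
    by (simp add: assms(3) subspace_0)
  then have "interior (X + S) \<noteq> {}"
    using interior_plus_subset[of X S] assms(2) by fastforce
  then have "interior (X + S) = rel_interior (X + S)"
    by (simp add: rel_interior_nonempty_interior)
  also have "\<dots> = rel_interior X + rel_interior S"
    using assms by (intro rel_interior_sum) (auto simp: subspace_imp_convex)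
  also have "\<dots> = interior X + S"
    using assms by (simp add: rel_interior_nonempty_interior rel_interior_affine subspace_imp_affine)
  finally show ?thesis .
qed

lemma span_insert_eq_plus:
  fixes S :: "'a::real_vector set"
  shows "span (insert a S) = span S + span {a}"
  using span_Un[of S "{a}"] by (auto simp: set_plus_def)

lemma hollow_plus_line:
  fixes X P :: "(real^'n) set"
  assumes X: "convex X" "interior X \<noteq> {}" and P: "convex P" "b \<in> P" "c \<in> P"
    and lat: "b \<in> int_lattice" "c \<in> int_lattice" and hol: "hollow (X + P)"
  shows "hollow (X + span {b - c})"
  unfolding hollow_def
proof (rule ccontr)
  assume "interior (X + span {b - c}) \<inter> int_lattice \<noteq> {}"
  then obtain z where z: "z \<in> int_lattice" "z \<in> interior X + span {b - c}"
    using interior_plus_subspace[OF X, of "span {b - c}"] by auto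
  then obtain x r where x: "x \<in> interior X" "z = x + r *\<^sub>R (b - c)"
    by (auto simp: set_plus_def span_singleton)
  \<comment> \<open>The integer part of \<open>r\<close> is removed by a lattice translation; the
    fractional part is absorbed by the segment from \<open>c\<close> to \<open>b\<close> inside
    \<open>P\<close>.\<close>
  have "(1 - frac r) *\<^sub>R c + frac r *\<^sub>R b \<in> P"
    using P frac_ge_0[of r] frac_lt_1[of r] by (intro convexD) auto
  then have "x + ((1 - frac r) *\<^sub>R c + frac r *\<^sub>R b) \<in> interior (X + P)"
    using x(1) interior_plus_subset[of X P] by blast
  moreover have "x + ((1 - frac r) *\<^sub>R c + frac r *\<^sub>R b) = z - of_int \<lfloor>r\<rfloor> *\<^sub>R (b - c) + c"
    by (simp add: x frac_def algebra_simps)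
  moreover have "\<dots> \<in> int_lattice"
    using z lat by (intro int_lattice_add int_lattice_diff int_lattice_scale) auto
  ultimately show False
    using hol hollowD by metis
qed

lemma hollow_plus_span_insert:
  fixes X P :: "(real^'n) set"
  assumes X: "convex X" "interior X \<noteq> {}" and P: "convex P" "b \<in> P" "c \<in> P"
    and lat: "b \<in> int_lattice" "c \<in> int_lattice" and hol: "hollow (X + P + span B)"
  shows "hollow (X + span (insert (b - c) B))"
proof -
  have "interior X \<subseteq> interior (X + span B)"
    using set_zero_plus2[OF span_0, of "interior X" B] interior_plus_subset[of X "span B"]
    by (simp add: add.commute)
  then have iX: "interior (X + span B) \<noteq> {}"
    using X by blast
  have cX: "convex (X + span B)"
    by (intro convex_set_plus X subspace_imp_convex subspace_span)
  have hX: "hollow ((X + span B) + P)"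
    using hol by (simp only: add.assoc add.commute[of P])
  have "hollow ((X + span B) + span {b - c})"
    by (rule hollow_plus_line[OF cX iX P lat hX])
  then show ?thesis
    using span_insert_eq_plus[of "b - c" B] by (simp only: add.assoc)
qed

text \<open>Each summand \<open>V k\<close> is traded for one of its own differences
  \<open>u k\<close>. The arbitrary \<open>B\<close> in the induction collects the directions
  already obtained.\<close>

lemma hollow_plus_span_family:
  fixes X :: "(real^'n) set"
  assumes X: "convex X" "interior X \<noteq> {}" and K: "finite K"
    and lat: "\<And>k. k \<in> K \<Longrightarrow> V k \<subseteq> int_lattice"
    and u: "\<And>k. k \<in> K \<Longrightarrow> \<exists>b\<in>V k. \<exists>c\<in>V k. u k = b - c"
    and hol: "hollow (X + (\<Sum>k\<in>K. convex hull V k) + span B)"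
  shows "hollow (X + span (u ` K \<union> B))"
  using K lat u hol
proof (induction K arbitrary: B rule: finite_induct)
  case empty
  then show ?case by simp
next
  case (insert k K)
  obtain b c where bc: "b \<in> V k" "c \<in> V k" "u k = b - c"
    using insert.prems(2)[of k] by blast
  define Y where "Y = X + (\<Sum>k\<in>K. convex hull V k)"
  have ne: "(\<Sum>k\<in>K. convex hull V k) \<noteq> {}"
  proof -
    have "(\<Sum>k\<in>K. SOME x. x \<in> V k) \<in> (\<Sum>k\<in>K. convex hull V k)"
      unfolding set_sum_alt[OF insert.hyps(1)] using insert.prems
      by (auto intro!: exI[of _ "\<lambda>k. SOME x. x \<in> V k"] hull_inc) (metis someI)
    then show ?thesis by blast
  qed
  then have Yint: "interior Y \<noteq> {}"
    using interior_plus_subset[of X "\<Sum>k\<in>K. convex hull V k"] X(2)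
    unfolding Y_def set_plus_def by blast
  have cs: "convex (\<Sum>k\<in>K. convex hull V k)"
    using insert.hyps(1) by (induction K) (auto intro: convex_set_plus)
  have Yc: "convex Y"
    unfolding Y_def using X cs by (intro convex_set_plus) auto
  have "hollow (Y + convex hull V k + span B)"
    using insert.prems(3) insert.hyps by (simp add: Y_def ac_simps)
  then have "hollow (Y + span (insert (u k) B))"
    unfolding bc(3) using bc insert.prems(1)[of k] Yc Yint
    by (intro hollow_plus_span_insert[of _ "convex hull V k"]) (auto intro: hull_inc)
  then have "hollow (X + span (u ` K \<union> insert (u k) B))"
    using insert.prems by (intro insert.IH) (auto simp: Y_def)
  then show ?case by simp
qed

text \<open>If the width exceeded one, the open slab strictly between the levels of \<open>x\<close>
  and \<open>y\<close> would lie in the interior of the shadow, and it contains the lattice point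
  \<open>x + z0\<close> one level above \<open>x\<close>.\<close>

lemma width_le_one:
  fixes f :: "real^'n \<Rightarrow> real"
  assumes f: "linear f" and z0: "z0 \<in> int_lattice" "f z0 = 1"
    and X: "convex X" "x \<in> X" "y \<in> X" "x \<in> int_lattice"
    and hol: "hollow (X + {p. f p = 0})"
  shows "f y - f x \<le> 1"
proof (rule ccontr)
  assume "\<not> f y - f x \<le> 1"
  then have xy: "f x + 1 < f y" by simp
  interpret f: linear f by (fact f)
  define W where "W = {p. f x < f p} \<inter> {p. f p < f y}"
  have "continuous_on UNIV f"
    using f linear_continuous_on linear_conv_bounded_linear by blast
  then have "open W"
    unfolding W_def by (intro open_Int open_Collect_less) auto
  moreover have "W \<subseteq> X + {p. f p = 0}"
  proof
    fix p assume p: "p \<in> W"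
    define t where "t = (f p - f x) / (f y - f x)"
    have t: "0 \<le> t" "t \<le> 1"
      using p xy by (auto simp: t_def W_def)
    define q where "q = (1 - t) *\<^sub>R x + t *\<^sub>R y"
    have "q \<in> X"
      unfolding q_def using X t by (intro convexD) auto
    moreover have "f q = f x + t * (f y - f x)"
      unfolding q_def f.add f.scale by (simp add: algebra_simps)
    then have "f q = f p"
      using xy by (simp add: t_def)
    then have "f (p - q) = 0"
      by (simp add: f.diff)
    ultimately have "q + (p - q) \<in> X + {p. f p = 0}"
      by (intro set_plus_intro) auto
    then show "p \<in> X + {p. f p = 0}" by simp
  qed
  ultimately have "W \<subseteq> interior (X + {p. f p = 0})"
    by (rule interior_maximal[rotated])
  moreover have "x + z0 \<in> W"
    using xy by (simp add: W_def f.add z0)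
  ultimately show False
    using hollowD[OF hol] X(4) z0 int_lattice_add by blast
qed

section \<open>Primitive integer functionals with a given kernel\<close>

lemma det_in_Ints:
  fixes A :: "real^'n^'n"
  assumes "\<And>i. A $ i \<in> int_lattice"
  shows "det A \<in> \<int>"
  unfolding det_def using assms
  by (intro Ints_sum Ints_mult Ints_prod) (auto simp: int_lattice_def)

lemma linear_det_row: "linear (\<lambda>x::real^'n. det (\<chi> i. if i = k then x else u i))"
proof (rule linearI)
  show "det (\<chi> i. if i = k then x + y else u i) =
      det (\<chi> i. if i = k then x else u i) + det (\<chi> i. if i = k then y else u i)" for x y
    by (rule det_row_add)
  show "det (\<chi> i. if i = k then r *\<^sub>R x else u i) = r *\<^sub>R det (\<chi> i. if i = k then x else u i)" for r x
    using det_row_mul[of k r "\<lambda>_. x" u] unfolding scalar_mult_eq_scaleR by simp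
qed

text \<open>The functional is a determinant with one free row, divided by the generator of its group of values.\<close>

lemma primitive_functional:
  fixes B :: "(real^'n) set"
  assumes B: "B \<subseteq> int_lattice" and dB: "dim B = CARD('n) - 1"
  obtains f :: "real^'n \<Rightarrow> real" where "linear f" "\<And>z. z \<in> int_lattice \<Longrightarrow> f z \<in> \<int>"
    "\<exists>z\<in>int_lattice. f z = 1" "{x. f x = 0} = span B"
proof -
  obtain C where C: "C \<subseteq> B" "independent C" "B \<subseteq> span C" "card C = dim B"
    using basis_exists by blast
  have spC: "span C = span B"
    using C by (metis span_mono subset_antisym span_minimal subspace_span)
  have "dim (span B) < CARD('n)"
    using dB by simp
  then have "span B \<noteq> UNIV"
    by (metis DIM_cart DIM_real dim_UNIV less_irrefl mult.right_neutral)
  then obtain k where k: "axis k 1 \<notin> span B"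
  proof -
    have "\<exists>k. axis k (1::real) \<notin> span B"
    proof (rule ccontr)
      assume "\<nexists>k. axis k (1::real) \<notin> span B"
      then have "(\<Sum>i\<in>UNIV. x $ i *\<^sub>R axis i 1) \<in> span B" for x :: "real^'n"
        by (intro span_sum span_scale) auto
      then have "x \<in> span B" for x :: "real^'n"
        using basis_expansion[of x] unfolding scalar_mult_eq_scaleR by metis
      then show False using \<open>span B \<noteq> UNIV\<close> by blast
    qed
    then show ?thesis using that by blast
  qed
  define e where "e = (axis k 1 :: real^'n)"
  have eC: "e \<notin> span C" using k spC by (simp add: e_def)
  then have ind: "independent (insert e C)"
    using C by (simp add: independent_insert)
  have "e \<notin> C" using eC span_base by blast
  have finC: "finite C"
    using C independent_imp_finite by blast
  have card: "card (insert e C) = CARD('n)"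
    using \<open>e \<notin> C\<close> finC C dB by simp
  then obtain h :: "'n \<Rightarrow> real^'n" where h: "bij_betw h UNIV (insert e C)"
    using finite_same_card_bij[of "UNIV::'n set" "insert e C"] finC by auto
  then obtain i0 where i0: "h i0 = e"
    by (metis bij_betw_imp_surj_on image_iff insertI1)
  define g where "g = (\<lambda>x. det (\<chi> i. if i = i0 then x else h i))"
  have g: "linear g"
    using linear_det_row[of i0 h] by (simp only: g_def)
  interpret g: linear g by (fact g)
  have g_zero: "g c = 0" if "c \<in> C" for c
  proof -
    have "c \<in> range h" using h that by (auto simp: bij_betw_def)
    then obtain j where j: "h j = c" by blast
    then have "j \<noteq> i0" using i0 that \<open>e \<notin> C\<close> by auto
    then show ?thesis
      unfolding g_def by (intro det_identical_rows[of i0 j]) (auto simp: row_def j vec_eq_iff)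
  qed
  have "g e \<noteq> 0"
  proof -
    define A where "A = (\<chi> i. h i)"
    have "rows A = insert e C"
      using h by (auto simp: rows_def row_def A_def bij_betw_def)
    then have "det A \<noteq> 0"
      using dim_eq_card_independent[OF ind] det_eq_0_rank[of A] card row_rank_def[of A] by simp
    moreover have "A = (\<chi> i. if i = i0 then e else h i)"
      using i0 by (auto simp: A_def vec_eq_iff)
    ultimately show ?thesis by (simp add: g_def)
  qed
  have Cl: "C \<subseteq> int_lattice" using B C by blast
  have el: "e \<in> int_lattice" by (simp add: e_def int_lattice_axis)
  have hl: "h i \<in> int_lattice" for i
    using h Cl el by (metis UNIV_I bij_betw_apply insertE subset_eq)
  have gint: "g z \<in> \<int>" if "z \<in> int_lattice" for z
    unfolding g_def using that hl by (intro det_in_Ints) simp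
  define S where "S = {m::nat. m > 0 \<and> (\<exists>z\<in>int_lattice. g z = real m)}"
  have "S \<noteq> {}"
  proof -
    obtain m where m: "g e = of_int m" using gint[OF el] Ints_cases by blast
    show ?thesis
    proof (cases "m > 0")
      case True
      then have "nat m \<in> S" using m el by (auto simp: S_def intro!: bexI[of _ e])
      then show ?thesis by blast
    next
      case False
      then have "nat (-m) \<in> S" using m el \<open>g e \<noteq> 0\<close> 
        by (auto simp: S_def g.neg int_lattice_minus intro!: bexI[of _ "-e"])
      then show ?thesis by blast
    qed
  qed
  define d where "d = (LEAST m. m \<in> S)"
  have dS: "d \<in> S" using \<open>S \<noteq> {}\<close> by (metis LeastI d_def ex_in_conv)
  then obtain z1 where z1: "z1 \<in> int_lattice" "g z1 = real d" and d0: "d > 0"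
    by (auto simp: S_def)
  \<comment> \<open>Division with remainder: a nonzero remainder would be a positive value of
    \<open>g\<close> on the lattice below the least one, \<open>d\<close>.\<close>
  have mult: "g z / real d \<in> \<int>" if z: "z \<in> int_lattice" for z
  proof -
    obtain m where m: "g z = of_int m" using gint[OF z] Ints_cases by blast
    define z' where "z' = z - of_int (m div int d) *\<^sub>R z1"
    have "g z' = of_int (m mod int d)"
      unfolding z'_def g.diff g.scale m z1 minus_mult_div_eq_mod[symmetric] by (simp add: mult.commute)
    moreover have "z' \<in> int_lattice"
      unfolding z'_def using z z1 by (intro int_lattice_diff int_lattice_scale) auto
    moreover have "0 \<le> m mod int d" "m mod int d < int d" using d0 by auto
    ultimately have "m mod int d \<noteq> 0 \<Longrightarrow> nat (m mod int d) \<in> S"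
      unfolding S_def by (auto intro!: bexI[of _ z'])
    moreover have "nat (m mod int d) \<notin> S"
      unfolding d_def using \<open>m mod int d < int d\<close> \<open>0 \<le> m mod int d\<close>
      by (metis d_def nat_less_iff not_less_Least)
    ultimately have "m mod int d = 0" by blast
    then obtain q where "m = int d * q"
      by blast
    then show ?thesis using m d0 by simp
  qed
  define f where "f x = g x / real d" for x
  have f: "linear f"
    unfolding f_def by (rule linearI) (simp_all add: g.add g.scale add_divide_distrib)
  interpret f: linear f by (fact f)
  have sub: "subspace {x. f x = 0}"
    by (rule subspaceI) (simp_all add: f.add f.scale)
  have incl: "span B \<subseteq> {x. f x = 0}"
    unfolding spC[symmetric] using g_zero sub by (intro span_minimal) (auto simp: f_def)
  have "e \<notin> {x. f x = 0}" using \<open>g e \<noteq> 0\<close> d0 by (simp add: f_def)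
  then have "{x. f x = 0} \<noteq> UNIV" by blast
  then have "dim {x. f x = 0} < CARD('n)"
    using dim_eq_full[of "{x. f x = 0}"] dim_subset_UNIV[of "{x. f x = 0}"] iffD2[OF span_eq_iff sub]
    by auto
  then have "dim {x. f x = 0} \<le> dim (span B)"
    using dB by simp
  then have ker: "{x. f x = 0} = span B"
    using incl sub subspace_dim_equal[of "span B" "{x. f x = 0}"] by auto
  show ?thesis
  proof (rule that[OF f])
    show "f z \<in> \<int>" if "z \<in> int_lattice" for z
      using mult[OF that] by (simp add: f_def)
    show "\<exists>z\<in>int_lattice. f z = 1"
      using z1 d0 by (auto simp: f_def intro!: bexI[of _ z1])
  qed (fact ker)
qed

section \<open>Affine independence modulo a subspace\<close>

text \<open>Two distinct points of \<open>A\<close> with difference in \<open>R\<close> already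
  violate this, through the coefficients 1 and -1. The notion therefore includes injectivity of the
  map from \<open>A\<close> to the quotient.\<close>

definition aff_indep_mod :: "'a::real_vector set \<Rightarrow> 'a set \<Rightarrow> bool" where
  "aff_indep_mod R A \<longleftrightarrow> (\<forall>c. (\<Sum>x\<in>A. c x) = (0::real) \<longrightarrow> (\<Sum>x\<in>A. c x *\<^sub>R x) \<in> R \<longrightarrow> (\<forall>x\<in>A. c x = 0))"

definition inequiv_mod :: "'a::real_vector set \<Rightarrow> 'a set \<Rightarrow> bool" where
  "inequiv_mod R A \<longleftrightarrow> (\<forall>x\<in>A. \<forall>y\<in>A. x - y \<in> R \<longrightarrow> x = y)"

text \<open>One choice operator selects the representative: equivalent points satisfy the same
  predicate, so they receive the same value.\<close>

lemma transversal_exists: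
  fixes V :: "'a::real_vector set"
  assumes "subspace R"
  obtains \<rho> where "\<And>x. x \<in> V \<Longrightarrow> \<rho> x \<in> V" "\<And>x. x \<in> V \<Longrightarrow> \<rho> x - x \<in> R"
    "\<And>x y. x \<in> V \<Longrightarrow> y \<in> V \<Longrightarrow> \<rho> x = \<rho> y \<longleftrightarrow> x - y \<in> R"
    "inequiv_mod R (\<rho> ` V)"
proof -
  define \<rho> where "\<rho> x = (SOME y. y \<in> V \<and> y - x \<in> R)" for x
  have sp: "\<rho> x \<in> V \<and> \<rho> x - x \<in> R" if "x \<in> V" for x
    unfolding \<rho>_def by (rule someI[of _ x]) (use that assms in \<open>auto simp: subspace_0\<close>)
  have eq: "\<rho> x = \<rho> y \<longleftrightarrow> x - y \<in> R" if "x \<in> V" "y \<in> V" for x y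
  proof
    assume "\<rho> x = \<rho> y"
    then have "x - y = (\<rho> y - y) - (\<rho> x - x)" by simp
    then show "x - y \<in> R"
      using sp that assms by (metis subspace_diff)
  next
    assume xy: "x - y \<in> R"
    have "z - x \<in> R \<longleftrightarrow> z - y \<in> R" for z
    proof -
      have "z - y = (z - x) + (x - y)" "z - x = (z - y) - (x - y)" by simp_all
      then show ?thesis
        using xy assms by (metis subspace_add subspace_diff)
    qed
    then show "\<rho> x = \<rho> y" by (simp add: \<rho>_def)
  qed
  have "inequiv_mod R (\<rho> ` V)"
    unfolding inequiv_mod_def
  proof clarify
    fix x y assume xy: "x \<in> V" "y \<in> V" "\<rho> x - \<rho> y \<in> R"
    have "x - y = (\<rho> x - \<rho> y) - (\<rho> x - x) + (\<rho> y - y)" by simp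
    then have "x - y \<in> R"
      using sp[OF xy(1)] sp[OF xy(2)] xy(3) assms by (metis subspace_add subspace_diff)
    then show "\<rho> x = \<rho> y" using eq xy by simp
  qed
  then show ?thesis
    using sp eq that[of \<rho>] by blast
qed

lemma sum_differences_in_subspace:
  fixes c :: "'a::real_vector \<Rightarrow> real"
  assumes "subspace R" "\<And>x. x \<in> A \<Longrightarrow> \<rho> x - x \<in> R"
  shows "(\<Sum>x\<in>A. c x *\<^sub>R \<rho> x) - (\<Sum>x\<in>A. c x *\<^sub>R x) \<in> R"
proof -
  have "(\<Sum>x\<in>A. c x *\<^sub>R \<rho> x) - (\<Sum>x\<in>A. c x *\<^sub>R x) = (\<Sum>x\<in>A. c x *\<^sub>R (\<rho> x - x))"
    by (simp add: scaleR_right_diff_distrib sum_subtractf)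
  also have "\<dots> \<in> R"
    using assms by (intro subspace_sum subspace_scale)
  finally show ?thesis .
qed

text \<open>Moving each point to its representative changes a linear combination only by an element
  of \<open>R\<close>, so a relation descends to the representatives with the class sums as
  coefficients.\<close>

lemma collapse_relation:
  fixes c :: "'a::real_vector \<Rightarrow> real"
  assumes "finite A" "subspace R" "\<And>x. x \<in> A \<Longrightarrow> \<rho> x - x \<in> R"
  shows "(\<Sum>t\<in>\<rho>`A. \<Sum>x | x \<in> A \<and> \<rho> x = t. c x) = (\<Sum>x\<in>A. c x)"
    and "(\<Sum>t\<in>\<rho>`A. (\<Sum>x | x \<in> A \<and> \<rho> x = t. c x) *\<^sub>R t) - (\<Sum>x\<in>A. c x *\<^sub>R x) \<in> R"
proof -
  show "(\<Sum>t\<in>\<rho>`A. \<Sum>x | x \<in> A \<and> \<rho> x = t. c x) = (\<Sum>x\<in>A. c x)"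
    using sum.image_gen[OF assms(1), of c \<rho>] by simp
  have "(\<Sum>t\<in>\<rho>`A. (\<Sum>x | x \<in> A \<and> \<rho> x = t. c x) *\<^sub>R t)
      = (\<Sum>t\<in>\<rho>`A. \<Sum>x | x \<in> A \<and> \<rho> x = t. c x *\<^sub>R \<rho> x)"
    by (intro sum.cong refl) (simp add: scaleR_left.sum)
  also have "\<dots> = (\<Sum>x\<in>A. c x *\<^sub>R \<rho> x)"
    using sum.image_gen[OF assms(1), of "\<lambda>x. c x *\<^sub>R \<rho> x" \<rho>] by simp
  finally show "(\<Sum>t\<in>\<rho>`A. (\<Sum>x | x \<in> A \<and> \<rho> x = t. c x) *\<^sub>R t) - (\<Sum>x\<in>A. c x *\<^sub>R x) \<in> R"
    using sum_differences_in_subspace[OF assms(2,3)] by simp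
qed

lemma aff_indep_modD3:
  assumes "aff_indep_mod R {x, y, z}" "x \<noteq> y" "x \<noteq> z" "y \<noteq> z"
    "a + b + c = 0" "a *\<^sub>R x + b *\<^sub>R y + c *\<^sub>R z \<in> R"
  shows "a = 0" "b = 0" "c = 0"
proof -
  define h where "h = (\<lambda>t. if t = x then a else if t = y then b else c)"
  have "(\<Sum>t\<in>{x,y,z}. h t) = 0" "(\<Sum>t\<in>{x,y,z}. h t *\<^sub>R t) \<in> R"
    using assms by (auto simp: h_def add.assoc)
  then have "h x = 0" "h y = 0" "h z = 0"
    using assms(1) unfolding aff_indep_mod_def by blast+
  then show "a = 0" "b = 0" "c = 0"
    using assms(2-4) by (auto simp: h_def)
qed

lemma aff_indep_modD4:
  assumes "aff_indep_mod R {w, x, y, z}" "distinct [w, x, y, z]"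
    "e + a + b + c = 0" "e *\<^sub>R w + a *\<^sub>R x + b *\<^sub>R y + c *\<^sub>R z \<in> R"
  shows "c = 0"
proof -
  define h where "h = (\<lambda>t. if t = w then e else if t = x then a else if t = y then b else c)"
  have "(\<Sum>t\<in>{w,x,y,z}. h t) = 0" "(\<Sum>t\<in>{w,x,y,z}. h t *\<^sub>R t) \<in> R"
    using assms by (auto simp: h_def add.assoc)
  then have "h z = 0"
    using assms(1) unfolding aff_indep_mod_def by blast
  then show "c = 0"
    using assms(2) by (auto simp: h_def)
qed

section \<open>Spans, Minkowski sums and full-dimensionality\<close>

lemma mem_span_insert:
  "x \<in> span (insert a S) \<longleftrightarrow> (\<exists>k. x - k *\<^sub>R a \<in> span S)"
  by (simp add: span_insert)

text \<open>Modulo \<open>span S\<close> these are two different lines through the origin (or the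
  first is zero), so they meet only in zero.\<close>

lemma span_insert_Int:
  assumes "v' \<notin> span (insert v S)" "x \<in> span (insert v S)" "x \<in> span (insert v' S)"
  shows "x \<in> span S"
proof -
  obtain k where k: "x - k *\<^sub>R v' \<in> span S" using assms mem_span_insert by blast
  show ?thesis
  proof (cases "k = 0")
    case False
    have "x - k *\<^sub>R v' \<in> span (insert v S)"
      using k span_mono[of S "insert v S"] by blast
    then have "x - (x - k *\<^sub>R v') \<in> span (insert v S)"
      by (rule span_diff[OF assms(2)])
    then have "(1/k) *\<^sub>R (x - (x - k *\<^sub>R v')) \<in> span (insert v S)"
      by (rule span_scale)
    then show ?thesis using False assms by simp
  qed (use k in simp)
qed

lemma convex_sum_sets:
  "(\<And>i. i \<in> I \<Longrightarrow> convex (S i)) \<Longrightarrow> convex (\<Sum>i\<in>I. S i :: 'a::real_vector set)"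
  by (induction I rule: infinite_finite_induct) (auto intro: convex_set_plus)

lemma sum_sets_nonempty:
  "(\<And>i. i \<in> I \<Longrightarrow> S i \<noteq> {}) \<Longrightarrow> (\<Sum>i\<in>I. S i :: 'a::comm_monoid_add set) \<noteq> {}"
  by (induction I rule: infinite_finite_induct) (auto simp: set_plus_def)

lemma interior_sum_nonempty:
  fixes S :: "'b \<Rightarrow> 'a::real_normed_vector set"
  assumes "finite I" "j \<in> I" "\<And>i. i \<in> I \<Longrightarrow> interior (S i) \<noteq> {}"
  shows "interior (\<Sum>i\<in>I. S i) \<noteq> {}"
proof -
  have "(\<Sum>i\<in>I - {j}. S i) \<noteq> {}"
    using assms(3) by (intro sum_sets_nonempty) fastforce
  then have "interior (S j) + (\<Sum>i\<in>I - {j}. S i) \<noteq> {}"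
    using assms(2,3) by (auto simp: set_plus_def)
  then show ?thesis
    using interior_plus_subset[of "S j" "\<Sum>i\<in>I - {j}. S i"] sum.remove[OF assms(1,2), of S] by auto
qed

text \<open>Otherwise \<open>W\<close> would lie in the proper affine subspace \<open>b + S\<close>,
  although its affine hull is the whole space.\<close>

lemma full_dim_difference:
  fixes W :: "'a::euclidean_space set"
  assumes "interior (convex hull W) \<noteq> {}" "subspace S" "S \<noteq> UNIV"
  shows "\<exists>c\<in>W. c - b \<notin> S"
proof (rule ccontr)
  assume "\<not> ?thesis"
  then have sub: "W \<subseteq> (+) b ` S"
    by (auto intro!: image_eqI[of _ "(+) b" "_ - b"])
  have "affine ((+) b ` S)"
    using subspace_imp_affine[OF assms(2)] by (metis affine_translation)
  then have hull: "affine hull W \<subseteq> (+) b ` S"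
    by (rule hull_minimal[OF sub])
  obtain x where x: "x \<notin> S" using assms(3) by blast
  have "b + x \<in> affine hull W"
    using affine_hull_nonempty_interior[OF assms(1)] by simp
  then have "b + x \<in> (+) b ` S" using hull by blast
  then obtain s where "b + x = b + s" "s \<in> S" by (rule imageE)
  then show False using x by simp
qed

lemma span_ne_UNIV:
  fixes S :: "(real^'n) set"
  assumes "dim S < CARD('n)"
  shows "span S \<noteq> UNIV"
proof
  assume "span S = UNIV"
  then have "dim (UNIV::(real^'n) set) = dim S" by (metis dim_span)
  then show False using assms by simp
qed

text \<open>
Trading one more polytope for a difference \<open>v\<close> of its vertices, induction shows that the coefficients of an affine
relation cancel within each class modulo \<open>v\<close>, and that these classes are pairs. The three directions
\<open>v\<close>, \<open>v2\<close> and \<open>v2 - v\<close> then give one point three partners in a common plane, each with the opposite coefficient.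
\<close>

lemma affine_independence_mod_hollow_sum:
  fixes V :: "'i \<Rightarrow> (real^'n) set"
  assumes "finite J" and "\<And>i. i \<in> J \<Longrightarrow> finite (V i)" and "\<And>i. i \<in> J \<Longrightarrow> V i \<subseteq> int_lattice"
    and "\<And>i. i \<in> J \<Longrightarrow> interior (convex hull V i) \<noteq> {}"
    and "B \<subseteq> int_lattice" "dim B + card J = CARD('n)"
    and "hollow ((\<Sum>i\<in>J. convex hull V i) + span B)"
    and "j \<in> J" "A \<subseteq> V j" "inequiv_mod (span B) A"
  shows "aff_indep_mod (span B) A"
  using assms
proof (induction "card J" arbitrary: J B A rule: less_induct)
  case less
  have A_int: "A \<subseteq> int_lattice" using less.prems by blast
  have finA: "finite A" using less.prems by (meson finite_subset)
  have neq: "x - y \<notin> span B" if "x \<in> A" "y \<in> A" "x \<noteq> y" for x y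
    using less.prems(10) that unfolding inequiv_mod_def by blast
  have "card J > 0" using less.prems by (metis card_gt_0_iff empty_iff)
  then consider "card J = 1" | "card J \<ge> 2" by linarith
  then show ?case
  proof cases
    case 1
    then have J: "J = {j}" using less.prems(8) by (metis card_1_singletonE singletonD)
    obtain f :: "real^'n \<Rightarrow> real" where f: "linear f" "\<And>z. z \<in> int_lattice \<Longrightarrow> f z \<in> \<int>"
        "\<exists>z\<in>int_lattice. f z = 1" "{x. f x = 0} = span B"
    proof (rule primitive_functional[OF less.prems(5)])
      show "dim B = CARD('n) - 1" using less.prems(6) 1 by linarith
    qed blast
    interpret f: linear f by (fact f(1))
    obtain z0 where z0: "z0 \<in> int_lattice" "f z0 = 1" using f by blast
    have hol: "hollow (convex hull V j + {p. f p = 0})" using less.prems(7) f(4) J by simp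
    have hull: "x \<in> convex hull V j" if "x \<in> A" for x using that less.prems(9) by (blast intro: hull_inc)
    have w: "f y - f x \<le> 1" if "x \<in> A" "y \<in> A" for x y
      by (rule width_le_one[OF f(1) z0 convex_convex_hull hull[OF that(1)] hull[OF that(2)] _ hol])
        (use that A_int in blast)
    have fne: "f x \<noteq> f y" if "x \<in> A" "y \<in> A" "x \<noteq> y" for x y
    proof -
      have "f (x - y) \<noteq> 0" using neq[OF that] f(4) by blast
      then show ?thesis by (simp add: f.diff)
    qed
    have fint: "f x \<in> \<int>" if "x \<in> A" for x using f(2) A_int that by blast
    \<comment> \<open>The values of \<open>f\<close> are distinct integers at mutual distance at
      most one, so there are at most two of them. This settles the base case.\<close>
    have no3: False if xyz: "x \<in> A" "y \<in> A" "z \<in> A" "x \<noteq> y" "x \<noteq> z" "y \<noteq> z" for x y z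
    proof -
      obtain a where a: "f x = of_int a" using fint[OF xyz(1)] by (rule Ints_cases)
      obtain b where b: "f y = of_int b" using fint[OF xyz(2)] by (rule Ints_cases)
      obtain c where c: "f z = of_int c" using fint[OF xyz(3)] by (rule Ints_cases)
      show False
        using fne[of x y] fne[of x z] fne[of y z] w[of x y] w[of y x] w[of x z] w[of z x] w[of y z] w[of z y] xyz
        unfolding a b c by (simp flip: of_int_diff)
    qed
    show ?thesis
      unfolding aff_indep_mod_def
    proof (intro allI impI ballI, rule ccontr)
      fix c x assume c: "(\<Sum>x\<in>A. c x) = (0::real)" "(\<Sum>x\<in>A. c x *\<^sub>R x) \<in> span B" and x: "x \<in> A" "c x \<noteq> 0"
      have "A \<noteq> {x}" using c x by auto
      then obtain y where y: "y \<in> A" "y \<noteq> x" using x by blast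
      then have A: "A = {x, y}" using no3[OF x(1) y(1)] x by blast
      then have "c y = - c x" using c y by simp
      moreover have "f (\<Sum>x\<in>A. c x *\<^sub>R x) = 0" using c f(4) by blast
      ultimately have "c x * (f x - f y) = 0" 
        using A y by (simp add: f.add f.scale f.neg f.diff algebra_simps)
      then show False using x y fne by auto
    qed
  next
    case 2
    then have "J \<noteq> {j}" by auto
    then obtain l where l: "l \<in> J" "l \<noteq> j" using less.prems(8) by blast
    define b0 where "b0 = (SOME b. b \<in> V l)"
    have "V l \<noteq> {}" using less.prems(4)[OF l(1)] by auto
    then have b0: "b0 \<in> V l" unfolding b0_def by (simp add: some_in_eq)
    define X where "X = (\<Sum>i\<in>J - {l}. convex hull V i)"
    have cX: "convex X" unfolding X_def by (intro convex_sum_sets) simp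
    have iX: "interior X \<noteq> {}" unfolding X_def 
      using less.prems l by (intro interior_sum_nonempty[of _ j]) auto
    have hX: "hollow (X + convex hull V l + span B)"
      using less.prems(7) sum.remove[OF less.prems(1) l(1), of "\<lambda>i. convex hull V i"]
      by (simp add: X_def add.commute)
    \<comment> \<open>Dropping \<open>l\<close> loses one index and adjoining \<open>b - c\<close>
      gains one dimension, so the balance between \<open>dim B\<close> and \<open>card J\<close>
      survives.\<close>
    have IH: "aff_indep_mod (span (insert (b - c) B)) A'"
      if bc: "b \<in> V l" "c \<in> V l" "b - c \<notin> span B" and A': "A' \<subseteq> V j" "inequiv_mod (span (insert (b - c) B)) A'"
      for b c A'
    proof (rule less.hyps[of "J - {l}"])
      show "card (J - {l}) < card J"
        by (rule psubset_card_mono) (use less.prems(1) l in auto)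
      show "dim (insert (b - c) B) + card (J - {l}) = CARD('n)"
        using bc less.prems(1,6) l(1) 2 by (simp add: dim_insert)
      have "b \<in> int_lattice" "c \<in> int_lattice"
        using bc less.prems(3)[OF l(1)] by auto
      then show "insert (b - c) B \<subseteq> int_lattice" 
        using less.prems(5) by (simp add: int_lattice_diff)
      show "hollow ((\<Sum>i\<in>J - {l}. convex hull V i) + span (insert (b - c) B))"
        unfolding X_def[symmetric]
        by (rule hollow_plus_span_insert[OF cX iX, of "convex hull V l"])
           (use bc less.prems(3)[OF l(1)] hX in \<open>auto intro: hull_inc\<close>)
    qed (use less.prems l A' in auto)
    have pick: "\<exists>c\<in>V l. c - b0 \<notin> span S" if "dim S < CARD('n)" for S
      using full_dim_difference[OF less.prems(4)[OF l(1)] _ span_ne_UNIV[OF that], of b0] by auto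
    have dB: "dim B + 2 \<le> CARD('n)" using less.prems(6) 2 by linarith
    show ?thesis
      unfolding aff_indep_mod_def
    proof (intro allI impI ballI, rule ccontr)
      fix c x assume c: "(\<Sum>x\<in>A. c x) = (0::real)" "(\<Sum>x\<in>A. c x *\<^sub>R x) \<in> span B" and x: "x \<in> A" "c x \<noteq> 0"
      \<comment> \<open>On the support no class can be a singleton, since its coefficient sum
        vanishes while its coefficients do not.\<close>
      define A' where "A' = {x \<in> A. c x \<noteq> 0}"
      have A': "A' \<subseteq> A" "finite A'" "x \<in> A'" using finA x by (auto simp: A'_def)
      have "(\<Sum>x\<in>A'. c x) = (\<Sum>x\<in>A. c x)"
        by (rule sum.mono_neutral_left[OF finA A'(1)]) (simp add: A'_def)
      moreover have "(\<Sum>x\<in>A'. c x *\<^sub>R x) = (\<Sum>x\<in>A. c x *\<^sub>R x)"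
        by (rule sum.mono_neutral_left[OF finA A'(1)]) (simp add: A'_def)
      ultimately have c': "(\<Sum>x\<in>A'. c x) = 0" "(\<Sum>x\<in>A'. c x *\<^sub>R x) \<in> span B"
        using c by simp_all
      have class_sum: "(\<Sum>y | y \<in> A' \<and> y - x \<in> span (insert (b - b') B). c y) = 0"
        if bb: "b \<in> V l" "b' \<in> V l" "b - b' \<notin> span B" and x: "x \<in> A'" for b b' x
      proof -
        let ?R = "span (insert (b - b') B)"
        obtain \<rho> where \<rho>: "\<And>x. x \<in> A' \<Longrightarrow> \<rho> x \<in> A'" "\<And>x. x \<in> A' \<Longrightarrow> \<rho> x - x \<in> ?R"
          "\<And>x y. x \<in> A' \<Longrightarrow> y \<in> A' \<Longrightarrow> \<rho> x = \<rho> y \<longleftrightarrow> x - y \<in> ?R"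
          "inequiv_mod ?R (\<rho> ` A')"
          using transversal_exists[of ?R A'] by auto
        have ai: "aff_indep_mod ?R (\<rho> ` A')"
          using \<rho>(1,4) A' less.prems(9) by (intro IH[OF bb]) auto
        have "span B \<subseteq> ?R" by (intro span_mono) auto
        define C where "C t = (\<Sum>x | x \<in> A' \<and> \<rho> x = t. c x)" for t
        have "(\<Sum>t\<in>\<rho>`A'. C t) = 0"
          using collapse_relation(1)[OF A'(2) subspace_span \<rho>(2), where c = c] c' by (simp add: C_def)
        moreover have "(\<Sum>t\<in>\<rho>`A'. C t *\<^sub>R t) \<in> ?R"
          using span_add[OF collapse_relation(2)[OF A'(2) subspace_span \<rho>(2), where c = c], of "\<Sum>x\<in>A'. c x *\<^sub>R x"] 
            c'(2) \<open>span B \<subseteq> ?R\<close> unfolding C_def by auto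
        ultimately have "C (\<rho> x) = 0"
          using ai x unfolding aff_indep_mod_def by blast
        moreover have "{y. y \<in> A' \<and> \<rho> y = \<rho> x} = {y. y \<in> A' \<and> y - x \<in> ?R}"
          using \<rho>(3) x by auto
        ultimately show ?thesis by (simp add: C_def)
      qed
      \<comment> \<open>Points of one class lie on a line modulo \<open>span B\<close>. A direction
        \<open>c2 - b0\<close> off this line keeps the three points inequivalent, so by induction
        three collinear points would be affinely independent.\<close>
      have no3: False if bb: "b \<in> V l" "b' \<in> V l" "b - b' \<notin> span B" and xyz: "x \<in> A'" "y \<in> A'" "z \<in> A'" "x \<noteq> y" "x \<noteq> z" "y \<noteq> z"
        and yx: "y - x \<in> span (insert (b - b') B)" and zx: "z - x \<in> span (insert (b - b') B)" for b b' x y z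
      proof -
        have "dim (insert (b - b') B) < CARD('n)"
          using dB by (simp add: dim_insert)
        then obtain c2 where c2: "c2 \<in> V l" "c2 - b0 \<notin> span (insert (b - b') B)" using pick by blast
        have c2B: "c2 - b0 \<notin> span B" using c2 span_mono[of B "insert (b - b') B"] by blast
        have sub: "span B \<subseteq> span (insert (c2 - b0) B)" by (intro span_mono) auto
        have yz: "y - z \<in> span (insert (b - b') B)" using span_diff[OF yx zx] by simp
        have R: "p - q \<in> span (insert (b - b') B)" if "p \<in> {x,y,z}" "q \<in> {x,y,z}" for p q
          using that yx zx yz span_neg[OF yx] span_neg[OF zx] span_neg[OF yz] by (auto simp: span_0)
        have "inequiv_mod (span (insert (c2 - b0) B)) {x, y, z}"
          unfolding inequiv_mod_def
        proof (intro ballI impI)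
          fix p q assume pq: "p \<in> {x,y,z}" "q \<in> {x,y,z}" "p - q \<in> span (insert (c2 - b0) B)"
          then have "p - q \<in> span B" using span_insert_Int[OF c2(2) R] by blast
          then show "p = q" using neq[of p q] pq xyz A'(1) by auto
        qed
        then have ai: "aff_indep_mod (span (insert (c2 - b0) B)) {x, y, z}"
          using xyz A' less.prems(9) by (intro IH[OF c2(1) b0 c2B]) auto
        obtain \<alpha> \<beta> where ab: "y - x - \<alpha> *\<^sub>R (b - b') \<in> span B" "z - x - \<beta> *\<^sub>R (b - b') \<in> span B"
          using yx zx mem_span_insert by blast
        have "(\<alpha> - \<beta>) *\<^sub>R x + \<beta> *\<^sub>R y + (-\<alpha>) *\<^sub>R z = \<beta> *\<^sub>R (y - x - \<alpha> *\<^sub>R (b - b')) - \<alpha> *\<^sub>R (z - x - \<beta> *\<^sub>R (b - b'))"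
          by (simp add: algebra_simps)
        also have "\<dots> \<in> span B" by (rule span_diff[OF span_scale[OF ab(1)] span_scale[OF ab(2)]])
        finally have "\<beta> = 0" 
          using sub aff_indep_modD3(2)[OF ai, of "\<alpha> - \<beta>" \<beta> "-\<alpha>"] xyz by auto
        then have "z - x \<in> span B" using ab by simp
        then show False using neq[of z x] xyz A' by auto
      qed
      have partner: "\<exists>y\<in>A'. y \<noteq> x \<and> y - x \<in> span (insert (b - b') B) \<and> c y = - c x"
        if bb: "b \<in> V l" "b' \<in> V l" "b - b' \<notin> span B" and x: "x \<in> A'" for b b' x
      proof -
        let ?C = "{y. y \<in> A' \<and> y - x \<in> span (insert (b - b') B)}"
        have s: "(\<Sum>y\<in>?C. c y) = 0" by (rule class_sum[OF that])
        have xC: "x \<in> ?C" using x by (simp add: span_0)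
        have "?C \<noteq> {x}" using s x by (auto simp: A'_def)
        then obtain y where y: "y \<in> ?C" "y \<noteq> x" using xC by blast
        have "z = x \<or> z = y" if z: "z \<in> ?C" for z
          using no3[OF bb x, of y z] y z by auto
        then have "?C = {x, y}"
          using xC y(1) by blast
        then have "c y = - c x" using s y by simp
        then show ?thesis using y by blast
      qed
      have "dim B < CARD('n)" using dB by simp
      then obtain c1 where c1: "c1 \<in> V l" "c1 - b0 \<notin> span B" using pick by blast
      have "dim (insert (c1 - b0) B) < CARD('n)" using dB by (simp add: dim_insert)
      then obtain c2 where c2: "c2 \<in> V l" "c2 - b0 \<notin> span (insert (c1 - b0) B)" using pick by blast
      \<comment> \<open>\<open>v\<close>, \<open>v2\<close> and \<open>v2 - v\<close> are all
        differences of points of \<open>V l\<close> and pairwise independent modulo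
        \<open>span B\<close>. Hence \<open>partner\<close> applies to each, and the three partners
        of \<open>x\<close> lie on different lines through \<open>x\<close>.\<close>
      define v where "v = c1 - b0"
      define v2 where "v2 = c2 - b0"
      have v3: "c2 - c1 = v2 - v" by (simp add: v_def v2_def)
      have v: "v \<notin> span B" using c1 by (simp add: v_def)
      have v2v: "v2 \<notin> span (insert v B)" using c2 by (simp add: v_def v2_def)
      have BS: "span B \<subseteq> span (insert a B)" for a by (intro span_mono) auto
      have v2: "v2 \<notin> span B" using v2v BS by blast
      have vin: "a \<in> span (insert a B)" for a by (simp add: span_base)
      have v3v: "v2 - v \<notin> span (insert v B)"
        using v2v vin[of v] span_add[of "v2 - v" "insert v B" v] by auto
      have v3v2: "v2 - v \<notin> span (insert v2 B)"
      proof
        assume "v2 - v \<in> span (insert v2 B)"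
        then have "v2 - (v2 - v) \<in> span (insert v2 B)" by (rule span_diff[OF vin])
        then have "v \<in> span (insert v2 B)" by simp
        then show False using v v2v span_insert_Int[of v2 v B v] vin by blast
      qed
      have v3B: "v2 - v \<notin> span B" using v3v BS by blast
      obtain p1 where p1: "p1 \<in> A'" "p1 \<noteq> x" "p1 - x \<in> span (insert v B)" "c p1 = - c x"
        using partner[OF c1(1) b0 _ A'(3)] v by (auto simp: v_def)
      obtain p2 where p2: "p2 \<in> A'" "p2 \<noteq> x" "p2 - x \<in> span (insert v2 B)" "c p2 = - c x"
        using partner[OF c2(1) b0 _ A'(3)] v2 by (auto simp: v2_def)
      obtain p3 where p3: "p3 \<in> A'" "p3 \<noteq> x" "p3 - x \<in> span (insert (v2 - v) B)" "c p3 = - c x"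
        using partner[OF c2(1) c1(1) _ A'(3)] v3B by (auto simp: v3)
      have nB: "p - x \<notin> span B" if "p \<in> A'" "p \<noteq> x" for p
        using neq[of p x] that A' by auto
      have p2v: "p2 - x \<notin> span (insert v B)"
        using span_insert_Int[OF v2v] nB[of p2] p2 by blast
      have p3v: "p3 - x \<notin> span (insert v B)"
        using span_insert_Int[OF v3v] nB[of p3] p3 by blast
      have p3v2: "p3 - x \<notin> span (insert v2 B)"
        using span_insert_Int[OF v3v2] nB[of p3] p3 by blast
      have dist: "distinct [x, p1, p2, p3]"
        using p1 p2 p3 p2v p3v p3v2 by auto
      show False
      proof (cases "dim B + 2 < CARD('n)")
        \<comment> \<open>There is room for a direction \<open>c4 - b0\<close> off the plane of
          \<open>v\<close> and \<open>v2\<close>. Modulo this direction the four points stay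
          inequivalent, hence affinely independent by induction; but they are coplanar, and
          expressing \<open>p3\<close> through \<open>x\<close>, \<open>p1\<close> and
          \<open>p2\<close> is a relation with coefficient 1 at \<open>p3\<close>.\<close>
        case True
        let ?E = "insert v2 (insert v B)"
        have "dim ?E < CARD('n)" using True by (simp add: dim_insert)
        then obtain c4 where c4: "c4 \<in> V l" "c4 - b0 \<notin> span ?E" using pick by blast
        have subE: "span (insert v B) \<subseteq> span ?E" "span (insert v2 B) \<subseteq> span ?E" "span B \<subseteq> span ?E"
          by (intro span_mono; auto)+
        have "v \<in> span ?E" "v2 \<in> span ?E" by (auto simp: span_base)
        then have "insert (v2 - v) B \<subseteq> span ?E"
          by (auto intro: span_diff span_base)
        then have subE3: "span (insert (v2 - v) B) \<subseteq> span ?E"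
          by (intro span_minimal) auto
        have pE: "p - x \<in> span ?E" if "p \<in> {x, p1, p2, p3}" for p
          using that subsetD[OF subE(1) p1(3)] subsetD[OF subE(2) p2(3)] subsetD[OF subE3 p3(3)]
          by (auto simp: span_0)
        have E: "p - q \<in> span ?E" if "p \<in> {x, p1, p2, p3}" "q \<in> {x, p1, p2, p3}" for p q
          using span_diff[OF pE[OF that(1)] pE[OF that(2)]] by simp
        have c4B: "c4 - b0 \<notin> span B" using c4 subE by blast
        have inA: "p \<in> A" if "p \<in> {x, p1, p2, p3}" for p
          using that p1 p2 p3 A' by auto
        have "inequiv_mod (span (insert (c4 - b0) B)) {x, p1, p2, p3}"
          unfolding inequiv_mod_def
        proof (intro ballI impI)
          fix p q assume pq: "p \<in> {x, p1, p2, p3}" "q \<in> {x, p1, p2, p3}" "p - q \<in> span (insert (c4 - b0) B)"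
          have "p - q \<in> span B"
          proof -
            obtain k where k: "p - q - k *\<^sub>R (c4 - b0) \<in> span B" using pq(3) mem_span_insert by blast
            have "k = 0"
            proof (rule ccontr)
              assume "k \<noteq> 0"
              have "(1/k) *\<^sub>R ((p - q) - (p - q - k *\<^sub>R (c4 - b0))) \<in> span ?E"
                by (rule span_scale[OF span_diff[OF E[OF pq(1,2)] subsetD[OF subE(3) k]]])
              then show False using \<open>k \<noteq> 0\<close> c4 by simp
            qed
            then show ?thesis using k by simp
          qed
          then show "p = q" using neq[of p q] inA pq by blast
        qed
        then have ai: "aff_indep_mod (span (insert (c4 - b0) B)) {x, p1, p2, p3}"
          using inA less.prems(9) by (intro IH[OF c4(1) b0 c4B]) blast
        obtain \<alpha> where a: "p1 - x - \<alpha> *\<^sub>R v \<in> span B" using p1(3) unfolding mem_span_insert by blast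
        obtain \<beta> where b: "p2 - x - \<beta> *\<^sub>R v2 \<in> span B" using p2(3) unfolding mem_span_insert by blast
        obtain \<gamma> where g: "p3 - x - \<gamma> *\<^sub>R (v2 - v) \<in> span B" using p3(3) unfolding mem_span_insert by blast
        have "\<alpha> \<noteq> 0" "\<beta> \<noteq> 0" using a b nB[OF p1(1,2)] nB[OF p2(1,2)] by auto
        then have "(\<gamma> / \<beta> - \<gamma> / \<alpha> - 1) *\<^sub>R x + (\<gamma> / \<alpha>) *\<^sub>R p1 + (- (\<gamma> / \<beta>)) *\<^sub>R p2 + 1 *\<^sub>R p3
           = (p3 - x - \<gamma> *\<^sub>R (v2 - v)) - (\<gamma> / \<beta>) *\<^sub>R (p2 - x - \<beta> *\<^sub>R v2) + (\<gamma> / \<alpha>) *\<^sub>R (p1 - x - \<alpha> *\<^sub>R v)"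
          by (simp add: algebra_simps)
        also have "\<dots> \<in> span B" by (rule span_add[OF span_diff[OF g span_scale[OF b]] span_scale[OF a]])
        finally have "(\<gamma> / \<beta> - \<gamma> / \<alpha> - 1) *\<^sub>R x + (\<gamma> / \<alpha>) *\<^sub>R p1 + (- (\<gamma> / \<beta>)) *\<^sub>R p2 + 1 *\<^sub>R p3
          \<in> span (insert (c4 - b0) B)" using BS by blast
        then show False
          using aff_indep_modD4[OF ai dist, of "\<gamma> / \<beta> - \<gamma> / \<alpha> - 1" "\<gamma> / \<alpha>" "- (\<gamma> / \<beta>)" 1] by simp
      next
        \<comment> \<open>Now \<open>span (insert v B)\<close> is a hyperplane, and three points
          inequivalent modulo it would be affinely independent on a line. So \<open>p2\<close> and
          \<open>p3\<close> share a class and must be partners of each other; their coefficients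
          would be opposite, yet both equal \<open>- c x\<close>.\<close>
        case False
        have dv: "dim (insert v B) = CARD('n) - 1"
          using False dB v by (simp add: dim_insert)
        have "c1 \<in> int_lattice" "b0 \<in> int_lattice" using c1(1) b0 less.prems(3)[OF l(1)] by blast+
        then have "v \<in> int_lattice" unfolding v_def by (rule int_lattice_diff)
        then have vint: "insert v B \<subseteq> int_lattice" using less.prems(5) by blast
        obtain f :: "real^'n \<Rightarrow> real" where f: "linear f" "{x. f x = 0} = span (insert v B)"
          by (rule primitive_functional[OF vint dv])
        interpret f: linear f by (fact f(1))
        have "p2 - p3 \<in> span (insert v B)"
        proof (rule ccontr)
          assume n: "p2 - p3 \<notin> span (insert v B)"
          have n': "p3 - p2 \<notin> span (insert v B)" "x - p2 \<notin> span (insert v B)" "x - p3 \<notin> span (insert v B)"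
            using n p2v p3v span_neg[of "p3 - p2" "insert v B"] span_neg[of "x - p2" "insert v B"] 
              span_neg[of "x - p3" "insert v B"] by auto
          have "inequiv_mod (span (insert v B)) {x, p2, p3}"
            using n n' p2v p3v by (auto simp: inequiv_mod_def)
          then have ai: "aff_indep_mod (span (insert v B)) {x, p2, p3}"
            using v A' p2 p3 less.prems(9) unfolding v_def by (intro IH[OF c1(1) b0]) auto
          have "f ((f p2 - f p3) *\<^sub>R x + (f p3 - f x) *\<^sub>R p2 + (f x - f p2) *\<^sub>R p3) = 0"
            unfolding f.add f.scale by (simp add: algebra_simps)
          then have "(f p2 - f p3) *\<^sub>R x + (f p3 - f x) *\<^sub>R p2 + (f x - f p2) *\<^sub>R p3 \<in> span (insert v B)"
            using f(2) by blast
          moreover have "x \<noteq> p2" "x \<noteq> p3" "p2 \<noteq> p3" using dist by auto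
          moreover have "(f p2 - f p3) + (f p3 - f x) + (f x - f p2) = 0" by simp
          ultimately have "f p2 - f p3 = 0"
            using aff_indep_modD3(1)[OF ai] by blast
          then have "f (p2 - p3) = 0" by (simp add: f.diff)
          then show False using n f(2) by blast
        qed
        from span_neg[OF this] have p32: "p3 - p2 \<in> span (insert v B)" by simp
        obtain q where q: "q \<in> A'" "q \<noteq> p2" "q - p2 \<in> span (insert v B)" "c q = - c p2"
          using partner[OF c1(1) b0 _ p2(1)] v by (auto simp: v_def)
        have "q = p3"
          using no3[OF c1(1) b0 _ p2(1) q(1) p3(1)] v q dist p32 by (auto simp: v_def)
        then show False using q p2 p3 x by simp
      qed
    qed
  qed
qed

section \<open>Projection to a unimodular simplex\<close>

text \<open>A polytope is carried by a finite generating set, which need not consist of vertices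
  only: translations and linear maps then act on points, and the hull is taken afterwards.\<close>

definition lattice_body :: "(real^'n) set \<Rightarrow> bool" where
  "lattice_body W \<longleftrightarrow> finite W \<and> W \<subseteq> int_lattice \<and> interior (convex hull W) \<noteq> {}"

section \<open>Coordinates modulo a line\<close>

lemma full_dim_combination:
  fixes W :: "'a::euclidean_space set"
  assumes "finite W" "interior (convex hull W) \<noteq> {}"
  obtains c where "(\<Sum>x\<in>W. c x) = (0::real)" "(\<Sum>x\<in>W. c x *\<^sub>R x) = z"
proof -
  have "affine hull W = UNIV"
    using affine_hull_nonempty_interior[OF assms(2)] by simp
  then have "z \<in> affine hull W" "0 \<in> affine hull W" by auto
  then obtain u u' where "sum u W = 1" "(\<Sum>x\<in>W. u x *\<^sub>R x) = z" "sum u' W = 1" "(\<Sum>x\<in>W. u' x *\<^sub>R x) = 0"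
    unfolding affine_hull_finite[OF assms(1)] by blast
  then show ?thesis
    by (intro that[of "\<lambda>x. u x - u' x"]) (simp_all add: sum_subtractf scaleR_left_diff_distrib)
qed

lemma transversal_combination:
  fixes W :: "'a::euclidean_space set"
  assumes "finite W" "interior (convex hull W) \<noteq> {}" "subspace R" "\<And>x. x \<in> W \<Longrightarrow> \<rho> x - x \<in> R"
  obtains c where "(\<Sum>t\<in>\<rho>`W. c t) = (0::real)" "(\<Sum>t\<in>\<rho>`W. c t *\<^sub>R t) - z \<in> R"
proof -
  obtain c where c: "(\<Sum>x\<in>W. c x) = (0::real)" "(\<Sum>x\<in>W. c x *\<^sub>R x) = z"
    using full_dim_combination[OF assms(1,2)] by blast
  show ?thesis
  proof (rule that)
    show "(\<Sum>t\<in>\<rho>`W. \<Sum>x | x \<in> W \<and> \<rho> x = t. c x) = 0"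
      using collapse_relation(1)[OF assms(1,3,4), where c = c] c by simp
    show "(\<Sum>t\<in>\<rho>`W. (\<Sum>x | x \<in> W \<and> \<rho> x = t. c x) *\<^sub>R t) - z \<in> R"
      using collapse_relation(2)[OF assms(1,3,4), where c = c] c by simp
  qed
qed

text \<open>If \<open>V i\<close> had no such difference, its representatives modulo
  \<open>w\<close> would stay inequivalent after factoring out \<open>b - c\<close> as well, hence
  be affinely independent there. But full-dimensionality writes \<open>b - c\<close> modulo
  \<open>w\<close> as a zero-sum combination of these representatives; modulo both directions this
  is a relation, so all coefficients vanish and \<open>b - c\<close> is a multiple of
  \<open>w\<close>.\<close>

lemma parallel_difference:
  fixes V :: "'i \<Rightarrow> (real^'n) set"
  assumes I: "finite I" "card I + 1 = CARD('n)" and V: "\<And>i. i \<in> I \<Longrightarrow> lattice_body (V i)"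
    and w: "w \<in> int_lattice" "w \<noteq> 0" and hol: "hollow ((\<Sum>i\<in>I. convex hull V i) + span {w})"
    and il: "i \<in> I" "l \<in> I" "i \<noteq> l" and bc: "b \<in> V l" "c \<in> V l" "b - c \<notin> span {w}"
  shows "\<exists>b'\<in>V i. \<exists>c'\<in>V i. b' - c' \<notin> span {w} \<and> b' - c' \<in> span {b - c, w}"
proof (rule ccontr)
  assume no: "\<not> ?thesis"
  obtain \<rho> where \<rho>: "\<And>x. x \<in> V i \<Longrightarrow> \<rho> x \<in> V i" "\<And>x. x \<in> V i \<Longrightarrow> \<rho> x - x \<in> span {w}"
      "inequiv_mod (span {w}) (\<rho> ` V i)"
    by (rule transversal_exists[OF subspace_span]) (rule that)
  have sub: "\<rho> ` V i \<subseteq> V i" using \<rho>(1) by blast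
  have ineq: "inequiv_mod (span {b - c, w}) (\<rho> ` V i)"
    unfolding inequiv_mod_def
  proof (intro ballI impI)
    fix x y assume xy: "x \<in> \<rho> ` V i" "y \<in> \<rho> ` V i" "x - y \<in> span {b - c, w}"
    then have "x - y \<in> span {w}" using no sub by blast
    then show "x = y" using \<rho>(3) xy unfolding inequiv_mod_def by blast
  qed
  define X where "X = (\<Sum>k\<in>I - {l}. convex hull V k)"
  have cX: "convex X" unfolding X_def by (intro convex_sum_sets) simp
  have iX: "interior X \<noteq> {}" unfolding X_def
    using I il V by (intro interior_sum_nonempty[of _ i]) (auto simp: lattice_body_def)
  have hX: "hollow (X + convex hull V l + span {w})"
    using hol sum.remove[OF I(1) il(2), of "\<lambda>i. convex hull V i"]
    by (simp add: X_def add.commute)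
  have lat: "b \<in> int_lattice" "c \<in> int_lattice"
    using bc V[OF il(2)] by (auto simp: lattice_body_def)
  have ai: "aff_indep_mod (span {b - c, w}) (\<rho> ` V i)"
  proof (rule affine_independence_mod_hollow_sum[of "I - {l}" V "{b - c, w}" i])
    show "hollow ((\<Sum>k\<in>I - {l}. convex hull V k) + span {b - c, w})"
      unfolding X_def[symmetric]
      by (rule hollow_plus_span_insert[OF cX iX _ _ _ lat hX]) (use bc in \<open>auto intro: hull_inc\<close>)
    have "card (I - {l}) + 1 = card I" using I il by (metis Suc_eq_plus1 card_Suc_Diff1)
    moreover have "dim {b - c, w} = 2" using bc(3) w(2) by (simp add: dim_insert)
    ultimately show "dim {b - c, w} + card (I - {l}) = CARD('n)" using I(2) by linarith
    show "{b - c, w} \<subseteq> int_lattice" using lat w int_lattice_diff by blast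
  qed (use I V il sub ineq in \<open>auto simp: lattice_body_def\<close>)
  have fV: "finite (V i)" "interior (convex hull V i) \<noteq> {}"
    using V[OF il(1)] by (auto simp: lattice_body_def)
  obtain C where C: "(\<Sum>t\<in>\<rho>`V i. C t) = (0::real)" "(\<Sum>t\<in>\<rho>`V i. C t *\<^sub>R t) - (b - c) \<in> span {w}"
    by (rule transversal_combination[OF fV subspace_span \<rho>(2), where z = "b - c"])
  have "(\<Sum>t\<in>\<rho>`V i. C t *\<^sub>R t) - (b - c) \<in> span {b - c, w}"
    using C(2) span_mono[of "{w}" "{b - c, w}"] by blast
  from span_add[OF this span_base, of "b - c"] have "(\<Sum>t\<in>\<rho>`V i. C t *\<^sub>R t) \<in> span {b - c, w}" by simp
  then have "\<forall>t\<in>\<rho>`V i. C t = 0" using ai C(1) unfolding aff_indep_mod_def by blast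
  then have "(\<Sum>t\<in>\<rho>`V i. C t *\<^sub>R t) = 0" by (intro sum.neutral) simp
  then show False using C(2) bc(3) span_neg[of "-(b-c)" "{w}"] by simp
qed

text \<open>The representatives of \<open>W\<close> modulo \<open>w\<close> are affinely independent
  and affinely generate everything modulo \<open>w\<close>. With one of them as origin, the
  remaining differences together with \<open>w\<close> form a basis, which forces their number to be
  \<open>CARD('m)\<close>; \<open>\<phi>\<close> reads off the coordinates other than that of
  \<open>w\<close>.\<close>

lemma simplex_coordinates_exist:
  fixes W :: "(real^'n) set"
  assumes W: "lattice_body W" and w: "w \<noteq> 0" and dims: "CARD('m) + 1 = CARD('n)"
    and ai: "\<And>A. A \<subseteq> W \<Longrightarrow> inequiv_mod (span {w}) A \<Longrightarrow> aff_indep_mod (span {w}) A"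
  obtains a0 and a :: "'m::finite \<Rightarrow> real^'n" and \<phi> :: "real^'n \<Rightarrow> real^'m"
  where "a0 \<in> W" "\<And>l. a l \<in> W" "linear \<phi>" "\<And>l. \<phi> (a l - a0) = axis l 1" "{z. \<phi> z = 0} = span {w}"
proof -
  obtain \<rho> where \<rho>: "\<And>x. x \<in> W \<Longrightarrow> \<rho> x \<in> W" "\<And>x. x \<in> W \<Longrightarrow> \<rho> x - x \<in> span {w}"
      "inequiv_mod (span {w}) (\<rho> ` W)"
    by (rule transversal_exists[OF subspace_span]) (rule that)
  have finW: "finite W" and iW: "interior (convex hull W) \<noteq> {}" using W by (auto simp: lattice_body_def)
  define A where "A = \<rho> ` W"
  have A: "finite A" "A \<subseteq> W" using finW \<rho>(1) by (auto simp: A_def)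
  have A3: "aff_indep_mod (span {w}) A" using ai[OF A(2)] \<rho>(3) by (simp add: A_def)
  have "W \<noteq> {}" using iW by auto
  then obtain a0 where a0: "a0 \<in> A" by (auto simp: A_def)
  define A0 where "A0 = A - {a0}"
  define D where "D = (\<lambda>x. x - a0) ` A0"
  have inj: "inj_on (\<lambda>x. x - a0) A0" by (auto simp: inj_on_def)
  have finA0: "finite A0" using A by (simp add: A0_def)
  have finD: "finite D" using finA0 by (simp add: D_def)
  \<comment> \<open>Affine independence in linear form: giving \<open>a0\<close> the negative of the
    total coefficient turns a linear relation of differences into an affine one.\<close>
  have key: "\<forall>x\<in>A0. u x = 0" if "(\<Sum>x\<in>A0. u x *\<^sub>R (x - a0)) \<in> span {w}" for u
  proof -
    define c where "c = (\<lambda>x. if x = a0 then - sum u A0 else u x)"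
    have eq: "(\<Sum>x\<in>A0. c x) = sum u A0" "(\<Sum>x\<in>A0. c x *\<^sub>R x) = (\<Sum>x\<in>A0. u x *\<^sub>R x)"
      by (auto simp: c_def A0_def intro!: sum.cong)
    have "(\<Sum>x\<in>A. c x) = 0"
      using sum.remove[OF A(1) a0, of c] eq by (simp add: A0_def[symmetric] c_def)
    moreover have "(\<Sum>x\<in>A. c x *\<^sub>R x) = (\<Sum>x\<in>A0. u x *\<^sub>R (x - a0))"
      using sum.remove[OF A(1) a0, of "\<lambda>x. c x *\<^sub>R x"] eq
      by (simp add: A0_def[symmetric] c_def scaleR_right_diff_distrib sum_subtractf scaleR_left.sum)
    ultimately have c0: "\<forall>x\<in>A. c x = 0" using A3 that unfolding aff_indep_mod_def by simp
    have "u x = 0" if "x \<in> A0" for x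
      using bspec[OF c0, of x] that by (simp add: c_def A0_def)
    then show ?thesis by blast
  qed
  have wD: "w \<notin> D"
  proof
    assume "w \<in> D"
    then obtain x where x: "x \<in> A0" "w = x - a0" by (auto simp: D_def)
    have "(\<Sum>y\<in>A0. (if y = x then 1 else 0) *\<^sub>R (y - a0)) = (\<Sum>y\<in>A0. if y = x then w else 0)"
      using x by (intro sum.cong) auto
    also have "\<dots> = w" using x(1) finA0 by simp
    finally have "(\<Sum>y\<in>A0. (if y = x then 1 else 0) *\<^sub>R (y - a0)) \<in> span {w}" by (simp add: span_base)
    from key[OF this] show False using x(1) by auto
  qed
  have ind: "independent (insert w D)"
  proof (rule independent_if_scalars_zero)
    show "finite (insert w D)" using finD by simp
    fix f x assume f: "(\<Sum>x\<in>insert w D. f x *\<^sub>R x) = 0" and x: "x \<in> insert w D"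
    have s: "f w *\<^sub>R w + (\<Sum>x\<in>A0. f (x - a0) *\<^sub>R (x - a0)) = 0"
      using f finD wD by (simp add: D_def sum.reindex[OF inj])
    then have "(\<Sum>x\<in>A0. f (x - a0) *\<^sub>R (x - a0)) = (- f w) *\<^sub>R w"
      by (simp add: add_eq_0_iff)
    then have z: "\<forall>x\<in>A0. f (x - a0) = 0"
      by (intro key) (simp add: span_base span_scale span_neg)
    then have "f w *\<^sub>R w = 0" using s by simp
    then show "f x = 0" using x z w by (auto simp: D_def)
  qed
  have spn: "span (insert w D) = UNIV"
  proof -
    have "z \<in> span (insert w D)" for z
    proof -
      obtain C where C: "(\<Sum>t\<in>A. C t) = (0::real)" "(\<Sum>t\<in>A. C t *\<^sub>R t) - z \<in> span {w}"
        unfolding A_def by (rule transversal_combination[OF finW iW subspace_span \<rho>(2), where z = z])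
      have "C a0 = - (\<Sum>t\<in>A0. C t)" using C(1) sum.remove[OF A(1) a0, of C] by (simp add: A0_def)
      then have "(\<Sum>t\<in>A. C t *\<^sub>R t) = (\<Sum>t\<in>A0. C t *\<^sub>R (t - a0))"
        using sum.remove[OF A(1) a0, of "\<lambda>x. C x *\<^sub>R x"]
        by (simp add: A0_def[symmetric] scaleR_right_diff_distrib sum_subtractf scaleR_left.sum)
      also have "\<dots> \<in> span (insert w D)"
        by (intro span_sum span_scale span_base) (auto simp: D_def)
      finally have "(\<Sum>t\<in>A. C t *\<^sub>R t) \<in> span (insert w D)" .
      moreover have "(\<Sum>t\<in>A. C t *\<^sub>R t) - z \<in> span (insert w D)"
        using C(2) span_mono[of "{w}" "insert w D"] by blast
      ultimately have "(\<Sum>t\<in>A. C t *\<^sub>R t) - ((\<Sum>t\<in>A. C t *\<^sub>R t) - z) \<in> span (insert w D)"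
        by (rule span_diff)
      then show ?thesis by simp
    qed
    then show ?thesis by blast
  qed
  have "card (insert w D) = CARD('n)"
    using dim_eq_card_independent[OF ind] spn dim_span[of "insert w D"] by simp
  then have "card A0 = CARD('m)"
    using wD finD dims card_image[OF inj] by (simp add: D_def)
  then obtain a :: "'m \<Rightarrow> real^'n" where a: "bij_betw a UNIV A0"
    using finite_same_card_bij[of "UNIV :: 'm set" A0] finA0 by auto
  define b where "b = inv_into UNIV a"
  have ainj: "inj a" using a by (simp add: bij_betw_def)
  define g where "g x = (if x = w then 0 else axis (b (x + a0)) (1::real))" for x
  obtain \<phi> where \<phi>: "linear \<phi>" "\<forall>x\<in>insert w D. \<phi> x = g x"
    using linear_independent_extend[OF ind] by blast
  interpret \<phi>: linear \<phi> by (fact \<phi>(1))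
  have aA0: "a l \<in> A0" for l using a by (auto simp: bij_betw_def)
  then have aD: "a l - a0 \<in> D" for l by (auto simp: D_def)
  have \<phi>a: "\<phi> (a l - a0) = axis l 1" for l
  proof -
    have "a l - a0 \<noteq> w" using aD wD by metis
    then show ?thesis using \<phi>(2) aD[of l] ainj by (simp add: g_def b_def)
  qed
  have \<phi>w: "\<phi> w = 0" using \<phi>(2) by (simp add: g_def)
  have "{z. \<phi> z = 0} = span {w}"
  proof
    show "span {w} \<subseteq> {z. \<phi> z = 0}"
      by (auto simp: span_singleton \<phi>.scale \<phi>w)
    show "{z. \<phi> z = 0} \<subseteq> span {w}"
    proof
      fix z assume "z \<in> {z. \<phi> z = 0}"
      then have z: "\<phi> z = 0" by simp
      have "z \<in> span (insert w D)" using spn by simp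
      then obtain u where u: "z = (\<Sum>x\<in>insert w D. u x *\<^sub>R x)"
        using finD by (auto simp: span_finite)
      then have zu: "z = u w *\<^sub>R w + (\<Sum>x\<in>A0. u (x - a0) *\<^sub>R (x - a0))"
        using finD wD by (simp add: D_def sum.reindex[OF inj])
      also have "(\<Sum>x\<in>A0. u (x - a0) *\<^sub>R (x - a0)) = (\<Sum>l\<in>UNIV. u (a l - a0) *\<^sub>R (a l - a0))"
        using sum.reindex_bij_betw[OF a, of "\<lambda>x. u (x - a0) *\<^sub>R (x - a0)"] by simp
      finally have zs: "z = u w *\<^sub>R w + (\<Sum>l\<in>UNIV. u (a l - a0) *\<^sub>R (a l - a0))" .
      then have "\<phi> z = (\<Sum>l\<in>UNIV. u (a l - a0) *\<^sub>R axis l 1)"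
        by (simp add: \<phi>.add \<phi>.scale \<phi>.sum \<phi>w \<phi>a)
      then have "(\<Sum>l\<in>UNIV. u (a l - a0) *\<^sub>R axis l (1::real)) $ k = 0" for k using z by simp
      then have "u (a k - a0) = 0" for k by (simp add: axis_def if_distrib cong: if_cong)
      then have "z = u w *\<^sub>R w" using zs by simp
      then show "z \<in> span {w}" by (simp add: span_base span_scale)
    qed
  qed
  then show ?thesis
    using that[of a0 a \<phi>] a0 aA0 A \<phi>(1) \<phi>a by (auto simp: A0_def)
qed

text \<open>Every polytope with index in \<open>K\<close> owns a difference parallel, modulo
  \<open>w\<close>, to any prescribed edge \<open>a l - a0\<close>. A bijection from
  \<open>K\<close> to \<open>L\<close> tells which edge each of them is traded for, so the remaining
  polytopes stay hollow modulo exactly these edges.\<close>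

lemma hollow_plus_edges:
  fixes V :: "'i \<Rightarrow> (real^'n) set" and a :: "'m::finite \<Rightarrow> real^'n"
  assumes I: "finite I" "card I + 1 = CARD('n)" and V: "\<And>i. i \<in> I \<Longrightarrow> lattice_body (V i)"
    and w: "w \<in> int_lattice" "w \<noteq> 0" and hol: "hollow ((\<Sum>i\<in>I. convex hull V i) + span {w})"
    and i: "i \<in> I" "a0 \<in> V i" "\<And>l. a l \<in> V i" "\<And>l. a l - a0 \<notin> span {w}"
    and K: "K \<subseteq> I" "card K = card L"
    and X: "convex X" "interior X \<noteq> {}" "X = (\<Sum>k\<in>I - K. convex hull V k)"
  shows "hollow (X + span (insert w ((\<lambda>l. a l - a0) ` L)))"
proof -
  have finK: "finite K" using K(1) I(1) by (rule finite_subset)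
  obtain \<beta> where \<beta>: "bij_betw \<beta> K L"
    using finite_same_card_bij[OF finK _ K(2)] finite[of L] by blast
  have "\<exists>u. (\<exists>b\<in>V k. \<exists>c\<in>V k. u = b - c) \<and> a (\<beta> k) - a0 \<in> span {u, w}" if k: "k \<in> K" for k
  proof (cases "k = i")
    case True
    then show ?thesis using i by (intro exI[of _ "a (\<beta> k) - a0"]) (auto simp: span_base)
  next
    case False
    have "\<exists>b'\<in>V k. \<exists>c'\<in>V k. b' - c' \<notin> span {w} \<and> b' - c' \<in> span {a (\<beta> k) - a0, w}"
      by (rule parallel_difference[OF I V w hol _ i(1) False i(3,2) i(4)]) (use k K in auto)
    then obtain b' c' where bc: "b' \<in> V k" "c' \<in> V k" "b' - c' \<notin> span {w}" "b' - c' \<in> span {a (\<beta> k) - a0, w}"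
      by blast
    obtain s where s: "b' - c' - s *\<^sub>R (a (\<beta> k) - a0) \<in> span {w}" using bc(4) mem_span_insert by blast
    have "s \<noteq> 0" using s bc(3) by auto
    have mono: "span {w} \<subseteq> span {b' - c', w}" by (intro span_mono) auto
    have "b' - c' \<in> span {b' - c', w}" by (simp add: span_base)
    then have "(1/s) *\<^sub>R ((b' - c') - (b' - c' - s *\<^sub>R (a (\<beta> k) - a0))) \<in> span {b' - c', w}"
      using s mono by (intro span_scale) (rule span_diff, auto)
    then show ?thesis using \<open>s \<noteq> 0\<close> bc by (intro exI[of _ "b' - c'"]) auto
  qed
  then obtain u where u: "\<And>k. k \<in> K \<Longrightarrow> \<exists>b\<in>V k. \<exists>c\<in>V k. u k = b - c"
      "\<And>k. k \<in> K \<Longrightarrow> a (\<beta> k) - a0 \<in> span {u k, w}"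
    by metis
  have "hollow (X + (\<Sum>k\<in>K. convex hull V k) + span {w})"
    using hol sum.subset_diff[OF K(1) I(1), of "\<lambda>k. convex hull V k"] X(3) by simp
  then have h: "hollow (X + span (u ` K \<union> {w}))"
    by (rule hollow_plus_span_family[OF X(1,2) finK _ u(1), rotated 2])
       (use V K in \<open>auto simp: lattice_body_def\<close>)
  have "(\<lambda>l. a l - a0) ` L \<subseteq> span (u ` K \<union> {w})"
  proof clarify
    fix l assume "l \<in> L"
    then obtain k where k: "k \<in> K" "l = \<beta> k" using \<beta> by (auto simp: bij_betw_def)
    have "span {u k, w} \<subseteq> span (u ` K \<union> {w})" using k by (intro span_mono) auto
    then show "a l - a0 \<in> span (u ` K \<union> {w})" using u(2)[OF k(1)] k(2) by blast
  qed
  then have "span (insert w ((\<lambda>l. a l - a0) ` L)) \<subseteq> span (u ` K \<union> {w})"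
    by (intro span_minimal) (auto simp: span_base)
  then show ?thesis
    by (intro hollow_mono[OF h] set_plus_mono2 order_refl)
qed

lemma coordinate_kernel:
  fixes \<phi> :: "real^'n \<Rightarrow> real^'m"
  assumes \<phi>: "linear \<phi>" "\<And>l. \<phi> (a l - a0) = axis l 1" "{z. \<phi> z = 0} = span {w}"
    and z: "\<And>l. l \<notin> L \<Longrightarrow> \<phi> z $ l = 0"
  shows "z \<in> span (insert w ((\<lambda>l. a l - a0) ` L))"
proof -
  interpret \<phi>: linear \<phi> by (fact \<phi>(1))
  define y where "y = (\<Sum>l\<in>L. (\<phi> z $ l) *\<^sub>R (a l - a0))"
  have "\<phi> y = (\<Sum>l\<in>L. (\<phi> z $ l) *\<^sub>R axis l 1)"
    unfolding y_def \<phi>.sum \<phi>.scale \<phi>(2) ..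
  then have "\<phi> y $ k = \<phi> z $ k" for k
    using z[of k] by (auto simp: axis_def if_distrib cong: if_cong)
  then have "\<phi> (z - y) = 0" by (simp add: \<phi>.diff vec_eq_iff)
  then have "z - y \<in> span {w}" using \<phi>(3) by blast
  then have "z - y \<in> span (insert w ((\<lambda>l. a l - a0) ` L))"
    using span_mono[of "{w}" "insert w ((\<lambda>l. a l - a0) ` L)"] by blast
  moreover have "y \<in> span (insert w ((\<lambda>l. a l - a0) ` L))"
    unfolding y_def by (intro span_sum span_scale span_base) auto
  ultimately have "(z - y) + y \<in> span (insert w ((\<lambda>l. a l - a0) ` L))" by (rule span_add)
  then show ?thesis by simp
qed

text \<open>Each coordinate of \<open>\<phi>\<close> agrees up to sign with a primitive integer functional.\<close>

lemma coordinates_integral_width: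
  fixes V :: "'i \<Rightarrow> (real^'n) set" and a :: "'m::finite \<Rightarrow> real^'n" and \<phi> :: "real^'n \<Rightarrow> real^'m"
  assumes I: "finite I" "card I + 1 = CARD('n)" "CARD('m) + 1 = CARD('n)" 
    and V: "\<And>i. i \<in> I \<Longrightarrow> lattice_body (V i)"
    and w: "w \<in> int_lattice" "w \<noteq> 0" and hol: "hollow ((\<Sum>i\<in>I. convex hull V i) + span {w})"
    and i: "i \<in> I" "a0 \<in> V i" "\<And>l. a l \<in> V i"
    and \<phi>: "linear \<phi>" "\<And>l. \<phi> (a l - a0) = axis l 1" "{z. \<phi> z = 0} = span {w}"
  shows "\<And>z. z \<in> int_lattice \<Longrightarrow> \<phi> z $ l \<in> \<int>"
    and "\<And>j x y. j \<in> I \<Longrightarrow> x \<in> V j \<Longrightarrow> y \<in> V j \<Longrightarrow> \<phi> x $ l - \<phi> y $ l \<le> 1"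
proof -
  interpret \<phi>: linear \<phi> by (fact \<phi>(1))
  \<comment> \<open>\<open>B\<close> spans the hyperplane on which the coordinate \<open>l\<close>
    of \<open>\<phi>\<close> vanishes.\<close>
  define B where "B = insert w ((\<lambda>k. a k - a0) ` (UNIV - {l}))"
  have nw: "a k - a0 \<notin> span {w}" for k
    using \<phi>(2)[of k] \<phi>(3) by (metis (mono_tags) axis_eq_0_iff mem_Collect_eq zero_neq_one)
  have \<phi>w: "\<phi> w = 0" using \<phi>(3) span_base[of w "{w}"] by blast
  have Vi: "V i \<subseteq> int_lattice" using V[OF i(1)] by (simp add: lattice_body_def)
  have Bint: "B \<subseteq> int_lattice"
    using w i Vi by (auto simp: B_def intro!: int_lattice_diff)
  have spB: "span B = {z. \<phi> z $ l = 0}"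
  proof
    have "subspace {z. \<phi> z $ l = 0}" by (rule subspaceI) (simp_all add: \<phi>.add \<phi>.scale)
    moreover have "B \<subseteq> {z. \<phi> z $ l = 0}" using \<phi>(2) \<phi>w by (auto simp: B_def axis_def)
    ultimately show "span B \<subseteq> {z. \<phi> z $ l = 0}" by (intro span_minimal)
    show "{z. \<phi> z $ l = 0} \<subseteq> span B"
      unfolding B_def using coordinate_kernel[OF \<phi>, of "UNIV - {l}"] by blast
  qed
  have al: "a l - a0 \<notin> span B" by (simp add: spB \<phi>(2))
  have decomp: "z - (\<phi> z $ l) *\<^sub>R (a l - a0) \<in> span B" for z
  proof -
    have "\<phi> (z - (\<phi> z $ l) *\<^sub>R (a l - a0)) = \<phi> z - (\<phi> z $ l) *\<^sub>R axis l 1"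
      by (simp only: \<phi>.diff[of z] \<phi>.scale \<phi>(2))
    then show ?thesis by (simp add: spB)
  qed
  have "span (insert (a l - a0) B) = UNIV"
    using decomp mem_span_insert by blast
  then have "dim (insert (a l - a0) B) = CARD('n)" by (metis dim_span dim_UNIV DIM_cart DIM_real mult.right_neutral)
  then have dB: "dim B = CARD('n) - 1" using al by (simp add: dim_insert)
  obtain f :: "real^'n \<Rightarrow> real" where f: "linear f" "\<And>z. z \<in> int_lattice \<Longrightarrow> f z \<in> \<int>"
      "\<exists>z\<in>int_lattice. f z = 1" "{x. f x = 0} = span B"
    by (rule primitive_functional[OF Bint dB]) blast
  interpret f: linear f by (fact f(1))
  obtain z0 where z0: "z0 \<in> int_lattice" "f z0 = 1" using f by blast
  define \<mu> where "\<mu> = f (a l - a0)"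
  have f\<phi>: "f z = (\<phi> z $ l) * \<mu>" for z
  proof -
    have "f (z - (\<phi> z $ l) *\<^sub>R (a l - a0)) = 0" using decomp f(4) by blast
    then show ?thesis by (simp add: f.diff[of z] f.scale \<mu>_def)
  qed
  have width: "f y - f x \<le> 1" if "j \<in> I" "x \<in> V j" "y \<in> V j" for j x y
  proof (rule width_le_one[OF f(1) z0, of "convex hull V j"])
    \<comment> \<open>All polytopes except \<open>V j\<close> are traded for the edges other than
      \<open>l\<close>; the numbers agree, both being \<open>CARD('n) - 2\<close>.\<close>
    have "hollow (convex hull V j + span B)"
      unfolding B_def
    proof (rule hollow_plus_edges[OF I(1,2) V w hol i nw])
      show "card (I - {j}) = card (UNIV - {l})" using I that(1) by (simp add: card_Diff_singleton)
      have "I - (I - {j}) = {j}" using that(1) by blast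
      then show "convex hull V j = (\<Sum>k\<in>I - (I - {j}). convex hull V k)" by simp
      show "interior (convex hull V j) \<noteq> {}" using V[OF that(1)] by (simp add: lattice_body_def)
    qed auto
    then show "hollow (convex hull V j + {p. f p = 0})" by (simp add: f(4))
    show "x \<in> int_lattice" using V[OF that(1)] that(2) by (auto simp: lattice_body_def)
  qed (use that in \<open>auto intro: hull_inc\<close>)
  have "\<mu> \<noteq> 0" using al f(4) by (auto simp: \<mu>_def)
  have "a l \<in> int_lattice" "a0 \<in> int_lattice" using i Vi by auto
  then have "\<mu> \<in> \<int>" unfolding \<mu>_def by (intro f(2) int_lattice_diff)
  \<comment> \<open>\<open>a l\<close> and \<open>a0\<close> both lie in \<open>V i\<close>, whose
    width with respect to \<open>f\<close> is at most one.\<close>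
  moreover have "\<bar>\<mu>\<bar> \<le> 1"
    using width[OF i(1) i(2) i(3)[of l]] width[OF i(1) i(3)[of l] i(2)] by (simp add: \<mu>_def f.diff)
  ultimately have \<mu>: "\<mu> = 1 \<or> \<mu> = -1" using \<open>\<mu> \<noteq> 0\<close> by (auto elim!: Ints_cases)
  then have \<phi>f: "\<phi> z $ l = \<mu> * f z" for z using f\<phi>[of z] by auto
  show "\<phi> z $ l \<in> \<int>" if "z \<in> int_lattice" for z
    unfolding \<phi>f using f(2)[OF that] \<mu> by auto
  show "\<phi> x $ l - \<phi> y $ l \<le> 1" if "j \<in> I" "x \<in> V j" "y \<in> V j" for j x y
    unfolding \<phi>f using width[OF that] width[OF that(1,3,2)] \<mu> by auto
qed

text \<open>The Minkowski sum of the standard simplex and a unit-cube polytope reaching \<open>(1, 1)\<close> in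
  two coordinates contains that point in the interior of its projection.\<close>

lemma no_two_unit_coordinates:
  fixes V :: "'i \<Rightarrow> (real^'n) set" and a :: "'m::finite \<Rightarrow> real^'n" and \<phi> :: "real^'n \<Rightarrow> real^'m"
  assumes I: "finite I" "card I + 1 = CARD('n)" "CARD('m) + 1 = CARD('n)" 
    and V: "\<And>i. i \<in> I \<Longrightarrow> lattice_body (V i)"
    and w: "w \<in> int_lattice" "w \<noteq> 0" and hol: "hollow ((\<Sum>i\<in>I. convex hull V i) + span {w})"
    and i: "i \<in> I" "a0 \<in> V i" "\<And>l. a l \<in> V i"
    and \<phi>: "linear \<phi>" "\<And>l. \<phi> (a l - a0) = axis l 1" "{z. \<phi> z = 0} = span {w}"
    and j: "j \<in> I" "j \<noteq> i" "x \<in> V j" and lk: "l \<noteq> k"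
    and top: "\<And>y. y \<in> V j \<Longrightarrow> \<phi> y $ l \<le> \<phi> x $ l" "\<And>y. y \<in> V j \<Longrightarrow> \<phi> y $ k \<le> \<phi> x $ k"
  shows "False"
proof -
  interpret \<phi>: linear \<phi> by (fact \<phi>(1))
  have nw: "a k - a0 \<notin> span {w}" for k
    using \<phi>(2)[of k] \<phi>(3) by (metis (mono_tags) axis_eq_0_iff mem_Collect_eq zero_neq_one)
  let ?X = "convex hull V i + convex hull V j"
  let ?L = "UNIV - {l, k}"
  have bi: "lattice_body (V i)" and bj: "lattice_body (V j)" using V i j by auto
  obtain o' where o': "o' \<in> interior (convex hull V j)" using bj by (auto simp: lattice_body_def)
  have hull: "convex hull V j \<subseteq> {y. \<phi> x $ q - 1 \<le> \<phi> y $ q \<and> \<phi> y $ q \<le> \<phi> x $ q}" if q: "q = l \<or> q = k" for q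
  proof (rule hull_minimal)
    have "\<phi> x $ q - \<phi> y $ q \<le> 1" if "y \<in> V j" for y
      by (rule coordinates_integral_width(2)[OF I V w hol i \<phi> j(1) j(3) that])
    then show "V j \<subseteq> {y. \<phi> x $ q - 1 \<le> \<phi> y $ q \<and> \<phi> y $ q \<le> \<phi> x $ q}"
      using top q by force
    have *: "{y. \<phi> x $ q - 1 \<le> \<phi> y $ q \<and> \<phi> y $ q \<le> \<phi> x $ q} = (\<lambda>y. \<phi> y $ q) -` {\<phi> x $ q - 1 .. \<phi> x $ q}"
      by auto
    have "linear (\<lambda>y. \<phi> y $ q)" by (rule linearI) (simp_all add: \<phi>.add \<phi>.scale)
    then show "convex {y. \<phi> x $ q - 1 \<le> \<phi> y $ q \<and> \<phi> y $ q \<le> \<phi> x $ q}"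
      unfolding * by (intro convex_linear_vimage) auto
  qed
  define \<alpha> where "\<alpha> = \<phi> x $ l - \<phi> o' $ l"
  define \<beta> where "\<beta> = \<phi> x $ k - \<phi> o' $ k"
  have oin: "o' \<in> convex hull V j" using o' interior_subset by blast
  have ab: "0 \<le> \<alpha>" "\<alpha> \<le> 1" "0 \<le> \<beta>" "\<beta> \<le> 1"
    using hull[of l] hull[of k] oin by (auto simp: \<alpha>_def \<beta>_def)
  \<comment> \<open>Halfway to an interior point, \<open>y\<close> is itself interior. Its
    coordinates \<open>l\<close> and \<open>k\<close> fall short of those of \<open>x\<close> by
    \<open>\<alpha>/2\<close> and \<open>\<beta>/2\<close>, and \<open>p\<close> in the reference
    simplex supplies just these amounts; the weights are admissible because \<open>\<alpha>\<close>
    and \<open>\<beta>\<close> are at most one.\<close>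
  define y where "y = x - (1/2) *\<^sub>R (x - o')"
  have y: "y \<in> interior (convex hull V j)"
    unfolding y_def using j(3) o' by (intro mem_interior_convex_shrink) (auto intro: hull_inc)
  define p where "p = (1 - \<alpha>/2 - \<beta>/2) *\<^sub>R a0 + (\<alpha>/2) *\<^sub>R a l + (\<beta>/2) *\<^sub>R a k"
  have p: "p \<in> convex hull V i"
  proof -
    have "{a0, a l, a k} \<subseteq> V i" using i by auto
    then have "convex hull {a0, a l, a k} \<subseteq> convex hull V i" by (rule hull_mono)
    moreover have "p \<in> convex hull {a0, a l, a k}"
      unfolding convex_hull_3 p_def using ab
      by (intro CollectI exI[of _ "1 - \<alpha>/2 - \<beta>/2"] exI[of _ "\<alpha>/2"] exI[of _ "\<beta>/2"]) auto
    ultimately show ?thesis by blast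
  qed
  have \<phi>p: "\<phi> p = \<phi> a0 + (\<alpha>/2) *\<^sub>R axis l 1 + (\<beta>/2) *\<^sub>R axis k 1"
  proof -
    have "p = a0 + (\<alpha>/2) *\<^sub>R (a l - a0) + (\<beta>/2) *\<^sub>R (a k - a0)"
      by (simp add: p_def algebra_simps)
    then show ?thesis by (simp only: \<phi>.add \<phi>.scale \<phi>(2))
  qed
  have \<phi>y: "\<phi> y = \<phi> x - (1/2) *\<^sub>R (\<phi> x - \<phi> o')"
    unfolding y_def \<phi>.diff \<phi>.scale ..
  \<comment> \<open>The lattice point \<open>x + a0\<close> agrees with the interior point
    \<open>y + p\<close> in coordinates \<open>l\<close> and \<open>k\<close>; all other directions
    are factored out.\<close>
  have "(x + a0) - (y + p) \<in> span (insert w ((\<lambda>q. a q - a0) ` ?L))"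
  proof (rule coordinate_kernel[OF \<phi>])
    fix q assume "q \<notin> ?L"
    then have "q = l \<or> q = k" by auto
    then show "\<phi> (x + a0 - (y + p)) $ q = 0"
      using lk unfolding \<phi>.add \<phi>.diff \<phi>p \<phi>y
      by (auto simp: axis_def \<alpha>_def \<beta>_def field_simps)
  qed
  moreover have "p + y \<in> interior ?X"
    using subsetD[OF interior_plus_subset set_plus_intro[OF y p]] by (simp add: add.commute)
  ultimately have "(p + y) + ((x + a0) - (y + p)) \<in> interior (?X + span (insert w ((\<lambda>q. a q - a0) ` ?L)))"
    using interior_plus_subset[of ?X] by blast
  then have "x + a0 \<in> interior (?X + span (insert w ((\<lambda>q. a q - a0) ` ?L)))"
    by (simp add: algebra_simps)
  moreover have "hollow (?X + span (insert w ((\<lambda>q. a q - a0) ` ?L)))"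
  proof (rule hollow_plus_edges[OF I(1,2) V w hol i nw, where K = "I - {i, j}"])
    have "card (I - {i, j}) = card I - 2" using I(1) i(1) j by (simp add: card_Diff_subset)
    moreover have "card ?L = CARD('m) - 2" using lk by (simp add: card_Diff_subset)
    ultimately show "card (I - {i, j}) = card ?L" using I by simp
    have "I - (I - {i, j}) = {i, j}" using i j by blast
    then show "?X = (\<Sum>k\<in>I - (I - {i, j}). convex hull V k)" using j by simp
    show "convex ?X" by (intro convex_set_plus) auto
    show "interior ?X \<noteq> {}" using \<open>p + y \<in> interior ?X\<close> by blast
  qed auto
  moreover have "x + a0 \<in> int_lattice"
    using bi bj i j by (auto simp: lattice_body_def intro!: int_lattice_add)
  ultimately show False using hollowD by blast
qed

text \<open>A further image would give a set of points inequivalent modulo \<open>w\<close>, hence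
  affinely independent, with two more elements than \<open>\<phi>\<close> has coordinates.
  Barycentric coordinates of \<open>x\<close> yield a relation with coefficient 1 at
  \<open>x\<close>.\<close>

lemma reference_vertices:
  fixes W :: "(real^'n) set" and a :: "'m::finite \<Rightarrow> real^'n" and \<phi> :: "real^'n \<Rightarrow> real^'m"
  assumes ai: "\<And>A. A \<subseteq> W \<Longrightarrow> inequiv_mod (span {w}) A \<Longrightarrow> aff_indep_mod (span {w}) A"
    and a: "a0 \<in> W" "\<And>l. a l \<in> W"
    and \<phi>: "linear \<phi>" "\<And>l. \<phi> (a l - a0) = axis l 1" "{z. \<phi> z = 0} = span {w}" and x: "x \<in> W"
  shows "\<phi> x \<in> insert (\<phi> a0) (range (\<lambda>l. \<phi> (a l)))"
proof (rule ccontr)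
  assume nx: "\<not> ?thesis"
  interpret \<phi>: linear \<phi> by (fact \<phi>(1))
  have \<phi>a: "\<phi> (a l) = \<phi> a0 + axis l 1" for l using \<phi>(2)[of l] by (simp add: \<phi>.diff algebra_simps)
  have inja: "inj a"
  proof (rule injI)
    fix l k assume "a l = a k"
    then have "axis l (1::real) = (axis k 1 :: real^'m)" using \<phi>a by (metis add_left_cancel)
    then show "l = k" by (simp add: axis_eq_axis)
  qed
  have a0: "a0 \<notin> range a" using \<phi>a by (metis add_cancel_left_right axis_eq_0_iff rangeE zero_neq_one)
  have xn: "x \<notin> insert a0 (range a)" using nx by auto
  let ?A = "insert x (insert a0 (range a))"
  have inj: "inj_on \<phi> ?A"
    using nx by (auto simp: inj_on_def \<phi>a axis_eq_axis) (metis rangeI)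
  have "inequiv_mod (span {w}) ?A"
    unfolding inequiv_mod_def
  proof (intro ballI impI)
    fix p q assume pq: "p \<in> ?A" "q \<in> ?A" "p - q \<in> span {w}"
    then have "\<phi> (p - q) = 0" using \<phi>(3) by blast
    then have "\<phi> p = \<phi> q" by (simp add: \<phi>.diff)
    then show "p = q" by (rule inj_onD[OF inj _ pq(1,2)])
  qed
  then have A: "aff_indep_mod (span {w}) ?A" using a x by (intro ai) auto
  define d where "d = \<phi> x - \<phi> a0"
  define c where "c y = (if y = x then 1 else if y = a0 then (\<Sum>l\<in>UNIV. d $ l) - 1 else - d $ (inv a y))" for y
  have ca: "c (a l) = - d $ l" for l
    using xn a0 inja by (auto simp: c_def)
  have c0: "c a0 = (\<Sum>l\<in>UNIV. d $ l) - 1" using xn by (auto simp: c_def)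
  have "(\<Sum>y\<in>?A. c y) = 0"
    using xn a0 by (simp add: sum.reindex[OF inja] ca c0 sum_negf) (simp add: c_def)
  moreover have "(\<Sum>y\<in>?A. c y *\<^sub>R y) = (x - a0) - (\<Sum>l\<in>UNIV. d $ l *\<^sub>R (a l - a0))"
    using xn a0 by (simp add: sum.reindex[OF inja] ca c0 sum_negf scaleR_right_diff_distrib sum_subtractf scaleR_left_diff_distrib scaleR_left.sum)
      (simp add: c_def)
  moreover have "\<phi> ((x - a0) - (\<Sum>l\<in>UNIV. d $ l *\<^sub>R (a l - a0))) = 0"
  proof -
    have "\<phi> ((x - a0) - (\<Sum>l\<in>UNIV. d $ l *\<^sub>R (a l - a0))) = \<phi> (x - a0) - (\<Sum>l\<in>UNIV. d $ l *\<^sub>R axis l 1)"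
      by (simp only: \<phi>.diff[of "x - a0"] \<phi>.sum \<phi>.scale \<phi>(2))
    also have "\<dots> = 0"
      using basis_expansion[of d] unfolding scalar_mult_eq_scaleR by (simp add: d_def \<phi>.diff)
    finally show ?thesis .
  qed
  moreover have "(x - a0) - (\<Sum>l\<in>UNIV. d $ l *\<^sub>R (a l - a0)) \<in> span {w}"
    using \<phi>(3) calculation(3) by blast
  ultimately have "\<forall>y\<in>?A. c y = 0"
    using A unfolding aff_indep_mod_def by simp
  then show False by (simp add: c_def)
qed

text \<open>For another polytope than the reference one, subtracting the integral minima of the
  coordinates leaves vectors with entries 0 and 1 and at most one entry 1. Full-dimensionality then
  forces every unit vector and the origin to occur.\<close>

lemma projects_to_simplex:
  fixes V :: "'i \<Rightarrow> (real^'n) set" and a :: "'m::finite \<Rightarrow> real^'n" and \<phi> :: "real^'n \<Rightarrow> real^'m"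
  assumes I: "finite I" "card I + 1 = CARD('n)" "CARD('m) + 1 = CARD('n)" 
    and V: "\<And>i. i \<in> I \<Longrightarrow> lattice_body (V i)"
    and w: "w \<in> int_lattice" "w \<noteq> 0" and hol: "hollow ((\<Sum>i\<in>I. convex hull V i) + span {w})"
    and i: "i \<in> I" "a0 \<in> V i" "\<And>l. a l \<in> V i"
    and \<phi>: "linear \<phi>" "\<And>l. \<phi> (a l - a0) = axis l 1" "{z. \<phi> z = 0} = span {w}"
    and j: "j \<in> I"
  shows "\<exists>t\<in>int_lattice. (\<lambda>x. \<phi> (x + t)) ` V j = insert 0 (range (\<lambda>l. axis l 1))"
proof -
  interpret \<phi>: linear \<phi> by (fact \<phi>(1))
  have lat: "a0 \<in> int_lattice" "\<And>l. a l \<in> int_lattice"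
    using V[OF i(1)] i by (auto simp: lattice_body_def)
  show ?thesis
  proof (cases "j = i")
    case True
    have ai: "aff_indep_mod (span {w}) A" if "A \<subseteq> V i" "inequiv_mod (span {w}) A" for A
    proof (rule affine_independence_mod_hollow_sum[of I V "{w}" i A])
      have "dim {w} = 1" using w(2) by (simp add: dim_insert)
      then show "dim {w} + card I = CARD('n)" using I by simp
    qed (use I V w hol i that in \<open>auto simp: lattice_body_def\<close>)
    have "(\<lambda>x. \<phi> (x + - a0)) ` V i = insert 0 (range (\<lambda>l. axis l 1))"
    proof
      have *: "\<phi> (x - a0) \<in> insert 0 (range (\<lambda>l. axis l 1))" if "x \<in> V i" for x
      proof -
        have "\<phi> x \<in> insert (\<phi> a0) (range (\<lambda>l. \<phi> (a l)))"
          by (rule reference_vertices[OF ai i(2,3) \<phi> that])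
        then consider "\<phi> x = \<phi> a0" | l where "\<phi> x = \<phi> (a l)" by blast
        then show ?thesis
        proof cases
          case 2
          then have "\<phi> (x - a0) = axis l 1" using \<phi>(2)[of l] by (simp add: \<phi>.diff)
          then show ?thesis by simp
        qed (simp add: \<phi>.diff)
      qed
      then show "(\<lambda>x. \<phi> (x + - a0)) ` V i \<subseteq> insert 0 (range (\<lambda>l. axis l 1))" by auto
      have "0 \<in> (\<lambda>x. \<phi> (x + - a0)) ` V i" using i(2) by (intro image_eqI[of _ _ a0]) auto
      moreover have "axis l 1 \<in> (\<lambda>x. \<phi> (x + - a0)) ` V i" for l
        using i(3)[of l] \<phi>(2)[of l] by (intro image_eqI[of _ _ "a l"]) auto
      ultimately show "insert 0 (range (\<lambda>l. axis l 1)) \<subseteq> (\<lambda>x. \<phi> (x + - a0)) ` V i" by blast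
    qed
    then show ?thesis using True lat by (intro bexI[of _ "- a0"]) (auto intro: int_lattice_minus)
  next
    case False
    have bj: "finite (V j)" "V j \<noteq> {}" "interior (convex hull V j) \<noteq> {}" "V j \<subseteq> int_lattice"
      using V[OF j] by (auto simp: lattice_body_def)
    define \<mu> where "\<mu> l = Min ((\<lambda>x. \<phi> x $ l) ` V j)" for l
    have fin: "finite ((\<lambda>x. \<phi> x $ l) ` V j)" for l using bj by simp
    have \<mu>in: "\<exists>x\<in>V j. \<phi> x $ l = \<mu> l" for l
    proof -
      have "\<mu> l \<in> (\<lambda>x. \<phi> x $ l) ` V j" unfolding \<mu>_def using bj by (intro Min_in) auto
      then show ?thesis by auto
    qed
    have \<mu>le: "\<mu> l \<le> \<phi> x $ l" if "x \<in> V j" for x l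
      unfolding \<mu>_def using that fin by (intro Min_le) auto
    have int\<phi>: "\<phi> x $ l \<in> \<int>" if "x \<in> V j" for x l
      using coordinates_integral_width(1)[OF I V w hol i \<phi>] that bj(4) by blast
    have \<mu>int: "\<mu> l \<in> \<int>" for l using \<mu>in[of l] int\<phi> by metis
    have le1: "\<phi> x $ l \<le> \<mu> l + 1" if "x \<in> V j" for x l
    proof -
      obtain y where y: "y \<in> V j" "\<phi> y $ l = \<mu> l" using \<mu>in by blast
      show ?thesis using coordinates_integral_width(2)[OF I V w hol i \<phi> j that y(1), of l] y(2) by simp
    qed
    \<comment> \<open>The lattice vectors \<open>a l - a0\<close> map to the unit vectors, so an
      integral shift downstairs lifts to a lattice translation upstairs.\<close>
    define t where "t = - (\<Sum>l\<in>UNIV. \<mu> l *\<^sub>R (a l - a0))"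
    have t: "t \<in> int_lattice"
      unfolding t_def using lat \<mu>int
      by (intro int_lattice_minus int_lattice_sum int_lattice_scale int_lattice_diff) auto
    have "\<phi> t = - (\<Sum>l\<in>UNIV. \<mu> l *\<^sub>R axis l 1)"
      unfolding t_def \<phi>.neg \<phi>.sum \<phi>.scale \<phi>(2) ..
    then have \<phi>t: "\<phi> t $ l = - \<mu> l" for l
      by (simp add: axis_def if_distrib cong: if_cong)
    define g where "g x = \<phi> (x + t)" for x
    have g: "g x $ l = \<phi> x $ l - \<mu> l" for x l by (simp add: g_def \<phi>.add \<phi>t)
    have g01: "g x $ l = 0 \<or> g x $ l = 1" if "x \<in> V j" for x l
    proof -
      have "g x $ l \<in> \<int>" unfolding g using int\<phi>[OF that] \<mu>int by (rule Ints_diff)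
      moreover have "0 \<le> g x $ l" "g x $ l \<le> 1" using \<mu>le[OF that, of l] le1[OF that, of l] by (auto simp: g)
      ultimately show ?thesis by (auto elim!: Ints_cases)
    qed
    have one: "l = k" if "x \<in> V j" "g x $ l = 1" "g x $ k = 1" for x l k
    proof (rule ccontr)
      assume lk: "l \<noteq> k"
      show False
        by (rule no_two_unit_coordinates[OF I V w hol i \<phi> j False that(1) lk])
           (use that le1 in \<open>auto simp: g algebra_simps\<close>)
    qed
    have axis: "g x = axis l 1" if "x \<in> V j" "g x $ l = 1" for x l
      using g01[OF that(1)] one[OF that(1)] that(2) by (auto simp: vec_eq_iff axis_def) 
    have gi: "\<phi> (x - y) = g x - g y" for x y by (simp add: g_def \<phi>.diff \<phi>.add)
    have ex1: "\<exists>x\<in>V j. g x $ l = 1" for l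
    proof (rule ccontr)
      assume no: "\<not> ?thesis"
      have sub: "subspace {z. \<phi> z $ l = 0}" by (rule subspaceI) (simp_all add: \<phi>.add \<phi>.scale)
      have "{z. \<phi> z $ l = 0} \<noteq> UNIV"
      proof -
        have "\<phi> (a l - a0) $ l \<noteq> 0" using \<phi>(2)[of l] by simp
        then show ?thesis by blast
      qed
      then obtain x where x: "x \<in> V j" "x - (SOME y. y \<in> V j) \<notin> {z. \<phi> z $ l = 0}"
        using full_dim_difference[OF bj(3) sub] by blast
      have y: "(SOME y. y \<in> V j) \<in> V j" using bj(2) by (simp add: some_in_eq)
      then have "g x $ l = 0" "g (SOME y. y \<in> V j) $ l = 0" using g01 no x by blast+
      then show False using x(2) gi by simp
    qed
    have ex0: "\<exists>x\<in>V j. g x = 0"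
    proof (rule ccontr)
      assume no: "\<not> ?thesis"
      \<comment> \<open>Without the origin, all images would lie on the hyperplane of coordinate sum
        one.\<close>
      have sum1: "(\<Sum>l\<in>UNIV. g x $ l) = 1" if x: "x \<in> V j" for x
      proof -
        have "g x \<noteq> 0" using no x by blast
        then obtain l where "g x $ l \<noteq> 0" by (auto simp: vec_eq_iff)
        then have "g x = axis l 1" using axis[OF x] g01[OF x] by blast
        then show ?thesis by (simp add: axis_def if_distrib cong: if_cong)
      qed
      let ?S = "{z. (\<Sum>l\<in>UNIV. \<phi> z $ l) = 0}"
      have sub: "subspace ?S"
        by (rule subspaceI) (simp_all add: \<phi>.add \<phi>.scale sum.distrib flip: sum_distrib_left)
      have "?S \<noteq> UNIV"
      proof -
        fix k
        have "(\<Sum>l\<in>UNIV. \<phi> (a k - a0) $ l) = 1"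
          unfolding \<phi>(2) by (simp add: axis_def if_distrib cong: if_cong)
        then have "a k - a0 \<notin> ?S" by simp
        then show ?thesis by blast
      qed
      then obtain x where x: "x \<in> V j" "x - (SOME y. y \<in> V j) \<notin> ?S"
        using full_dim_difference[OF bj(3) sub] by blast
      have y: "(SOME y. y \<in> V j) \<in> V j" using bj(2) by (simp add: some_in_eq)
      show False using x(2) sum1[OF x(1)] sum1[OF y] by (simp add: gi sum_subtractf)
    qed
    have "g ` V j = insert 0 (range (\<lambda>l. axis l 1))"
    proof
      show "g ` V j \<subseteq> insert 0 (range (\<lambda>l. axis l 1))"
      proof clarify
        fix x assume x: "x \<in> V j" "g x \<notin> range (\<lambda>l. axis l 1)"
        then have "g x $ l = 0" for l using axis[OF x(1), of l] g01[OF x(1), of l] by blast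
        then show "g x = 0" by (simp add: vec_eq_iff)
      qed
      have "axis l 1 \<in> g ` V j" for l using ex1[of l] axis by (metis image_eqI)
      moreover have "0 \<in> g ` V j" using ex0 by (metis image_eqI)
      ultimately show "insert 0 (range (\<lambda>l. axis l 1)) \<subseteq> g ` V j" by blast
    qed
    moreover have "g = (\<lambda>x. \<phi> (x + t))" by (simp add: g_def fun_eq_iff)
    ultimately show ?thesis using t by (intro bexI[of _ t]) simp_all
  qed
qed

section \<open>Long chords of hollow lattice polytopes\<close>

lemma simultaneous_approximation:
  fixes \<theta> :: "'a \<Rightarrow> real"
  assumes "finite T" "N > 0"
  obtains q :: nat and p :: "'a \<Rightarrow> int"
  where "0 < q" "q \<le> N ^ card T" "\<And>i. i \<in> T \<Longrightarrow> \<bar>real q * \<theta> i - of_int (p i)\<bar> < 1 / N"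
proof -
  obtain h where h: "bij_betw h {0..<card T} T"
    using ex_bij_betw_nat_finite[OF assms(1)] by blast
  obtain q p where qp: "0 < q" "q \<le> int (N ^ card T)"
    "\<And>i. i < card T \<Longrightarrow> \<bar>of_int q * \<theta> (h i) - of_int (p i)\<bar> < 1 / N"
    using Dirichlet_approx_simult[OF assms(2), of "card T" "\<theta> \<circ> h"] by (metis comp_apply)
  show ?thesis
  proof (rule that)
    show "0 < nat q" using qp(1) by simp
    show "nat q \<le> N ^ card T" using nat_mono[OF qp(2)] by (simp only: nat_int)
    show "\<bar>real (nat q) * \<theta> i - of_int (p (inv_into {0..<card T} h i))\<bar> < 1 / N" if "i \<in> T" for i
    proof -
      have "i \<in> h ` {0..<card T}" using h that by (simp add: bij_betw_def)
      then have "inv_into {0..<card T} h i \<in> {0..<card T}" "h (inv_into {0..<card T} h i) = i"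
        by (rule inv_into_into, rule f_inv_into_f)
      then show ?thesis using qp(1) qp(3)[of "inv_into {0..<card T} h i"] by simp
    qed
  qed
qed

text \<open>Inverse thresholds for coefficients. With approximation quality
  \<open>N = approx_scale m j\<close> for at most \<open>m\<close> numbers, Dirichlet's multiplier
  is at most \<open>N ^ (m + 1)\<close>, so a coefficient below the next threshold stays at most 1/3
  after multiplication. The start \<open>2 * m + 3\<close> keeps each error below 1/3 and the sum of
  all errors at most 1/2.\<close>

fun approx_scale :: "nat \<Rightarrow> nat \<Rightarrow> nat" where
  "approx_scale m 0 = 2 * m + 3"
| "approx_scale m (Suc j) = 3 * approx_scale m j ^ (m + 1)"

declare approx_scale.simps(2) [simp del]

lemma approx_scale_pos: "approx_scale m j > 0"
  by (induction j) (auto simp: approx_scale.simps(2))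

lemma approx_scale_Suc_ge: "approx_scale m j \<le> approx_scale m (Suc j)"
proof -
  have "approx_scale m j * 1 \<le> approx_scale m j * approx_scale m j ^ m"
    using approx_scale_pos[of m j] by (intro mult_left_mono) auto
  then show ?thesis by (simp add: approx_scale.simps(2))
qed

lemma approx_scale_mono: "i \<le> j \<Longrightarrow> approx_scale m i \<le> approx_scale m j"
  using lift_Suc_mono_le[of "approx_scale m"] approx_scale_Suc_ge by blast

text \<open>Pigeonhole on \<open>m + 1\<close> disjoint ranges of magnitudes: some range contains no coefficient.\<close>

lemma approx_scale_gap:
  fixes \<beta> :: "'a \<Rightarrow> real"
  assumes "finite T" "card T \<le> m"
  shows "\<exists>j\<le>m. \<forall>i\<in>T. \<beta> i < 1 / approx_scale m (Suc j) \<or> \<beta> i \<ge> 1 / approx_scale m j"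
proof (rule ccontr)
  assume nt: "\<not> ?thesis"
  have "\<exists>i\<in>T. 1 / approx_scale m (Suc j) \<le> \<beta> i \<and> \<beta> i < 1 / approx_scale m j" if "j \<le> m" for j
    using nt that by (metis not_le)
  then obtain h where h: "\<And>j. j \<le> m \<Longrightarrow> h j \<in> T \<and> 1 / approx_scale m (Suc j) \<le> \<beta> (h j) \<and> \<beta> (h j) < 1 / approx_scale m j"
    by metis
  have lt: "\<beta> (h j') < \<beta> (h j)" if "j < j'" "j' \<le> m" for j j'
  proof -
    have "real (approx_scale m (Suc j)) \<le> real (approx_scale m j')" using that approx_scale_mono[of "Suc j" j' m] by linarith
    then have "1 / real (approx_scale m j') \<le> 1 / real (approx_scale m (Suc j))"
      using approx_scale_pos[of m "Suc j"] by (intro divide_left_mono mult_pos_pos) (auto intro: approx_scale_pos)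
    then show ?thesis using h[of j] h[of j'] that by linarith
  qed
  have "inj_on h {..m}"
    by (intro linorder_inj_onI') (use lt in fastforce)
  then have "card {..m} \<le> card T"
    using h assms(1) by (intro card_inj_on_le[of h]) auto
  then show False using assms(2) by simp
qed

text \<open>Multiplying a lattice point by \<open>k + 1\<close> and subtracting nearest integer multiples of the
  vertices enlarges every small coefficient, and the large ones stay nonnegative.\<close>

lemma enlarge_coefficient:
  fixes T :: "(real^'n) set" and \<beta> :: "real^'n \<Rightarrow> real"
  assumes T: "finite T" "card T \<le> m" "T \<subseteq> int_lattice"
    and \<beta>: "0 < \<beta>0" "\<And>v. v \<in> T \<Longrightarrow> 0 \<le> \<beta> v" "\<beta>0 + sum \<beta> T = 1"
    and x: "x \<in> int_lattice" "x = \<beta>0 *\<^sub>R c + (\<Sum>v\<in>T. \<beta> v *\<^sub>R v) + \<rho> *\<^sub>R w"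
    and small: "\<beta>0 \<le> 1 / approx_scale m (Suc m)"
  shows "\<exists>\<beta>0' \<beta>' x' \<rho>'. 2 * \<beta>0 \<le> \<beta>0' \<and> (\<forall>v\<in>T. 0 \<le> \<beta>' v) \<and> \<beta>0' + sum \<beta>' T = 1 \<and>
    x' \<in> int_lattice \<and> x' = \<beta>0' *\<^sub>R c + (\<Sum>v\<in>T. \<beta>' v *\<^sub>R v) + \<rho>' *\<^sub>R w"
proof -
  obtain j where j: "j \<le> m" "\<And>v. v \<in> T \<Longrightarrow> \<beta> v < 1 / approx_scale m (Suc j) \<or> \<beta> v \<ge> 1 / approx_scale m j"
    using approx_scale_gap[OF T(1,2), of \<beta>] by blast
  define N where "N = approx_scale m j"
  have N: "N > 0" using approx_scale_pos by (simp add: N_def)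
  obtain k :: nat and r where k: "0 < k" "k \<le> N ^ card T"
    and r: "\<And>v. v \<in> T \<Longrightarrow> \<bar>real k * \<beta> v - of_int (r v)\<bar> < 1 / N"
    by (rule simultaneous_approximation[OF T(1) N, of \<beta>]) blast
  have "N ^ card T \<le> N ^ (m + 1)" using T(2) N by (intro power_increasing) auto
  then have "k \<le> N ^ (m + 1)" using k by linarith
  then have k3: "3 * real k \<le> real (approx_scale m (Suc j))" by (simp add: N_def approx_scale.simps(2) flip: of_nat_power of_nat_mult)
  have spos: "real (approx_scale m (Suc j)) > 0" using approx_scale_pos[of m "Suc j"] by simp
  have kb: "real k * b \<le> 1/3" if "b \<le> 1 / approx_scale m (Suc j)" for b
  proof -
    have "real k * b \<le> real k * (1 / approx_scale m (Suc j))" using that by (intro mult_left_mono) auto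
    also have "\<dots> \<le> 1/3" using k3 spos by (simp add: field_simps)
    finally show ?thesis .
  qed
  have N3: "real N \<ge> 2 * real m + 3" using approx_scale_mono[of 0 j m] by (simp add: N_def)
  have N13: "1 / real N \<le> 1/3" using N3 by (simp add: field_simps)
  \<comment> \<open>A small coefficient is approximated by \<open>r v = 0\<close> and only grows; a
    large one is at least \<open>1 / N\<close>, which exceeds the error.\<close>
  define \<beta>' where "\<beta>' v = \<beta> v + (real k * \<beta> v - of_int (r v))" for v
  have nonneg: "0 \<le> \<beta>' v" if v: "v \<in> T" for v
    using j(2)[OF v]
  proof
    assume "\<beta> v < 1 / approx_scale m (Suc j)"
    then have "real k * \<beta> v \<le> 1/3" by (intro kb) simp
    moreover have "0 \<le> real k * \<beta> v" using \<beta>(2)[OF v] by simp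
    ultimately have "\<bar>real_of_int (r v)\<bar> < 1" using r[OF v] N13 by linarith
    then have "r v = 0" by linarith
    then show ?thesis using \<beta>(2)[OF v] by (simp add: \<beta>'_def)
  next
    assume "1 / approx_scale m j \<le> \<beta> v"
    then show ?thesis using r[OF v] by (simp add: \<beta>'_def N_def)
  qed
  define \<beta>0' where "\<beta>0' = (1 + real k) * \<beta>0"
  have "1 / real (approx_scale m (Suc m)) \<le> 1 / approx_scale m (Suc j)"
  proof (rule divide_left_mono)
    show "real (approx_scale m (Suc j)) \<le> real (approx_scale m (Suc m))"
      using approx_scale_mono[of "Suc j" "Suc m" m] j(1) by simp
    show "0 < real (approx_scale m (Suc m)) * real (approx_scale m (Suc j))"
      using approx_scale_pos by simp
  qed simp
  then have "real k * \<beta>0 \<le> 1/3" using small by (intro kb) linarith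
  have "\<bar>\<Sum>v\<in>T. real k * \<beta> v - of_int (r v)\<bar> \<le> (\<Sum>v\<in>T. 1 / real N)"
    using r by (intro order.trans[OF sum_abs] sum_mono) (auto intro: less_imp_le)
  also have "\<dots> \<le> real m / real N" using T(2) by (simp add: divide_right_mono)
  also have "\<dots> \<le> 1/2" using N3 by (simp add: field_simps)
  finally have e1: "\<bar>\<Sum>v\<in>T. real k * \<beta> v - of_int (r v)\<bar> \<le> 1/2" .
  have e2: "real k - of_int (\<Sum>v\<in>T. r v) = real k * \<beta>0 + (\<Sum>v\<in>T. real k * \<beta> v - of_int (r v))"
  proof -
    have "real k = real k * (\<beta>0 + sum \<beta> T)" using \<beta>(3) by simp
    then show ?thesis by (simp add: sum_subtractf sum_distrib_left distrib_left)
  qed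
  \<comment> \<open>An integer of absolute value below one is zero, so the subtracted multiples add
    up to \<open>k\<close> and the new coefficients again have total one.\<close>
  have "\<bar>real k - of_int (\<Sum>v\<in>T. r v)\<bar> < 1"
    unfolding e2 using e1 \<open>real k * \<beta>0 \<le> 1/3\<close> \<beta>(1) mult_nonneg_nonneg[of "real k" \<beta>0] by linarith
  then have "\<bar>real_of_int (int k - (\<Sum>v\<in>T. r v))\<bar> < 1" by simp
  then have e3: "(\<Sum>v\<in>T. r v) = int k" by linarith
  have "sum \<beta>' T = sum \<beta> T + (\<Sum>v\<in>T. real k * \<beta> v - of_int (r v))"
    by (simp add: \<beta>'_def sum.distrib)
  then have sum1: "\<beta>0' + sum \<beta>' T = 1"
    using e2 e3 \<beta>(3) by (simp add: \<beta>0'_def algebra_simps)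
  define x' where "x' = (1 + real k) *\<^sub>R x - (\<Sum>v\<in>T. of_int (r v) *\<^sub>R v)"
  have "(1 + real k) \<in> \<int>" by auto
  then have x'int: "x' \<in> int_lattice"
    unfolding x'_def using x(1) T(3) by (intro int_lattice_diff int_lattice_scale int_lattice_sum) auto
  have "x' = \<beta>0' *\<^sub>R c + (\<Sum>v\<in>T. \<beta>' v *\<^sub>R v) + ((1 + real k) * \<rho>) *\<^sub>R w"
    unfolding x'_def x(2) \<beta>0'_def \<beta>'_def
    by (simp add: scaleR_add_right scaleR_add_left scaleR_left_diff_distrib sum.distrib sum_subtractf scaleR_sum_right distrib_right)
  moreover have "2 * \<beta>0 \<le> \<beta>0'" using k(1) \<beta>(1) by (simp add: \<beta>0'_def distrib_right)
  ultimately show ?thesis using nonneg sum1 x'int by blast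
qed

text \<open>Each enlargement at least doubles the weight of \<open>c\<close>; the exponent
  \<open>p\<close> bounds how many are needed to reach the threshold.\<close>

lemma large_coefficient:
  fixes T :: "(real^'n) set" and \<beta> :: "real^'n \<Rightarrow> real"
  assumes T: "finite T" "card T \<le> m" "T \<subseteq> int_lattice"
    and "0 < \<beta>0" "\<And>v. v \<in> T \<Longrightarrow> 0 \<le> \<beta> v" "\<beta>0 + sum \<beta> T = 1"
    and "x \<in> int_lattice" "x = \<beta>0 *\<^sub>R c + (\<Sum>v\<in>T. \<beta> v *\<^sub>R v) + \<rho> *\<^sub>R w"
    and "1 / approx_scale m (Suc m) \<le> \<beta>0 * 2 ^ p"
  shows "\<exists>\<beta>0 \<beta> x \<rho>. 1 / approx_scale m (Suc m) \<le> \<beta>0 \<and> (\<forall>v\<in>T. 0 \<le> \<beta> v) \<and> \<beta>0 + sum \<beta> T = 1 \<and>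
    x \<in> int_lattice \<and> x = \<beta>0 *\<^sub>R c + (\<Sum>v\<in>T. \<beta> v *\<^sub>R v) + \<rho> *\<^sub>R w"
  using assms(4-)
proof (induction p arbitrary: \<beta>0 \<beta> x \<rho>)
  case 0
  then have "1 / approx_scale m (Suc m) \<le> \<beta>0" by simp
  with 0 show ?case by blast
next
  case (Suc p)
  show ?case
  proof (cases "1 / approx_scale m (Suc m) \<le> \<beta>0")
    case True
    with Suc.prems show ?thesis by blast
  next
    case False
    then have sm: "\<beta>0 \<le> 1 / approx_scale m (Suc m)" by simp
    obtain \<beta>0' \<beta>' x' \<rho>' where n': "2 * \<beta>0 \<le> \<beta>0' \<and> (\<forall>v\<in>T. 0 \<le> \<beta>' v) \<and> \<beta>0' + sum \<beta>' T = 1 \<and>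
        x' \<in> int_lattice \<and> x' = \<beta>0' *\<^sub>R c + (\<Sum>v\<in>T. \<beta>' v *\<^sub>R v) + \<rho>' *\<^sub>R w"
      using enlarge_coefficient[OF T Suc.prems(1-5) sm] by blast
    then have n: "2 * \<beta>0 \<le> \<beta>0'" "\<And>v. v \<in> T \<Longrightarrow> 0 \<le> \<beta>' v" "\<beta>0' + sum \<beta>' T = 1"
        "x' \<in> int_lattice" "x' = \<beta>0' *\<^sub>R c + (\<Sum>v\<in>T. \<beta>' v *\<^sub>R v) + \<rho>' *\<^sub>R w" by blast+
    have "1 / approx_scale m (Suc m) \<le> (2 * \<beta>0) * 2 ^ p" using Suc.prems(6) by (simp add: mult.commute mult.left_commute)
    also have "\<dots> \<le> \<beta>0' * 2 ^ p" using n(1) by (intro mult_right_mono) auto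
    finally have l: "1 / approx_scale m (Suc m) \<le> \<beta>0' * 2 ^ p" .
    have "0 < \<beta>0'" using n(1) Suc.prems(1) by linarith
    from Suc.IH[OF this n(2-5) l] show ?thesis .
  qed
qed

text \<open>The ray from \<open>c\<close> through \<open>p\<close> is prolonged slightly beyond
  \<open>p\<close> to a point \<open>y\<close> still in the hull. Caratheodory's theorem represents
  \<open>y\<close>, and \<open>p\<close> lies between \<open>c\<close> and \<open>y\<close>, with
  positive weight on \<open>c\<close>.\<close>

lemma interior_point_combination:
  fixes W :: "'a::euclidean_space set"
  assumes p: "p \<in> interior (convex hull W)" and c: "c \<in> convex hull W"
  obtains T \<beta>0 \<beta> where "finite T" "T \<subseteq> W" "card T \<le> DIM('a) + 1" "0 < \<beta>0"
    "\<And>v. v \<in> T \<Longrightarrow> 0 \<le> \<beta> v" "\<beta>0 + sum \<beta> T = 1" "p = \<beta>0 *\<^sub>R c + (\<Sum>v\<in>T. \<beta> v *\<^sub>R v)"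
proof -
  obtain r where r: "r > 0" "ball p r \<subseteq> convex hull W"
    using p mem_interior by blast
  \<comment> \<open>Small enough to keep \<open>y\<close> in the ball around \<open>p\<close>; the
    summand 1 covers the case \<open>p = c\<close>.\<close>
  define e where "e = r / (2 * (norm (p - c) + 1))"
  have e: "e > 0" using r by (simp add: e_def add_nonneg_pos)
  define y where "y = p + e *\<^sub>R (p - c)"
  have "dist p y = e * norm (p - c)" using e by (simp add: y_def dist_norm)
  also have "\<dots> < r"
  proof -
    have "norm (p - c) / (2 * (norm (p - c) + 1)) < 1"
    proof -
      have "N / (2 * (N + 1)) < 1" if "0 \<le> N" for N :: real
        using that by (simp add: divide_less_eq)
      from this[OF norm_ge_zero] show ?thesis .
    qed
    then have "r * (norm (p - c) / (2 * (norm (p - c) + 1))) < r * 1"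
      using r(1) by (rule mult_strict_left_mono)
    then show ?thesis by (simp add: e_def)
  qed
  finally have "y \<in> convex hull W" using r(2) by auto
  then obtain T where T: "finite T" "T \<subseteq> W" "card T \<le> DIM('a) + 1" "y \<in> convex hull T"
    unfolding caratheodory[of W] by blast
  then obtain u where u: "\<And>v. v \<in> T \<Longrightarrow> 0 \<le> u v" "sum u T = 1" "(\<Sum>v\<in>T. u v *\<^sub>R v) = y"
    unfolding convex_hull_finite[OF T(1)] by blast
  show ?thesis
  proof (rule that[OF T(1-3), of "e / (1 + e)" "\<lambda>v. u v / (1 + e)"])
    show "0 < e / (1 + e)" using e by simp
    show "0 \<le> u v / (1 + e)" if "v \<in> T" for v using u(1)[OF that] e by simp
    show "e / (1 + e) + (\<Sum>v\<in>T. u v / (1 + e)) = 1"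
      using e u(2) by (simp add: add_divide_distrib[symmetric] flip: sum_divide_distrib)
    have "(\<Sum>v\<in>T. (u v / (1 + e)) *\<^sub>R v) = (1 / (1 + e)) *\<^sub>R y"
      unfolding u(3)[symmetric] by (simp add: scaleR_sum_right)
    also have "\<dots> = p - (e / (1 + e)) *\<^sub>R c"
    proof -
      have "y = (1 + e) *\<^sub>R p - e *\<^sub>R c" by (simp add: y_def algebra_simps)
      then show ?thesis using e by (simp add: scaleR_diff_right)
    qed
    finally show "p = (e / (1 + e)) *\<^sub>R c + (\<Sum>v\<in>T. (u v / (1 + e)) *\<^sub>R v)" by simp
  qed
qed

text \<open>Caratheodory's theorem leaves at most \<open>CARD('n) + 1\<close> vertices, which is the
  parameter \<open>m\<close> of the scale, and the last threshold is number \<open>m + 1\<close>.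
  The factor 2 pays for halving the chord when it is pushed into the interior.\<close>

definition chord_bound :: "'n::finite itself \<Rightarrow> real" where
  "chord_bound _ = 2 * real (approx_scale (CARD('n) + 1) (CARD('n) + 2))"

lemma chord_bound_pos: "chord_bound TYPE('n::finite) > 0"
  using approx_scale_pos by (simp add: chord_bound_def)

theorem hollow_plus_long_chord:
  fixes W :: "(real^'n) set"
  assumes W: "W \<subseteq> int_lattice" "interior (convex hull W) \<noteq> {}" "hollow (convex hull W)"
    and w: "w \<in> int_lattice" and a: "a \<in> convex hull W" "a + chord_bound TYPE('n) *\<^sub>R w \<in> convex hull W"
  shows "hollow (convex hull W + span {w})"
  unfolding hollow_def
proof (rule ccontr)
  define m where "m = CARD('n) + 1"
  define \<kappa> where "\<kappa> = real (approx_scale m (Suc m))"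
  have \<kappa>: "\<kappa> > 0" using approx_scale_pos by (simp only: \<kappa>_def of_nat_0_less_iff)
  have \<kappa>2: "chord_bound TYPE('n) = 2 * \<kappa>" by (simp add: chord_bound_def \<kappa>_def m_def)
  assume "interior (convex hull W + span {w}) \<inter> int_lattice \<noteq> {}"
  then obtain z where z: "z \<in> int_lattice" "z \<in> interior (convex hull W) + span {w}"
    using interior_plus_subspace[OF convex_convex_hull W(2), of "span {w}"] by auto
  then obtain p \<rho> where p: "p \<in> interior (convex hull W)" "z = p + \<rho> *\<^sub>R w"
    by (auto simp: set_plus_def span_singleton)
  obtain o' where o': "o' \<in> interior (convex hull W)" using W(2) by blast
  \<comment> \<open>Shrinking the chord by half towards \<open>o'\<close> gives a segment from
    \<open>c\<close> to \<open>c + \<kappa> *\<^sub>R w\<close> inside the interior.\<close>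
  define c where "c = a - (1/2) *\<^sub>R (a - o')"
  have c: "c \<in> interior (convex hull W)"
    unfolding c_def using a o' by (intro mem_interior_convex_shrink) auto
  have "(a + (2 * \<kappa>) *\<^sub>R w) - (1/2) *\<^sub>R ((a + (2 * \<kappa>) *\<^sub>R w) - o') \<in> interior (convex hull W)"
    using a(2) o' unfolding \<kappa>2 by (intro mem_interior_convex_shrink) auto
  also have "(a + (2 * \<kappa>) *\<^sub>R w) - (1/2) *\<^sub>R ((a + (2 * \<kappa>) *\<^sub>R w) - o') = c + \<kappa> *\<^sub>R w"
    by (simp add: vec_eq_iff c_def field_simps)
  finally have c\<kappa>: "c + \<kappa> *\<^sub>R w \<in> interior (convex hull W)" .
  have cin: "c \<in> convex hull W" using c interior_subset by blast
  obtain T \<beta>0 \<beta> where T: "finite T" "T \<subseteq> W" "card T \<le> m" "0 < \<beta>0"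
    "\<And>v. v \<in> T \<Longrightarrow> 0 \<le> \<beta> v" "\<beta>0 + sum \<beta> T = 1" "p = \<beta>0 *\<^sub>R c + (\<Sum>v\<in>T. \<beta> v *\<^sub>R v)"
    using interior_point_combination[OF p(1) cin] unfolding m_def by auto
  have Tint: "T \<subseteq> int_lattice" using T W by blast
  obtain N where "1 / \<beta>0 < 2 ^ N" using real_arch_pow[of 2 "1 / \<beta>0"] by auto
  then have "1 \<le> \<beta>0 * 2 ^ N" using T(4) by (simp add: field_simps)
  moreover have "1 / approx_scale m (Suc m) \<le> 1" using approx_scale_pos[of m "Suc m"] by (simp add: divide_le_eq_1)
  ultimately have "1 / approx_scale m (Suc m) \<le> \<beta>0 * 2 ^ N" by linarith
  moreover have "z = \<beta>0 *\<^sub>R c + (\<Sum>v\<in>T. \<beta> v *\<^sub>R v) + \<rho> *\<^sub>R w" using p(2) T(7) by simp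
  ultimately obtain \<gamma>0 \<gamma> x \<sigma> where g: "1 / approx_scale m (Suc m) \<le> \<gamma>0" "\<forall>v\<in>T. 0 \<le> \<gamma> v" "\<gamma>0 + sum \<gamma> T = 1"
    "x \<in> int_lattice" "x = \<gamma>0 *\<^sub>R c + (\<Sum>v\<in>T. \<gamma> v *\<^sub>R v) + \<sigma> *\<^sub>R w"
    using large_coefficient[OF T(1,3) Tint T(4-6) z(1)] by blast
  have \<gamma>0: "1 / \<kappa> \<le> \<gamma>0" using g(1) by (simp only: \<kappa>_def)
  then have \<gamma>pos: "\<gamma>0 > 0" using \<kappa> by (smt (verit) divide_pos_pos)
  \<comment> \<open>Moving \<open>c\<close> by \<open>\<tau>\<close> along \<open>w\<close> moves
    the combination by \<open>frac \<sigma>\<close>, since \<open>c\<close> has weight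
    \<open>\<gamma>0\<close>. The lower bound \<open>1 / \<kappa>\<close> on this weight keeps the
    moved point on the interior segment; the integer part of \<open>\<sigma>\<close> is a lattice
    translation.\<close>
  define \<tau> where "\<tau> = frac \<sigma> / \<gamma>0"
  have \<tau>: "0 \<le> \<tau>" "\<tau> \<le> \<kappa>"
  proof -
    show "0 \<le> \<tau>" using \<gamma>pos frac_ge_0[of \<sigma>] by (simp add: \<tau>_def)
    have "frac \<sigma> \<le> 1" using frac_lt_1[of \<sigma>] by simp
    also have "1 \<le> \<kappa> * \<gamma>0" using \<gamma>0 \<kappa> by (simp add: field_simps)
    finally show "\<tau> \<le> \<kappa>" using \<gamma>pos by (simp add: \<tau>_def field_simps)
  qed
  have c\<tau>: "c + \<tau> *\<^sub>R w \<in> interior (convex hull W)"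
  proof -
    have "(1 - \<tau>/\<kappa>) *\<^sub>R c + (\<tau>/\<kappa>) *\<^sub>R (c + \<kappa> *\<^sub>R w) \<in> interior (convex hull W)"
      using c c\<kappa> \<tau> \<kappa> by (intro convexD convex_interior) auto
    also have "(1 - \<tau>/\<kappa>) *\<^sub>R c + (\<tau>/\<kappa>) *\<^sub>R (c + \<kappa> *\<^sub>R w) = c + \<tau> *\<^sub>R w"
      using \<kappa> by (simp add: algebra_simps)
    finally show ?thesis .
  qed
  define x' where "x' = x - of_int \<lfloor>\<sigma>\<rfloor> *\<^sub>R w"
  have x'int: "x' \<in> int_lattice" unfolding x'_def using g(4) w by (intro int_lattice_diff int_lattice_scale) auto
  have x'eq: "x' = \<gamma>0 *\<^sub>R (c + \<tau> *\<^sub>R w) + (\<Sum>v\<in>T. \<gamma> v *\<^sub>R v)"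
  proof -
    have "\<gamma>0 * \<tau> = frac \<sigma>" using \<gamma>pos by (simp add: \<tau>_def)
    then have "\<gamma>0 *\<^sub>R (c + \<tau> *\<^sub>R w) = \<gamma>0 *\<^sub>R c + frac \<sigma> *\<^sub>R w" by (simp add: scaleR_add_right)
    then show ?thesis by (simp add: x'_def g(5) frac_def scaleR_left_diff_distrib)
  qed
  have "x' \<in> interior (convex hull W)"
  proof (cases "\<gamma>0 = 1")
    case True
    then have "sum \<gamma> T = 0" using g(3) by simp
    then have "\<forall>v\<in>T. \<gamma> v = 0" using g(2) T(1) by (simp add: sum_nonneg_eq_0_iff)
    then show ?thesis using x'eq True c\<tau> by simp
  next
    case False
    have "sum \<gamma> T \<ge> 0" using g(2) by (intro sum_nonneg) auto
    then have lt: "\<gamma>0 < 1" using g(3) False by linarith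
    define y where "y = (\<Sum>v\<in>T. (\<gamma> v / (1 - \<gamma>0)) *\<^sub>R v)"
    have "y \<in> convex hull T"
      unfolding convex_hull_finite[OF T(1)] y_def
    proof (intro CollectI exI conjI)
      show "\<forall>v\<in>T. 0 \<le> \<gamma> v / (1 - \<gamma>0)" using g(2) lt by simp
      have "sum \<gamma> T = 1 - \<gamma>0" using g(3) by simp
      then show "(\<Sum>v\<in>T. \<gamma> v / (1 - \<gamma>0)) = 1" using lt by (simp flip: sum_divide_distrib)
    qed simp
    then have yW: "y \<in> convex hull W" using hull_mono[OF T(2), of convex] by blast
    have "(1 - \<gamma>0) *\<^sub>R y = (\<Sum>v\<in>T. \<gamma> v *\<^sub>R v)"
      unfolding y_def scaleR_sum_right using lt by (intro sum.cong) auto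
    then have "x' = y - \<gamma>0 *\<^sub>R (y - (c + \<tau> *\<^sub>R w))"
      unfolding x'eq by (simp add: algebra_simps)
    then show ?thesis
      using mem_interior_convex_shrink[OF convex_convex_hull c\<tau> yW \<gamma>pos] lt by simp
  qed
  then show False using hollowD[OF W(3)] x'int by blast
qed

section \<open>Long chords in a tuple\<close>

lemma sum_sets_memI:
  "finite I \<Longrightarrow> (\<And>i. i \<in> I \<Longrightarrow> s i \<in> S i) \<Longrightarrow> (\<Sum>i\<in>I. s i) \<in> (\<Sum>i\<in>I. S i)"
  by (auto simp: set_sum_alt)

lemma convex_hull_sum_sets:
  fixes V :: "'i \<Rightarrow> 'a::real_vector set"
  assumes "finite I"
  shows "convex hull (\<Sum>i\<in>I. V i) = (\<Sum>i\<in>I. convex hull V i)"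
  using assms by (induction I) (simp_all add: convex_hull_set_plus set_zero)

lemma sum_sets_int_lattice:
  assumes "finite I" "\<And>i. i \<in> I \<Longrightarrow> V i \<subseteq> int_lattice"
  shows "(\<Sum>i\<in>I. V i) \<subseteq> int_lattice"
  using assms by (auto simp: set_sum_alt intro!: int_lattice_sum)

lemma hollow_sum_plus_long_chord:
  fixes V :: "'i \<Rightarrow> (real^'n) set"
  assumes I: "finite I" "j \<in> I" and V: "\<And>i. i \<in> I \<Longrightarrow> lattice_body (V i)"
    and hol: "hollow (\<Sum>i\<in>I. convex hull V i)" and w: "w \<in> int_lattice"
    and x: "x \<in> (\<Sum>i\<in>I. convex hull V i)" "x + chord_bound TYPE('n) *\<^sub>R w \<in> (\<Sum>i\<in>I. convex hull V i)"
  shows "hollow ((\<Sum>i\<in>I. convex hull V i) + span {w})"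
proof -
  have "interior (\<Sum>i\<in>I. convex hull V i) \<noteq> {}"
    by (rule interior_sum_nonempty[OF I]) (use V in \<open>simp add: lattice_body_def\<close>)
  moreover have "(\<Sum>i\<in>I. V i) \<subseteq> int_lattice"
    using V I by (intro sum_sets_int_lattice) (auto simp: lattice_body_def)
  ultimately show ?thesis
    using hollow_plus_long_chord[of "\<Sum>i\<in>I. V i" w x] hol w x
    unfolding convex_hull_sum_sets[OF I(1)] by blast
qed

section \<open>Heights along a chord\<close>

lemma shorten_chord:
  assumes "convex X" "x \<in> X" "x + r *\<^sub>R w \<in> X" "0 \<le> s" "s \<le> r"
  shows "x + s *\<^sub>R w \<in> X"
proof (cases "r = 0")
  case False
  then have r: "r > 0" using assms by linarith
  have "(1 - s/r) *\<^sub>R x + (s/r) *\<^sub>R (x + r *\<^sub>R w) \<in> X"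
    using assms r by (intro convexD) auto
  also have "(1 - s/r) *\<^sub>R x + (s/r) *\<^sub>R (x + r *\<^sub>R w) = x + s *\<^sub>R w"
    using r by (simp add: algebra_simps)
  finally show ?thesis .
qed (use assms in simp)

lemma linear_oscillation_convex_hull:
  fixes h :: "'a::real_vector \<Rightarrow> real"
  assumes h: "linear h" and W: "\<And>u v. u \<in> W \<Longrightarrow> v \<in> W \<Longrightarrow> h u - h v \<le> C"
    and xy: "x \<in> convex hull W" "y \<in> convex hull W"
  shows "h x - h y \<le> C"
proof -
  interpret h: linear h by (fact h)
  have cu: "convex {x. h x \<le> c}" "convex {x. c \<le> h x}" for c
    using convex_linear_vimage[OF h, of "{..c}"] convex_linear_vimage[OF h, of "{c..}"]
    by (simp_all add: vimage_def)
  have 1: "h x \<le> C + h v" if "v \<in> W" for v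
  proof -
    have "W \<subseteq> {x. h x \<le> C + h v}" using W that by force
    then have "convex hull W \<subseteq> {x. h x \<le> C + h v}" using cu(1) by (rule hull_minimal)
    then show ?thesis using xy by blast
  qed
  then have "W \<subseteq> {y. h x - C \<le> h y}" by force
  then have "convex hull W \<subseteq> {y. h x - C \<le> h y}" using cu(2) by (rule hull_minimal)
  then show ?thesis using xy by force
qed

text \<open>Heights add over summands, so a long chord of the sum forces some \<open>V i\<close> to
  have height oscillation above \<open>2 * \<kappa>\<close>. Its two extreme points need not differ
  by a multiple of \<open>w\<close>; adding points of the reference simplex to both corrects their
  images under \<open>\<phi>\<close> without affecting the height difference.\<close>

lemma long_chord_pair:
  fixes V :: "'i \<Rightarrow> (real^'n) set" and a :: "'m::finite \<Rightarrow> real^'n" and \<phi> :: "real^'n \<Rightarrow> real^'m"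
  assumes I: "finite I" "k \<in> I" "i0 \<in> I" "i0 \<noteq> k"
    and a: "a0 \<in> V k" "\<And>l. a l \<in> V k" and w: "w \<noteq> 0"
    and \<phi>: "linear \<phi>" "\<And>l. \<phi> (a l - a0) = axis l 1" "{z. \<phi> z = 0} = span {w}"
    and simplex: "\<And>i. i \<in> I \<Longrightarrow> \<exists>t. (\<lambda>x. \<phi> (x + t)) ` V i = insert 0 (range (\<lambda>l. axis l 1))"
    and \<kappa>: "\<kappa> > (0::real)"
    and x: "x \<in> (\<Sum>i\<in>I. convex hull V i)" "x + K *\<^sub>R w \<in> (\<Sum>i\<in>I. convex hull V i)" 
      "K > 2 * \<kappa> * card I"
  shows "\<exists>i\<in>I. i \<noteq> k \<and> (\<exists>y\<in>convex hull V i + convex hull V k. y + \<kappa> *\<^sub>R w \<in> convex hull V i + convex hull V k)"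
proof (rule ccontr)
  assume no: "\<not> ?thesis"
  interpret \<phi>: linear \<phi> by (fact \<phi>(1))
  \<comment> \<open>Projection onto the line of \<open>w\<close> along the edges of the reference
    simplex. The resulting height \<open>h\<close> is 1 on \<open>w\<close> and constant on the
    reference vertices.\<close>
  define R where "R z = z - (\<Sum>l\<in>UNIV. (\<phi> z $ l) *\<^sub>R (a l - a0))" for z
  have "linear R"
  proof (rule linearI)
    show "R (y + z) = R y + R z" for y z
      by (simp add: R_def \<phi>.add scaleR_left_distrib sum.distrib)
    show "R (r *\<^sub>R z) = r *\<^sub>R R z" for r z
      by (simp add: R_def \<phi>.scale scaleR_right_diff_distrib[of r z] scaleR_sum_right)
  qed
  then interpret R: linear R .
  define h where "h z = (R z \<bullet> w) / (w \<bullet> w)" for z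
  have h: "linear h"
    by (rule linearI) (simp_all add: h_def R.add R.scale inner_add_left add_divide_distrib)
  interpret h: linear h by (fact h)
  have "\<phi> w = 0" using \<phi>(3) span_base[of w "{w}"] by blast
  then have hw: "h w = 1" using w by (simp add: h_def R_def)
  have ha: "h (a l - a0) = 0" for l
  proof -
    have "(\<Sum>q\<in>UNIV. (axis l (1::real) $ q) *\<^sub>R (a q - a0)) = (\<Sum>q\<in>UNIV. if q = l then a q - a0 else 0)"
      by (intro sum.cong) (auto simp: axis_def)
    then show ?thesis by (simp add: h_def R_def \<phi>(2))
  qed
  define S where "S = insert a0 (range a)"
  have SV: "S \<subseteq> V k" using a by (auto simp: S_def)
  have hS: "h b = h a0" if "b \<in> S" for b
    using that ha by (auto simp: S_def h.diff)
  have \<phi>S: "(\<lambda>b. \<phi> b - \<phi> a0) ` S = insert 0 (range (\<lambda>l. axis l 1))"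
    using \<phi>(2) by (auto simp: S_def \<phi>.diff image_iff)
  have width: "h v - h v' \<le> 2 * \<kappa>" if i: "i \<in> I" and v: "v \<in> V i" "v' \<in> V i" for i v v'
  proof (rule ccontr)
    define r where "r = h v - h v'"
    assume "\<not> ?thesis"
    then have r: "r > 2 * \<kappa>" by (simp add: r_def)
    obtain t where t: "(\<lambda>x. \<phi> (x + t)) ` V i = insert 0 (range (\<lambda>l. axis l 1))" using simplex[OF i] by blast
    have "\<phi> (v + t) \<in> (\<lambda>b. \<phi> b - \<phi> a0) ` S" "\<phi> (v' + t) \<in> (\<lambda>b. \<phi> b - \<phi> a0) ` S"
      using v t unfolding \<phi>S by blast+
    then obtain b b' where b: "b \<in> S" "\<phi> (v + t) = \<phi> b - \<phi> a0" "b' \<in> S" "\<phi> (v' + t) = \<phi> b' - \<phi> a0"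
      by blast
    have "\<phi> ((v + b') - (v' + b)) = \<phi> (v + t) - \<phi> (v' + t) + \<phi> b' - \<phi> b"
      by (simp add: \<phi>.diff \<phi>.add)
    then have "\<phi> ((v + b') - (v' + b)) = 0" using b by simp
    then have "(v + b') - (v' + b) \<in> span {w}" using \<phi>(3) by blast
    then obtain s where s: "(v + b') - (v' + b) = s *\<^sub>R w" by (auto simp: span_singleton)
    have "h ((v + b') - (v' + b)) = s" unfolding s by (simp add: h.scale hw)
    then have "s = r" using hS[OF b(1)] hS[OF b(3)] by (simp add: h.diff h.add r_def)
    then have eq: "v + b' = (v' + b) + r *\<^sub>R w" using s by (simp add: algebra_simps)
    have bk: "b \<in> convex hull V k" "b' \<in> convex hull V k" using b SV by (auto intro: hull_inc)
    show False
    proof (cases "i = k")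
      case False
      let ?X = "convex hull V i + convex hull V k"
      have vi: "v \<in> convex hull V i" "v' \<in> convex hull V i" using v by (auto intro: hull_inc)
      have X: "v' + b \<in> ?X" "v + b' \<in> ?X" using vi bk by blast+
      have "convex ?X" by (intro convex_set_plus convex_convex_hull)
      then have "(v' + b) + \<kappa> *\<^sub>R w \<in> ?X"
        using shorten_chord[OF _ X(1), of r w \<kappa>] X(2) r \<kappa> unfolding eq by simp
      then show False using no i False X(1) by blast
    next
      \<comment> \<open>The reference polytope cannot be paired with itself. Averaging its points
        gives a chord of half the length inside it, which explains the factor 2, and any point of
        another summand completes a pair.\<close>
      case True
      let ?X = "convex hull V i0 + convex hull V k"
      have vk: "v \<in> convex hull V k" "v' \<in> convex hull V k" using v True by (auto intro: hull_inc)
      obtain t0 where "(\<lambda>x. \<phi> (x + t0)) ` V i0 = insert 0 (range (\<lambda>l. axis l 1))" using simplex[OF I(3)] by blast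
      then have "V i0 \<noteq> {}" by auto
      then obtain u where "u \<in> V i0" by blast
      then have u: "u \<in> convex hull V i0" by (rule hull_inc)
      have "(1/2) *\<^sub>R v' + (1/2) *\<^sub>R b \<in> convex hull V k" "(1/2) *\<^sub>R v + (1/2) *\<^sub>R b' \<in> convex hull V k"
        using vk bk by (intro convexD; simp)+
      moreover have "(1/2) *\<^sub>R v + (1/2) *\<^sub>R b' = ((1/2) *\<^sub>R v' + (1/2) *\<^sub>R b) + (r/2) *\<^sub>R w"
        using arg_cong[OF eq, of "scaleR (1/2)"] by (simp add: scaleR_add_right)
      ultimately have c: "(1/2) *\<^sub>R v' + (1/2) *\<^sub>R b \<in> convex hull V k" 
        "((1/2) *\<^sub>R v' + (1/2) *\<^sub>R b) + \<kappa> *\<^sub>R w \<in> convex hull V k"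
        using shorten_chord[of "convex hull V k" "(1/2) *\<^sub>R v' + (1/2) *\<^sub>R b" "r/2" w \<kappa>] r \<kappa> by auto
      then have "u + ((1/2) *\<^sub>R v' + (1/2) *\<^sub>R b) \<in> ?X" "(u + ((1/2) *\<^sub>R v' + (1/2) *\<^sub>R b)) + \<kappa> *\<^sub>R w \<in> ?X"
        unfolding add.assoc[of u] using u by blast+
      then show False using no I by blast
    qed
  qed
  obtain p where p: "x = (\<Sum>i\<in>I. p i)" "\<And>i. i \<in> I \<Longrightarrow> p i \<in> convex hull V i"
    using x(1) unfolding set_sum_alt[OF I(1)] by blast
  obtain q where q: "x + K *\<^sub>R w = (\<Sum>i\<in>I. q i)" "\<And>i. i \<in> I \<Longrightarrow> q i \<in> convex hull V i"
    using x(2) unfolding set_sum_alt[OF I(1)] by blast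
  have "K = h (x + K *\<^sub>R w) - h x" by (simp add: h.add h.scale hw)
  also have "\<dots> = (\<Sum>i\<in>I. h (q i) - h (p i))"
    using arg_cong[OF q(1), of h] arg_cong[OF p(1), of h] by (simp only: h.sum sum_subtractf)
  also have "\<dots> \<le> (\<Sum>i\<in>I. 2 * \<kappa>)"
  proof (rule sum_mono)
    fix i assume i: "i \<in> I"
    show "h (q i) - h (p i) \<le> 2 * \<kappa>"
      by (rule linear_oscillation_convex_hull[OF h width[OF i] q(2)[OF i] p(2)[OF i]])
  qed
  also have "\<dots> = 2 * \<kappa> * card I" by simp
  finally show False using x(3) by linarith
qed

text \<open>A sum omitting one index has fewer than \<open>CARD('n)\<close> summands, so some
  summand must contribute height oscillation above \<open>2 * chord_bound TYPE('n)\<close>.\<close>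

definition long_chord :: "'n::finite itself \<Rightarrow> real" where
  "long_chord _ = 2 * chord_bound TYPE('n) * CARD('n)"

theorem long_chord_projection:
  fixes V :: "'n::finite \<Rightarrow> (real^'n) set"
  assumes n: "CARD('n) \<ge> 4" "CARD('m::finite) + 1 = CARD('n)" and V: "\<And>i. lattice_body (V i)"
    and hol: "\<And>I. card I = CARD('n) - 1 \<Longrightarrow> hollow (\<Sum>i\<in>I. convex hull V i)"
    and w: "w \<in> int_lattice" "w \<noteq> 0"
    and x: "x \<in> (\<Sum>i\<in>UNIV - {j0}. convex hull V i)" 
      "x + long_chord TYPE('n) *\<^sub>R w \<in> (\<Sum>i\<in>UNIV - {j0}. convex hull V i)"
  obtains \<phi> :: "real^'n \<Rightarrow> real^'m" where "linear \<phi>" "\<phi> ` int_lattice = int_lattice"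
    "\<And>i. \<exists>t\<in>int_lattice. (\<lambda>x. \<phi> (x + t)) ` V i = insert 0 (range (\<lambda>l. axis l 1))"
proof -
  let ?\<kappa> = "chord_bound TYPE('n)"
  have \<kappa>: "?\<kappa> > 0" by (rule chord_bound_pos)
  have cI: "card (UNIV - {j}) + 1 = CARD('n)" for j :: 'n using n(1) by (simp add: card_Diff_singleton)
  let ?I = "UNIV - {j0}"
  have fI: "finite ?I" by simp
  obtain i0 k where ik: "i0 \<in> ?I" "k \<in> ?I" "i0 \<noteq> k"
  proof -
    have "2 \<le> card ?I" using n(1) cI[of j0] by linarith
    then obtain B where "B \<subseteq> ?I" "card B = 2" by (meson obtain_subset_with_card_n)
    then show ?thesis using that by (auto simp: card_2_iff)
  qed
  have line: "hollow ((\<Sum>i\<in>UNIV - {j}. convex hull V i) + span {w})"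
    if "i \<noteq> j" "y \<in> (\<Sum>i\<in>UNIV - {j}. convex hull V i)" "y + ?\<kappa> *\<^sub>R w \<in> (\<Sum>i\<in>UNIV - {j}. convex hull V i)" for i j y
    using that w V hol[of "UNIV - {j}"] cI[of j] by (intro hollow_sum_plus_long_chord[of _ i]) auto
  have "?\<kappa> * 1 \<le> ?\<kappa> * (2 * real CARD('n))" using \<kappa> n(1) by (intro mult_left_mono) auto
  then have "?\<kappa> \<le> long_chord TYPE('n)" by (simp add: long_chord_def mult_ac)
  moreover have "convex (\<Sum>i\<in>?I. convex hull V i)" by (intro convex_sum_sets) simp
  ultimately have "x + ?\<kappa> *\<^sub>R w \<in> (\<Sum>i\<in>?I. convex hull V i)"
    using shorten_chord[OF _ x] \<kappa> by simp
  then have hI: "hollow ((\<Sum>i\<in>?I. convex hull V i) + span {w})"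
    using line[of i0 j0 x] x ik by auto
  have ai: "aff_indep_mod (span {w}) A" if "A \<subseteq> V k" "inequiv_mod (span {w}) A" for A
  proof (rule affine_independence_mod_hollow_sum[of ?I V "{w}" k A])
    have "dim {w} = 1" using w(2) by (simp add: dim_insert)
    then show "dim {w} + card ?I = CARD('n)" using cI[of j0] by simp
  qed (use V w hI ik that in \<open>auto simp: lattice_body_def\<close>)
  obtain a0 and a :: "'m \<Rightarrow> real^'n" and \<phi> :: "real^'n \<Rightarrow> real^'m"
    where a: "a0 \<in> V k" "\<And>l. a l \<in> V k" 
      and \<phi>: "linear \<phi>" "\<And>l. \<phi> (a l - a0) = axis l 1" "{z. \<phi> z = 0} = span {w}"
    by (rule simplex_coordinates_exist[OF V w(2) n(2) ai]) (assumption | rule that)+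
  interpret \<phi>: linear \<phi> by (fact \<phi>(1))
  have simplex: "\<exists>t\<in>int_lattice. (\<lambda>x. \<phi> (x + t)) ` V i = insert 0 (range (\<lambda>l. axis l 1))" if "i \<in> ?I" for i
    by (rule projects_to_simplex[OF fI cI n(2) V w hI ik(2) a \<phi> that])
  have K: "long_chord TYPE('n) > 2 * ?\<kappa> * card ?I"
    using \<kappa> n(1) by (simp add: long_chord_def card_Diff_singleton)
  obtain i y where i: "i \<in> ?I" "i \<noteq> k" 
    and y: "y \<in> convex hull V i + convex hull V k" "y + ?\<kappa> *\<^sub>R w \<in> convex hull V i + convex hull V k"
    using long_chord_pair[OF fI ik(2,1,3) a w(2) \<phi> _ \<kappa> x K] simplex by blast
  \<comment> \<open>Here dimension at least four enters. Omitting \<open>j1\<close> instead of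
    \<open>j0\<close> retains the pair with its chord and brings in the polytope missed so far;
    \<open>\<phi>\<close> can be kept, since its reference index \<open>k\<close> belongs to both
    sums.\<close>
  obtain j1 where j1: "j1 \<notin> {j0, i, k}"
  proof -
    have c3: "card {j0, i, k} \<le> 3" by (simp add: card_insert_if)
    have "{j0, i, k} \<noteq> UNIV"
    proof
      assume "{j0, i, k} = UNIV"
      then show False using c3 n(1) by simp
    qed
    then show ?thesis using that by blast
  qed
  let ?I' = "UNIV - {j1}"
  have "finite (?I' - {i, k})" by simp
  define s where "s = (\<Sum>l\<in>?I' - {i, k}. SOME v. v \<in> V l)"
  have s: "s \<in> (\<Sum>l\<in>?I' - {i, k}. convex hull V l)"
  proof -
    have "V l \<noteq> {}" for l using V[of l] by (auto simp: lattice_body_def)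
    then have "(SOME v. v \<in> V l) \<in> convex hull V l" for l by (simp add: some_in_eq hull_inc)
    then show ?thesis unfolding s_def by (intro sum_sets_memI) auto
  qed
  have split: "(\<Sum>l\<in>?I'. convex hull V l) = convex hull V i + convex hull V k + (\<Sum>l\<in>?I' - {i, k}. convex hull V l)"
  proof -
    have "(\<Sum>l\<in>?I'. convex hull V l) = (\<Sum>l\<in>?I' - {i, k}. convex hull V l) + (\<Sum>l\<in>{i, k}. convex hull V l)"
      using j1 by (intro sum.subset_diff) auto
    then show ?thesis using i(2) by (simp add: add.commute)
  qed
  have "y + s \<in> (\<Sum>l\<in>?I'. convex hull V l)" "(y + ?\<kappa> *\<^sub>R w) + s \<in> (\<Sum>l\<in>?I'. convex hull V l)"
    unfolding split using y s by blast+
  then have hI': "hollow ((\<Sum>i\<in>?I'. convex hull V i) + span {w})"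
    using line[of i j1 "y + s"] j1 by (auto simp: add_ac)
  have k': "k \<in> ?I'" "j0 \<in> ?I'" and fI': "finite ?I'" using j1 by auto
  have simplex': "\<exists>t\<in>int_lattice. (\<lambda>x. \<phi> (x + t)) ` V j0 = insert 0 (range (\<lambda>l. axis l 1))"
    by (rule projects_to_simplex[OF fI' cI n(2) V w hI' k'(1) a \<phi> k'(2)])
  have "\<phi> ` int_lattice = int_lattice"
  proof
    show "\<phi> ` int_lattice \<subseteq> int_lattice"
      using coordinates_integral_width(1)[OF fI cI n(2) V w hI ik(2) a \<phi>]
      unfolding int_lattice_def[where 'n = 'm] by blast
    have lat: "a0 \<in> int_lattice" "\<And>l. a l \<in> int_lattice"
      using V[of k] a by (auto simp: lattice_body_def)
    show "int_lattice \<subseteq> \<phi> ` int_lattice"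
    proof
      fix z :: "real^'m" assume z: "z \<in> int_lattice"
      have "\<phi> (\<Sum>l\<in>UNIV. (z $ l) *\<^sub>R (a l - a0)) = (\<Sum>l\<in>UNIV. (z $ l) *\<^sub>R axis l 1)"
        unfolding \<phi>.sum \<phi>.scale \<phi>(2) ..
      also have "\<dots> = z" using basis_expansion[of z] unfolding scalar_mult_eq_scaleR .
      finally have "z = \<phi> (\<Sum>l\<in>UNIV. (z $ l) *\<^sub>R (a l - a0))" by simp
      moreover have "(\<Sum>l\<in>UNIV. (z $ l) *\<^sub>R (a l - a0)) \<in> int_lattice"
        using lat z by (intro int_lattice_sum int_lattice_scale int_lattice_diff) (auto simp: int_lattice_def)
      ultimately show "z \<in> \<phi> ` int_lattice" by blast
    qed
  qed
  moreover have "\<exists>t\<in>int_lattice. (\<lambda>x. \<phi> (x + t)) ` V i = insert 0 (range (\<lambda>l. axis l 1))" for i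
    by (cases "i = j0") (simp_all only: simplex' simplex Diff_iff UNIV_I singleton_iff simp_thms)
  ultimately show ?thesis
    by (rule that[OF \<phi>(1)])
qed

section \<open>Tuples without long chords\<close>

lemma sum_sets_difference:
  fixes V :: "'i \<Rightarrow> 'a::ab_group_add set"
  assumes "finite I" "k \<in> I" "b \<in> V k" "c \<in> V k" "\<And>i. i \<in> I \<Longrightarrow> V i \<noteq> {}"
  obtains y y' where "y \<in> (\<Sum>i\<in>I. V i)" "y' \<in> (\<Sum>i\<in>I. V i)" "y - y' = b - c"
proof -
  have "(\<Sum>i\<in>I - {k}. V i) \<noteq> {}" using assms(5) by (intro sum_sets_nonempty) auto
  then obtain s where s: "s \<in> (\<Sum>i\<in>I - {k}. V i)" by blast
  have "(\<Sum>i\<in>I. V i) = V k + (\<Sum>i\<in>I - {k}. V i)" by (rule sum.remove[OF assms(1,2)])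
  then have "b + s \<in> (\<Sum>i\<in>I. V i)" "c + s \<in> (\<Sum>i\<in>I. V i)" using assms s by auto
  then show ?thesis by (rule that) simp
qed

lemma chord_from_differences:
  fixes X :: "'a::real_vector set" and x :: "'i \<Rightarrow> 'a"
  assumes X: "convex X" "X \<noteq> {}" and I: "finite I"
    and x: "\<And>i. i \<in> I \<Longrightarrow> \<exists>y\<in>X. \<exists>y'\<in>X. y - y' = x i" and c: "(\<Sum>i\<in>I. \<bar>c i\<bar>) \<le> 1"
  obtains p where "p \<in> X" "p + (\<Sum>i\<in>I. c i *\<^sub>R x i) \<in> X"
proof -
  obtain y0 where y0: "y0 \<in> X" using X by blast
  have "\<exists>u v. u \<in> X \<and> v \<in> X \<and> c i *\<^sub>R x i = \<bar>c i\<bar> *\<^sub>R (v - u)" if i: "i \<in> I" for i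
  proof -
    obtain y y' where y: "y \<in> X" "y' \<in> X" "y - y' = x i" using x[OF i] by blast
    show ?thesis
    proof (cases "c i \<ge> 0")
      case True
      then show ?thesis using y by (intro exI[of _ y'] exI[of _ y]) simp
    next
      case False
      then have "c i *\<^sub>R (y - y') = \<bar>c i\<bar> *\<^sub>R (y' - y)" by (simp add: algebra_simps)
      then show ?thesis using y by metis
    qed
  qed
  then obtain u v where uv: "\<And>i. i \<in> I \<Longrightarrow> u i \<in> X" "\<And>i. i \<in> I \<Longrightarrow> v i \<in> X"
    "\<And>i. i \<in> I \<Longrightarrow> c i *\<^sub>R x i = \<bar>c i\<bar> *\<^sub>R (v i - u i)" by metis
  define S where "S = (\<Sum>i\<in>I. \<bar>c i\<bar>)"
  have comb: "(1 - S) *\<^sub>R y0 + (\<Sum>i\<in>I. \<bar>c i\<bar> *\<^sub>R f i) \<in> X" if f: "\<And>i. i \<in> I \<Longrightarrow> f i \<in> X" for f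
  proof (cases "S = 0")
    case True
    then have "\<forall>i\<in>I. \<bar>c i\<bar> = 0" using I by (simp add: S_def sum_nonneg_eq_0_iff)
    then have "(\<Sum>i\<in>I. \<bar>c i\<bar> *\<^sub>R f i) = 0" by (intro sum.neutral) simp
    then show ?thesis using True y0 by simp
  next
    case False
    have S: "0 \<le> S" "S \<le> 1" using c by (auto simp: S_def intro: sum_nonneg)
    have "(\<Sum>i\<in>I. (\<bar>c i\<bar> / S) *\<^sub>R f i) \<in> X"
      using False S f by (intro convex_sum I X) (auto simp: S_def simp flip: sum_divide_distrib)
    then have "(1 - S) *\<^sub>R y0 + S *\<^sub>R (\<Sum>i\<in>I. (\<bar>c i\<bar> / S) *\<^sub>R f i) \<in> X"
      using S y0 by (intro convexD[OF X(1)]) auto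
    moreover have "S *\<^sub>R (\<Sum>i\<in>I. (\<bar>c i\<bar> / S) *\<^sub>R f i) = (\<Sum>i\<in>I. \<bar>c i\<bar> *\<^sub>R f i)"
      using False by (simp add: scaleR_sum_right)
    ultimately show ?thesis by simp
  qed
  show ?thesis
  proof (rule that)
    show "(1 - S) *\<^sub>R y0 + (\<Sum>i\<in>I. \<bar>c i\<bar> *\<^sub>R u i) \<in> X" by (rule comb[OF uv(1)])
    have "(\<Sum>i\<in>I. c i *\<^sub>R x i) = (\<Sum>i\<in>I. \<bar>c i\<bar> *\<^sub>R v i) - (\<Sum>i\<in>I. \<bar>c i\<bar> *\<^sub>R u i)"
      using uv(3) by (simp add: scaleR_right_diff_distrib sum_subtractf)
    then show "(1 - S) *\<^sub>R y0 + (\<Sum>i\<in>I. \<bar>c i\<bar> *\<^sub>R u i) + (\<Sum>i\<in>I. c i *\<^sub>R x i) \<in> X"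
      using comb[OF uv(2)] by simp
  qed
qed

lemma cramer_rows:
  fixes y :: "'n::finite \<Rightarrow> real^'n"
  assumes "det (\<chi> i. y i) \<noteq> 0"
  shows "z = (\<Sum>l\<in>UNIV. (det (\<chi> i. if i = l then z else y i) / det (\<chi> i. y i)) *\<^sub>R y l)"
proof -
  let ?A = "\<chi> i. y i"
  have "invertible ?A" using assms by (simp add: invertible_det_nz)
  then obtain B where B: "B ** ?A = mat 1" unfolding invertible_def by blast
  define x where "x = z v* B"
  have "x v* ?A = z"
    unfolding x_def by (simp add: vector_matrix_mul_assoc B)
  moreover have "x v* ?A = (\<Sum>l\<in>UNIV. x $ l *\<^sub>R y l)"
    by (simp add: vec_eq_iff vector_matrix_mult_def mult.commute)
  ultimately have z: "z = (\<Sum>l\<in>UNIV. x $ l *\<^sub>R y l)" by simp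
  have row: "row i ?A = y i" for i by (simp add: row_def vec_eq_iff)
  have "det (\<chi> i. if i = l then z else y i) = x $ l * det ?A" for l
    using cramer_lemma_transpose[of l x ?A] unfolding scalar_mult_eq_scaleR row z[symmetric] .
  then show ?thesis using z assms by simp
qed

text \<open>With \<open>N\<close> at least \<open>K * CARD('n)\<close>, the approximation errors
  scaled by \<open>K\<close> have absolute sum at most one. The multipliers are at most
  \<open>N ^ CARD('n)\<close>, so the factorial is a common multiple \<open>D\<close> of them, and
  \<open>D ^ CARD('n)\<close> is the determinant of \<open>D\<close> times the identity.\<close>

definition det_bound :: "'n::finite itself \<Rightarrow> real \<Rightarrow> real" where
  "det_bound _ K = real (fact ((nat \<lceil>K * CARD('n)\<rceil> + 1) ^ CARD('n))) ^ CARD('n)"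

text \<open>Without long lattice chords, the lattice has bounded index over the sublattice generated by
  any basis of differences: Dirichlet approximation produces a short lattice vector otherwise.\<close>

lemma det_differences_bounded:
  fixes X :: "(real^'n) set" and x :: "'n::finite \<Rightarrow> real^'n"
  assumes X: "convex X" "X \<noteq> {}" and K: "K > 0"
    and no: "\<And>w p. w \<in> int_lattice \<Longrightarrow> w \<noteq> 0 \<Longrightarrow> p \<in> X \<Longrightarrow> p + K *\<^sub>R w \<notin> X"
    and x: "\<And>i. x i \<in> int_lattice" "\<And>i. \<exists>y\<in>X. \<exists>y'\<in>X. y - y' = x i"
  shows "\<bar>det (\<chi> i. x i)\<bar> \<le> det_bound TYPE('n) K"
proof (cases "det (\<chi> i. x i) = 0")
  case True
  then show ?thesis by (simp add: det_bound_def)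
next
  case False
  define N where "N = nat \<lceil>K * CARD('n)\<rceil> + 1"
  have N: "N > 0" "K * CARD('n) \<le> real N" unfolding N_def by (simp, linarith)
  define D where "D = (fact (N ^ CARD('n)) :: nat)"
  have "\<exists>M :: 'n \<Rightarrow> int. real D *\<^sub>R z = (\<Sum>i\<in>UNIV. of_int (M i) *\<^sub>R x i)" if z: "z \<in> int_lattice" for z
  proof -
    define \<zeta> where "\<zeta> l = det (\<chi> i. if i = l then z else x i) / det (\<chi> i. x i)" for l
    have z\<zeta>: "z = (\<Sum>l\<in>UNIV. \<zeta> l *\<^sub>R x l)" unfolding \<zeta>_def by (rule cramer_rows[OF False])
    obtain q :: nat and p where q: "0 < q" "q \<le> N ^ CARD('n)" 
      and p: "\<And>i. \<bar>real q * \<zeta> i - of_int (p i)\<bar> < 1 / N"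
      using simultaneous_approximation[of "UNIV :: 'n set" N \<zeta>] N(1) by auto
    \<comment> \<open>This lattice vector has such small coordinates that
      \<open>K *\<^sub>R w\<close> is a chord of \<open>X\<close>, so it must be zero:
      \<open>q\<close> times \<open>z\<close> is an integral combination of the
      \<open>x i\<close>.\<close>
    define w where "w = real q *\<^sub>R z - (\<Sum>i\<in>UNIV. of_int (p i) *\<^sub>R x i)"
    have wint: "w \<in> int_lattice"
      unfolding w_def using z x(1) by (intro int_lattice_diff int_lattice_scale int_lattice_sum) auto
    have Kw: "K *\<^sub>R w = (\<Sum>i\<in>UNIV. (K * (real q * \<zeta> i - of_int (p i))) *\<^sub>R x i)"
      unfolding w_def by (subst z\<zeta>) (simp add: scaleR_sum_right scaleR_right_diff_distrib scaleR_left_diff_distrib sum_subtractf right_diff_distrib)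
    have "(\<Sum>i\<in>UNIV. \<bar>K * (real q * \<zeta> i - of_int (p i))\<bar>) \<le> (\<Sum>i\<in>(UNIV::'n set). K * (1 / N))"
      using p K by (intro sum_mono) (simp add: abs_mult less_imp_le del: times_divide_eq_right)
    also have "\<dots> = K * CARD('n) / N" by simp
    also have "\<dots> \<le> 1" using N by simp
    finally have s: "(\<Sum>i\<in>UNIV. \<bar>K * (real q * \<zeta> i - of_int (p i))\<bar>) \<le> 1" .
    obtain r where "r \<in> X" "r + K *\<^sub>R w \<in> X"
      unfolding Kw by (rule chord_from_differences[OF X finite x(2) s])
    then have "w = 0" using no[OF wint] by blast
    then have qz: "real q *\<^sub>R z = (\<Sum>i\<in>UNIV. of_int (p i) *\<^sub>R x i)" by (simp add: w_def)
    have "q dvd D" unfolding D_def using q by (intro dvd_fact) auto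
    then obtain e where e: "D = e * q" by (metis dvd_def mult.commute)
    have "real D *\<^sub>R z = real e *\<^sub>R (real q *\<^sub>R z)" by (simp add: e)
    also have "\<dots> = (\<Sum>i\<in>UNIV. of_int (int e * p i) *\<^sub>R x i)"
      unfolding qz by (simp add: scaleR_sum_right)
    finally show ?thesis by (rule exI[of _ "\<lambda>i. int e * p i"])
  qed
  then have "\<forall>k. \<exists>M :: 'n \<Rightarrow> int. real D *\<^sub>R axis k 1 = (\<Sum>i\<in>UNIV. of_int (M i) *\<^sub>R x i)"
    using int_lattice_axis by blast
  then obtain M :: "'n \<Rightarrow> 'n \<Rightarrow> int" where M: "\<And>k. real D *\<^sub>R axis k 1 = (\<Sum>i\<in>UNIV. of_int (M k i) *\<^sub>R x i)"
    by metis
  \<comment> \<open>Its determinant is a nonzero integer, so the other factor of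
    \<open>D ^ CARD('n)\<close> cannot be larger than the product in absolute value.\<close>
  define A where "A = (\<chi> k i. real_of_int (M k i))"
  have "A ** (\<chi> i. x i) = (\<chi> i j. if i = j then real D else 0)"
  proof (simp add: vec_eq_iff matrix_matrix_mult_def A_def, intro allI conjI impI)
    fix k j :: 'n
    have *: "(\<Sum>i\<in>UNIV. real_of_int (M k i) * x i $ j) = (real D *\<^sub>R axis k 1) $ j"
      unfolding M by simp
    show "k = j \<Longrightarrow> (\<Sum>i\<in>UNIV. real_of_int (M j i) * x i $ j) = real D" using * by (simp add: axis_def)
    show "k \<noteq> j \<Longrightarrow> (\<Sum>i\<in>UNIV. real_of_int (M k i) * x i $ j) = 0" unfolding * by (simp add: axis_def)
  qed
  then have "det (A ** (\<chi> i. x i)) = real D ^ CARD('n)"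
    using det_diagonal[of "(\<chi> i j. if i = j then real D else 0) :: real^'n^'n"] by simp
  then have dd: "det A * det (\<chi> i. x i) = real D ^ CARD('n)" by (simp add: det_mul)
  have "D > 0" by (simp add: D_def)
  then have "det A \<noteq> 0" using dd by auto
  moreover have "det A \<in> \<int>" by (rule det_in_Ints) (simp add: A_def int_lattice_def)
  ultimately have "1 \<le> \<bar>det A\<bar>" by (auto elim!: Ints_cases)
  then have "1 * \<bar>det (\<chi> i. x i)\<bar> \<le> \<bar>det A\<bar> * \<bar>det (\<chi> i. x i)\<bar>" by (intro mult_right_mono) auto
  also have "\<dots> = real D ^ CARD('n)" using dd by (simp flip: abs_mult)
  also have "\<dots> = det_bound TYPE('n) K" by (simp add: det_bound_def D_def N_def)
  finally show ?thesis by simp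
qed

text \<open>\<open>T\<close> turns coordinates with respect to a basis of lattice vectors into
  vectors. In these coordinates the lattice lies between the integer vectors and their multiples by
  \<open>1 / d\<close>, and every polytope of the tuple has bounded size.\<close>

definition bounded_frame :: "real \<Rightarrow> ('n::finite \<Rightarrow> (real^'n) set) \<Rightarrow> (real^'n \<Rightarrow> real^'n) \<Rightarrow> bool" where
  "bounded_frame C V T \<longleftrightarrow> linear T \<and> bij T \<and> T ` int_lattice \<subseteq> int_lattice \<and>
    (\<exists>d::nat. 0 < d \<and> real d \<le> C \<and> (\<forall>z\<in>int_lattice. real d *\<^sub>R inv T z \<in> int_lattice)) \<and>
    (\<forall>i. \<forall>v\<in>V i. \<forall>v'\<in>V i. \<forall>l. \<bar>inv T (v - v') $ l\<bar> \<le> C)"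

text \<open>The basis consists of differences within a single \<open>V k0\<close>. By Cramer's rule
  coordinates are quotients of determinants of differences: numerators are bounded, and the
  denominator is a nonzero integer that also serves as \<open>d\<close>.\<close>

lemma bounded_frame_exists:
  fixes V :: "'n::finite \<Rightarrow> (real^'n) set"
  assumes n: "CARD('n) \<ge> 3" and V: "\<And>i. lattice_body (V i)" and K: "K > 0"
    and no: "\<And>j w p. w \<in> int_lattice \<Longrightarrow> w \<noteq> 0 \<Longrightarrow> p \<in> (\<Sum>i\<in>UNIV - {j}. convex hull V i) \<Longrightarrow>
      p + K *\<^sub>R w \<notin> (\<Sum>i\<in>UNIV - {j}. convex hull V i)"
  shows "\<exists>T. bounded_frame (det_bound TYPE('n) K) V T"
proof -
  let ?C = "det_bound TYPE('n) K"
  have ne: "V i \<noteq> {}" for i using V[of i] by (auto simp: lattice_body_def)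
  have lat: "V i \<subseteq> int_lattice" for i using V[of i] by (simp add: lattice_body_def)
  have bound: "\<bar>det (\<chi> i. x i)\<bar> \<le> ?C" if x: "\<And>i. \<exists>k. k \<noteq> j \<and> (\<exists>b\<in>V k. \<exists>c\<in>V k. x i = b - c)" for x :: "'n \<Rightarrow> real^'n" and j
  proof (rule det_differences_bounded[OF _ _ K no[of _ _ j]])
    show "convex (\<Sum>i\<in>UNIV - {j}. convex hull V i)" by (intro convex_sum_sets) simp
    show "(\<Sum>i\<in>UNIV - {j}. convex hull V i) \<noteq> {}" using ne by (intro sum_sets_nonempty) simp
    show "x i \<in> int_lattice" for i
    proof -
      obtain k b c where k: "b \<in> V k" "c \<in> V k" "x i = b - c" using x by blast
      then show ?thesis using subsetD[OF lat] by (simp add: int_lattice_diff)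
    qed
    show "\<exists>y\<in>\<Sum>i\<in>UNIV - {j}. convex hull V i. \<exists>y'\<in>\<Sum>i\<in>UNIV - {j}. convex hull V i. y - y' = x i" for i
    proof -
      obtain k b c where k: "k \<noteq> j" "b \<in> V k" "c \<in> V k" "x i = b - c" using x by blast
      have kI: "k \<in> UNIV - {j}" using k by simp
      have bc: "b \<in> convex hull V k" "c \<in> convex hull V k" using k by (auto intro: hull_inc)
      have fI: "finite (UNIV - {j})" by simp
      have ne': "convex hull V l \<noteq> {}" for l using ne by simp
      obtain y y' where "y \<in> (\<Sum>i\<in>UNIV - {j}. convex hull V i)" "y' \<in> (\<Sum>i\<in>UNIV - {j}. convex hull V i)" "y - y' = b - c"
        by (rule sum_sets_difference[where V = "\<lambda>i. convex hull V i", OF fI kI bc ne'])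
      then show ?thesis unfolding k(4) by blast
    qed
  qed
  fix k0 :: 'n
  define v0 where "v0 = (SOME v. v \<in> V k0)"
  have v0: "v0 \<in> V k0" unfolding v0_def using ne by (simp add: some_in_eq)
  define D where "D = (\<lambda>v. v - v0) ` V k0"
  have spD: "span D = UNIV"
  proof (rule ccontr)
    assume "span D \<noteq> UNIV"
    then have "\<exists>c\<in>V k0. c - v0 \<notin> span D"
      using V[of k0] by (intro full_dim_difference) (auto simp: lattice_body_def)
    then show False by (auto simp: D_def span_base)
  qed
  obtain B where B: "B \<subseteq> D" "independent B" "D \<subseteq> span B" "card B = dim D" by (rule basis_exists)
  have finB: "finite B" using B(2) by (rule independent_imp_finite)
  have "dim D = CARD('n)" using spD dim_span[of D] by simp
  then obtain y where y: "bij_betw y (UNIV :: 'n set) B"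
    using finite_same_card_bij[of "UNIV :: 'n set" B] B(4) finB by auto
  have yD: "\<exists>b\<in>V k0. \<exists>c\<in>V k0. y i = b - c" for i
  proof -
    have "y i \<in> D" using y B(1) by (auto simp: bij_betw_def)
    then show ?thesis using v0 by (auto simp: D_def)
  qed
  have yint: "y i \<in> int_lattice" for i
  proof -
    obtain b c where "b \<in> V k0" "c \<in> V k0" "y i = b - c" using yD[of i] by blast
    then show ?thesis using subsetD[OF lat] by (simp add: int_lattice_diff)
  qed
  let ?Y = "\<chi> i. y i"
  have dY: "det ?Y \<noteq> 0"
  proof -
    have "rows ?Y = B" using y by (auto simp: rows_def row_def bij_betw_def)
    then have "rank ?Y = CARD('n)"
      using dim_eq_card_independent[OF B(2)] B(4) \<open>dim D = CARD('n)\<close> row_rank_def[of ?Y] by simp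
    then show ?thesis using det_eq_0_rank[of ?Y] by simp
  qed
  define T where "T c = (\<Sum>l\<in>UNIV. (c $ l) *\<^sub>R y l)" for c
  define S where "S z = (\<chi> l. det (\<chi> i. if i = l then z else y i) / det ?Y)" for z
  have T: "linear T"
    by (rule linearI) (simp_all add: T_def scaleR_left_distrib sum.distrib scaleR_sum_right)
  have TS: "T (S z) = z" for z
    using cramer_rows[OF dY, of z] by (simp add: T_def S_def)
  then have "surj T" by (metis surjI)
  then have bT: "bij T" using linear_surjective_imp_injective[OF T] by (simp add: bij_def)
  then have iS: "inv T z = S z" for z using TS by (metis bij_inv_eq_iff)
  have "T c \<in> int_lattice" if "c \<in> int_lattice" for c
    unfolding T_def using that
    by (intro int_lattice_sum int_lattice_scale yint) (simp add: int_lattice_def)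
  then have Tint: "T ` int_lattice \<subseteq> int_lattice" by blast
  have detint: "det (\<chi> i. if i = l then z else y i) \<in> \<int>" if "z \<in> int_lattice" for z l
    using that yint by (intro det_in_Ints) simp
  have dYint: "det ?Y \<in> \<int>" using yint by (intro det_in_Ints) simp
  then obtain e where e: "det ?Y = of_int e" by (rule Ints_cases)
  have "{k0} \<noteq> UNIV"
  proof
    assume U: "{k0} = UNIV"
    have "card {k0} = 1" by simp
    then show False using n unfolding U by simp
  qed
  then obtain j1 where j1: "j1 \<noteq> k0" by blast
  have dYC: "\<bar>det ?Y\<bar> \<le> ?C" using yD j1 by (intro bound[of j1] exI[of _ k0]) simp
  have frame: "real (nat \<bar>e\<bar>) *\<^sub>R inv T z \<in> int_lattice" if z: "z \<in> int_lattice" for z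
  proof -
    have "real (nat \<bar>e\<bar>) * (S z $ l) \<in> \<int>" for l
    proof -
      have "of_int e * (S z $ l) = det (\<chi> i. if i = l then z else y i)"
        using dY e by (simp add: S_def)
      then have "of_int e * (S z $ l) \<in> \<int>" using detint[OF z] by simp
      then show ?thesis by (cases "e \<ge> 0") (auto simp: abs_if)
    qed
    then show ?thesis by (simp add: iS int_lattice_def)
  qed
  have coords: "\<bar>inv T (v - v') $ l\<bar> \<le> ?C" if v: "v \<in> V i" "v' \<in> V i" for i v v' l
  proof -
    \<comment> \<open>The determinant mixes differences of \<open>V i\<close> and
      \<open>V k0\<close>. The bound needs both inside one sum of \<open>n - 1\<close> polytopes,
      hence a third index to omit.\<close>
    have "{i, k0} \<noteq> UNIV"
    proof
      assume U: "{i, k0} = UNIV"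
      have "card {i, k0} \<le> 2" by (simp add: card_insert_if)
      then show False using n unfolding U by simp
    qed
    then obtain j where j: "j \<noteq> i" "j \<noteq> k0" by blast
    have "\<bar>det (\<chi> q. (if q = l then v - v' else y q))\<bar> \<le> ?C"
    proof (rule bound[of j])
      show "\<exists>k. k \<noteq> j \<and> (\<exists>b\<in>V k. \<exists>c\<in>V k. (if q = l then v - v' else y q) = b - c)" for q
      proof (cases "q = l")
        case True
        then show ?thesis using j v by (intro exI[of _ i]) auto
      next
        case False
        then show ?thesis using j yD[of q] by (intro exI[of _ k0]) simp
      qed
    qed
    moreover have "1 \<le> \<bar>det ?Y\<bar>" using dY e by auto
    ultimately have "\<bar>det (\<chi> q. (if q = l then v - v' else y q))\<bar> / \<bar>det ?Y\<bar> \<le> ?C / 1"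
      by (intro frac_le) auto
    then show ?thesis by (simp add: iS S_def)
  qed
  have "bounded_frame ?C V T"
    unfolding bounded_frame_def
  proof (intro conjI exI[of _ "nat \<bar>e\<bar>"] ballI allI T bT Tint frame coords)
    show "0 < nat \<bar>e\<bar>" using dY e by auto
    show "real (nat \<bar>e\<bar>) \<le> ?C" using dYC e by simp
  qed
  then show ?thesis by blast
qed

section \<open>Classification\<close>

lemma finite_bounded_lattice_points:
  "finite {z \<in> (int_lattice :: (real^'n::finite) set). \<forall>l. \<bar>z $ l\<bar> \<le> R}"
proof -
  let ?F = "PiE (UNIV :: 'n set) (\<lambda>_. {- \<lceil>R\<rceil>..\<lceil>R\<rceil>})"
  have "finite ?F" by (intro finite_PiE) auto
  moreover have "{z \<in> (int_lattice :: (real^'n) set). \<forall>l. \<bar>z $ l\<bar> \<le> R} \<subseteq> (\<lambda>f. \<chi> l. real_of_int (f l)) ` ?F"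
  proof
    fix z :: "real^'n" assume z: "z \<in> {z \<in> int_lattice. \<forall>l. \<bar>z $ l\<bar> \<le> R}"
    have fl: "real_of_int \<lfloor>z $ l\<rfloor> = z $ l" for l
      using z by (auto simp: int_lattice_def elim!: allE[of _ l] Ints_cases)
    have "\<lfloor>z $ l\<rfloor> \<in> {- \<lceil>R\<rceil>..\<lceil>R\<rceil>}" for l
    proof -
      have "\<bar>real_of_int \<lfloor>z $ l\<rfloor>\<bar> \<le> R" unfolding fl using z by simp
      then show ?thesis by (simp add: abs_le_iff) linarith
    qed
    note mem = this
    show "z \<in> (\<lambda>f. \<chi> l. real_of_int (f l)) ` ?F"
    proof (rule image_eqI[of _ _ "\<lambda>l. \<lfloor>z $ l\<rfloor>"])
      show "z = (\<chi> l. real_of_int \<lfloor>z $ l\<rfloor>)" unfolding vec_eq_iff by (simp only: fl vec_lambda_beta simp_thms)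
    qed (use mem in auto)
  qed
  ultimately show ?thesis by (rule finite_surj)
qed

text \<open>The finite stock of rational points from which the coordinate data of any frame with
  bound \<open>C\<close> are drawn.\<close>

definition frame_grid :: "real \<Rightarrow> (real^'n) set" where
  "frame_grid C = {c. (\<exists>d::nat. 0 < d \<and> real d \<le> C \<and> real d *\<^sub>R c \<in> int_lattice) \<and> (\<forall>l. \<bar>c $ l\<bar> \<le> C)}"

lemma finite_frame_grid: "finite (frame_grid C :: (real^'n::finite) set)"
proof -
  let ?Z = "{z \<in> (int_lattice :: (real^'n) set). \<forall>l. \<bar>z $ l\<bar> \<le> C * C}"
  have "frame_grid C \<subseteq> (\<lambda>(d, z). (1 / real d) *\<^sub>R z) ` ({..nat \<lfloor>C\<rfloor>} \<times> ?Z)"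
  proof
    fix c :: "real^'n" assume c: "c \<in> frame_grid C"
    then obtain d :: nat where d: "0 < d" "real d \<le> C" "real d *\<^sub>R c \<in> int_lattice" and cC: "\<And>l. \<bar>c $ l\<bar> \<le> C"
      by (auto simp: frame_grid_def)
    have "\<bar>(real d *\<^sub>R c) $ l\<bar> \<le> C * C" for l
      using d cC[of l] by (simp add: abs_mult) (intro mult_mono; simp)
    then have "real d *\<^sub>R c \<in> ?Z" using d by simp
    moreover have "d \<in> {..nat \<lfloor>C\<rfloor>}" using d by (simp add: le_nat_floor)
    ultimately show "c \<in> (\<lambda>(d, z). (1 / real d) *\<^sub>R z) ` ({..nat \<lfloor>C\<rfloor>} \<times> ?Z)"
      using d(1) by (intro image_eqI[of _ _ "(d, real d *\<^sub>R c)"]) auto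
  qed
  then show ?thesis
    by (rule finite_subset) (intro finite_imageI finite_cartesian_product finite_atMost finite_bounded_lattice_points)
qed

text \<open>The lattice in the coordinates of a frame is recorded by its part in the unit cube.\<close>

definition frame_data :: "real \<Rightarrow> ('n::finite \<Rightarrow> (real^'n) set) \<Rightarrow> (real^'n \<Rightarrow> real^'n) \<Rightarrow> (real^'n) set \<times> ('n \<Rightarrow> (real^'n) set)" where
  "frame_data C V T = ({c \<in> frame_grid C. T c \<in> int_lattice}, \<lambda>i. (\<lambda>v. inv T (v - (SOME v. v \<in> V i))) ` V i)"

text \<open>Integral coordinate vectors are always mapped into the lattice, so membership depends on
  fractional parts only; since \<open>1 \<le> C\<close>, these stay within the size bound of the
  grid.\<close>

lemma frame_lattice_iff:
  fixes V :: "'n::finite \<Rightarrow> (real^'n) set"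
  assumes fr: "bounded_frame C V T" and C: "1 \<le> C"
  shows "T c \<in> int_lattice \<longleftrightarrow> (\<chi> l. frac (c $ l)) \<in> fst (frame_data C V T)"
proof -
  have T: "linear T" "bij T" "\<And>z. z \<in> int_lattice \<Longrightarrow> T z \<in> int_lattice" using fr by (auto simp: bounded_frame_def)
  interpret T: linear T by (fact T(1))
  obtain d :: nat where d: "0 < d" "real d \<le> C" "\<And>z. z \<in> int_lattice \<Longrightarrow> real d *\<^sub>R inv T z \<in> int_lattice"
    using fr unfolding bounded_frame_def by blast
  define c' where "c' = (\<chi> l. frac (c $ l))"
  define e where "e = (\<chi> l. real_of_int \<lfloor>c $ l\<rfloor>)"
  have eq: "c = c' + e" by (simp add: vec_eq_iff c'_def e_def frac_def)
  have Te: "T e \<in> int_lattice" by (rule T(3)) (simp add: e_def int_lattice_def)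
  have "T c = T c' + T e" unfolding eq by (rule T.add)
  then have iff: "T c \<in> int_lattice \<longleftrightarrow> T c' \<in> int_lattice"
    using Te int_lattice_add int_lattice_diff by (metis add_diff_cancel_right')
  have "c' \<in> frame_grid C" if "T c' \<in> int_lattice"
  proof -
    have "real d *\<^sub>R c' \<in> int_lattice" using d(3)[OF that] T(2) by (simp add: bij_is_inj inv_f_f)
    moreover have "\<bar>c' $ l\<bar> \<le> C" for l
      using frac_ge_0[of "c $ l"] frac_lt_1[of "c $ l"] C by (simp add: c'_def)
    ultimately show ?thesis using d by (auto simp: frame_grid_def)
  qed
  then show ?thesis using iff unfolding c'_def[symmetric] by (auto simp: frame_data_def)
qed

text \<open>\<open>T \<circ> inv T'\<close> transports one tuple to the other: both frames see the
  same lattice in coordinates, and the same point sets relative to the chosen base points. The base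
  points account for the individual translations.\<close>

lemma equal_frame_data:
  fixes V V' :: "'n::finite \<Rightarrow> (real^'n) set"
  assumes fr: "bounded_frame C V T" "bounded_frame C V' T'" and C: "1 \<le> C"
    and V: "\<And>i. lattice_body (V i)" "\<And>i. lattice_body (V' i)"
    and eq: "frame_data C V T = frame_data C V' T'"
  obtains U t where "linear U" "bij U" "U ` int_lattice = int_lattice" "\<And>i. t i \<in> int_lattice"
    "\<And>i. V i = (\<lambda>x. U x + t i) ` V' i"
proof -
  have T: "linear T" "bij T" "linear T'" "bij T'" using fr by (auto simp: bounded_frame_def)
  have lin: "linear (inv T)" "linear (inv T')"
    using T by (auto intro: inj_linear_imp_inv_linear simp: bij_is_inj)
  interpret T: linear T by (fact T)
  interpret T': linear T' by (fact T)
  interpret iT: linear "inv T" by (fact lin)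
  interpret iT': linear "inv T'" by (fact lin)
  have inv: "T (inv T x) = x" "inv T (T x) = x" "T' (inv T' x) = x" "inv T' (T' x) = x" for x
    using T by (simp_all add: bij_is_inj bij_is_surj surj_f_inv_f inv_f_f)
  have lat: "T c \<in> int_lattice \<longleftrightarrow> T' c \<in> int_lattice" for c
    using frame_lattice_iff[OF fr(1) C] frame_lattice_iff[OF fr(2) C] eq by simp
  define U where "U = T \<circ> inv T'"
  have U: "linear U" unfolding U_def using T lin by (intro linear_compose)
  interpret U: linear U by (fact U)
  have bU: "bij U" unfolding U_def using T by (intro bij_comp bij_imp_bij_inv)
  have Uint: "U z \<in> int_lattice" if "z \<in> int_lattice" for z
    using that lat[of "inv T' z"] inv by (simp add: U_def)
  have "U ` int_lattice = int_lattice"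
  proof
    show "U ` int_lattice \<subseteq> int_lattice" using Uint by blast
    show "int_lattice \<subseteq> U ` int_lattice"
    proof
      fix z :: "real^'n" assume z: "z \<in> int_lattice"
      then have "T' (inv T z) \<in> int_lattice" using lat[of "inv T z"] inv by simp
      moreover have "z = U (T' (inv T z))" by (simp add: U_def inv)
      ultimately show "z \<in> U ` int_lattice" by blast
    qed
  qed
  moreover
  define v where "v i = (SOME v. v \<in> V i)" for i
  define v' where "v' i = (SOME v. v \<in> V' i)" for i
  have ne: "V i \<noteq> {}" "V' i \<noteq> {}" for i using V(1)[of i] V(2)[of i] by (auto simp: lattice_body_def)
  have "v i \<in> V i" "v' i \<in> V' i" for i unfolding v_def v'_def using ne[of i] by (simp_all add: some_in_eq)
  then have vlat: "v i \<in> int_lattice" "v' i \<in> int_lattice" for i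
    using V(1)[of i] V(2)[of i] by (auto simp: lattice_body_def)
  have "v i - U (v' i) \<in> int_lattice" for i
    using vlat Uint by (intro int_lattice_diff) auto
  moreover have "V i = (\<lambda>x. U x + (v i - U (v' i))) ` V' i" for i
  proof -
    have "(\<lambda>x. inv T (x - v i)) ` V i = (\<lambda>x. inv T' (x - v' i)) ` V' i"
      using eq unfolding frame_data_def v_def v'_def by (simp add: fun_eq_iff)
    then have "(\<lambda>c. T c + v i) ` (\<lambda>x. inv T (x - v i)) ` V i = (\<lambda>c. T c + v i) ` (\<lambda>x. inv T' (x - v' i)) ` V' i"
      by simp
    moreover have "(\<lambda>c. T c + v i) ` (\<lambda>x. inv T (x - v i)) ` V i = V i"
      by (simp add: image_image inv)
    moreover have "(\<lambda>c. T c + v i) ` (\<lambda>x. inv T' (x - v' i)) ` V' i = (\<lambda>x. U x + (v i - U (v' i))) ` V' i"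
      unfolding image_image by (intro image_cong refl) (simp add: U_def iT'.diff T.diff)
    ultimately show ?thesis by simp
  qed
  ultimately show ?thesis by (rule that[OF U bU])
qed

text \<open>Only finitely many data occur, and one tuple is kept for each of them.\<close>

lemma finite_frame_representatives:
  fixes C :: real
  assumes C: "1 \<le> C"
  defines "F \<equiv> {V :: 'n::finite \<Rightarrow> (real^'n) set. (\<forall>i. lattice_body (V i)) \<and> (\<exists>T. bounded_frame C V T)}"
  obtains L where "finite L" "L \<subseteq> F"
    "\<And>V. V \<in> F \<Longrightarrow> \<exists>V'\<in>L. \<exists>U t. linear U \<and> bij U \<and> U ` int_lattice = int_lattice \<and> (\<forall>i. t i \<in> int_lattice) \<and>
      (\<forall>i. V i = (\<lambda>x. U x + t i) ` V' i)"
proof -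
  define T where "T V = (SOME T. bounded_frame C V T)" for V :: "'n \<Rightarrow> (real^'n) set"
  have T: "bounded_frame C V (T V)" if "V \<in> F" for V
  proof -
    have "\<exists>T. bounded_frame C V T" using that by (simp add: F_def)
    then show ?thesis unfolding T_def by (rule someI_ex)
  qed
  define dat where "dat V = frame_data C V (T V)" for V
  have "dat ` F \<subseteq> Pow (frame_grid C) \<times> PiE UNIV (\<lambda>_. Pow (frame_grid C))"
  proof (rule image_subsetI)
    fix V assume V: "V \<in> F"
    have fr: "bounded_frame C V (T V)" by (rule T[OF V])
    obtain d :: nat where d: "0 < d" "real d \<le> C" "\<And>z. z \<in> int_lattice \<Longrightarrow> real d *\<^sub>R inv (T V) z \<in> int_lattice"
      using fr unfolding bounded_frame_def by blast
    have "inv (T V) (v - (SOME v. v \<in> V i)) \<in> frame_grid C" if v: "v \<in> V i" for i v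
    proof -
      have s: "(SOME v. v \<in> V i) \<in> V i" using v by (rule someI)
      have "V i \<subseteq> int_lattice" using V by (simp add: F_def lattice_body_def)
      then have "v - (SOME v. v \<in> V i) \<in> int_lattice" using s v by (intro int_lattice_diff) auto
      then have "real d *\<^sub>R inv (T V) (v - (SOME v. v \<in> V i)) \<in> int_lattice" by (rule d(3))
      moreover have "\<bar>inv (T V) (v - (SOME v. v \<in> V i)) $ l\<bar> \<le> C" for l
        using fr v s unfolding bounded_frame_def by blast
      ultimately show ?thesis using d unfolding frame_grid_def by blast
    qed
    then show "dat V \<in> Pow (frame_grid C) \<times> PiE UNIV (\<lambda>_. Pow (frame_grid C))"
      by (auto simp: dat_def frame_data_def)
  qed
  moreover have "finite (Pow (frame_grid C :: (real^'n) set) \<times> PiE (UNIV::'n set) (\<lambda>_. Pow (frame_grid C :: (real^'n) set)))"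
    by (intro finite_cartesian_product finite_PiE) (simp_all add: finite_frame_grid)
  ultimately have fin: "finite (dat ` F)" by (rule finite_subset)
  define rep where "rep = inv_into F dat"
  have rep: "rep (dat V) \<in> F" "dat (rep (dat V)) = dat V" if "V \<in> F" for V
    using inv_into_into[OF imageI[OF that], of dat] f_inv_into_f[OF imageI[OF that], of dat]
    by (simp_all only: rep_def)
  have main: "\<exists>V'\<in>rep ` dat ` F. \<exists>U t. linear U \<and> bij U \<and> U ` int_lattice = int_lattice \<and>
      (\<forall>i. t i \<in> int_lattice) \<and> (\<forall>i. V i = (\<lambda>x. U x + t i) ` V' i)" if V: "V \<in> F" for V
  proof -
    have B: "lattice_body (V i)" "lattice_body (rep (dat V) i)" for i
      using V rep(1)[OF V] by (auto simp: F_def)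
    have e: "frame_data C V (T V) = frame_data C (rep (dat V)) (T (rep (dat V)))"
      using rep(2)[OF V] by (simp add: dat_def)
    obtain U t where "linear U" "bij U" "U ` int_lattice = int_lattice" "\<And>i. t i \<in> int_lattice"
        "\<And>i. V i = (\<lambda>x. U x + t i) ` rep (dat V) i"
      by (rule equal_frame_data[OF T[OF V] T[OF rep(1)[OF V]] C B e]) (assumption | rule that)+
    then show ?thesis
      using V by blast
  qed
  have "finite (rep ` dat ` F)" using fin by simp
  moreover have "rep ` dat ` F \<subseteq> F" using rep by auto
  ultimately show ?thesis by (rule that[OF _ _ main])
qed

section \<open>From polytopes and mixed degree to vertex sets\<close>

lemma det_bound_ge_1: "1 \<le> det_bound TYPE('n::finite) K"
  unfolding det_bound_def by (intro one_le_power) simp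

lemma long_chord_pos: "long_chord TYPE('n::finite) > 0"
  using chord_bound_pos[where 'n = 'n] by (simp add: long_chord_def)

lemma full_dim_lattice_polytope_body:
  fixes P :: "(real^'n) set"
  assumes "full_dim_lattice_polytope P"
  shows "P = convex hull {v. v extreme_point_of P}" "lattice_body {v. v extreme_point_of P}"
proof -
  have P: "polytope P" "\<And>v. v extreme_point_of P \<Longrightarrow> v \<in> int_lattice" "aff_dim P = int CARD('n)"
    using assms by (auto simp: full_dim_lattice_polytope_def lattice_polytope_def)
  obtain W where W: "finite W" "P = convex hull W" using P(1) unfolding polytope_def by blast
  show eq: "P = convex hull {v. v extreme_point_of P}"
    using Krein_Milman_polytope[OF W(1)] unfolding W(2) .
  have "{v. v extreme_point_of P} \<subseteq> W"
    unfolding W(2) using extreme_point_of_convex_hull by blast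
  then have "finite {v. v extreme_point_of P}" using W(1) by (rule finite_subset)
  moreover have "interior P \<noteq> {}"
  proof -
    have "convex P" by (simp add: W(2))
    moreover have "affine hull P = UNIV" using P(3) aff_dim_eq_full[of P] by simp
    moreover have "P \<noteq> {}" using P(3) by auto
    ultimately show ?thesis
      using rel_interior_eq_empty[of P] rel_interior_interior[of P] by simp
  qed
  ultimately show "lattice_body {v. v extreme_point_of P}"
    using P(2) eq by (auto simp: lattice_body_def)
qed

lemma lattice_body_polytope:
  fixes W :: "(real^'n) set"
  assumes "lattice_body W"
  shows "full_dim_lattice_polytope (convex hull W)"
  using assms extreme_point_of_convex_hull[of _ W]
  by (auto simp: full_dim_lattice_polytope_def lattice_polytope_def lattice_body_def polytope_def 
      aff_dim_nonempty_interior)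

lemma mixed_degree_one_hollow:
  fixes P :: "'n::finite \<Rightarrow> (real^'n) set"
  assumes n: "CARD('n) \<ge> 2" and md: "mixed_degree P = 1" and I: "card I = CARD('n) - 1"
  shows "hollow (\<Sum>i\<in>I. P i)"
proof -
  let ?A = "\<lambda>d. d \<le> CARD('n) - 1 \<and> (\<forall>I. card I = CARD('n) - d \<longrightarrow> hollow (\<Sum>i\<in>I. P i))"
  \<comment> \<open>The value 1 differs from \<open>CARD('n)\<close>, which is at least two, so the
    first branch of the definition is excluded.\<close>
  have h: "hollow (P i)" for i
    using md n by (auto simp: mixed_degree_def split: if_splits)
  then have L: "(LEAST d. ?A d) = 1" using md by (simp add: mixed_degree_def)
  \<comment> \<open>A witness is required before \<open>LEAST\<close> can be used; for
    \<open>d = CARD('n) - 1\<close> the sums are single polytopes, already known to be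
    hollow.\<close>
  have "?A (CARD('n) - 1)"
  proof (intro conjI allI impI)
    fix J :: "'n set" assume "card J = CARD('n) - (CARD('n) - 1)"
    then have "card J = 1" using n by simp
    then obtain i where "J = {i}" by (rule card_1_singletonE)
    then show "hollow (\<Sum>i\<in>J. P i)" using h by simp
  qed simp
  then have "?A (LEAST d. ?A d)" by (rule LeastI)
  then show ?thesis using I unfolding L by blast
qed

theorem theorem1p5:
  assumes "CARD('n::finite) \<ge> 4"
    and "CARD('m::finite) = CARD('n) - 1"
  shows "\<exists>L :: ('n \<Rightarrow> (real ^ 'n) set) set.
           finite L \<and>
           (\<forall>Q\<in>L. \<forall>i. full_dim_lattice_polytope (Q i)) \<and>
           (\<forall>P :: 'n \<Rightarrow> (real ^ 'n) set.
              (\<forall>i. full_dim_lattice_polytope (P i)) \<and> mixed_degree P = 1 \<longrightarrow>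
              (\<exists>Q. equivalent_tuples P Q \<and>
                 (Q \<in> L \<or>
                  (\<exists>\<phi> :: real ^ 'n \<Rightarrow> real ^ 'm.
                     lattice_projection \<phi> \<and> (\<forall>i. \<phi> ` Q i = unimodular_simplex)))))"
proof -
  let ?K = "long_chord TYPE('n)"
  let ?C = "det_bound TYPE('n) ?K"
  have m: "CARD('m) + 1 = CARD('n)" using assms by simp
  obtain L where L: "finite L" "L \<subseteq> {V :: 'n \<Rightarrow> (real^'n) set. (\<forall>i. lattice_body (V i)) \<and> (\<exists>T. bounded_frame ?C V T)}"
    and rep: "\<And>V. V \<in> {V. (\<forall>i. lattice_body (V i)) \<and> (\<exists>T. bounded_frame ?C V T)} \<Longrightarrow>
      \<exists>V'\<in>L. \<exists>U t. linear U \<and> bij U \<and> U ` int_lattice = int_lattice \<and> (\<forall>i. t i \<in> int_lattice) \<and>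
        (\<forall>i. V i = (\<lambda>x. U x + t i) ` V' i)"
    by (rule finite_frame_representatives[OF det_bound_ge_1, where 'n = 'n and K1 = ?K]) blast
  let ?L = "(\<lambda>V i. convex hull V i) ` L"
  have "\<exists>Q. equivalent_tuples P Q \<and> (Q \<in> ?L \<or>
      (\<exists>\<phi> :: real ^ 'n \<Rightarrow> real ^ 'm. lattice_projection \<phi> \<and> (\<forall>i. \<phi> ` Q i = unimodular_simplex)))"
    if P: "\<forall>i. full_dim_lattice_polytope (P i)" and md: "mixed_degree P = 1" for P :: "'n \<Rightarrow> (real^'n) set"
  proof -
    define V where "V i = {v. v extreme_point_of P i}" for i
    have PV: "P i = convex hull V i" and V: "lattice_body (V i)" for i
      using full_dim_lattice_polytope_body[of "P i"] P by (auto simp: V_def)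
    have hol: "hollow (\<Sum>i\<in>I. convex hull V i)" if "card I = CARD('n) - 1" for I
      using mixed_degree_one_hollow[OF _ md that] assms(1) by (simp add: PV)
    show ?thesis
    proof (cases "\<exists>j w x. w \<in> int_lattice \<and> w \<noteq> 0 \<and> x \<in> (\<Sum>i\<in>UNIV - {j}. convex hull V i) \<and>
        x + ?K *\<^sub>R w \<in> (\<Sum>i\<in>UNIV - {j}. convex hull V i)")
      case True
      then obtain j w x where w: "w \<in> int_lattice" "w \<noteq> 0" and x: "x \<in> (\<Sum>i\<in>UNIV - {j}. convex hull V i)"
        "x + ?K *\<^sub>R w \<in> (\<Sum>i\<in>UNIV - {j}. convex hull V i)" by blast
      obtain \<phi> :: "real^'n \<Rightarrow> real^'m" where \<phi>: "linear \<phi>" "\<phi> ` int_lattice = int_lattice"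
        and t: "\<And>i. \<exists>t\<in>int_lattice. (\<lambda>x. \<phi> (x + t)) ` V i = insert 0 (range (\<lambda>l. axis l 1))"
        by (rule long_chord_projection[OF assms(1) m V hol w x]) (assumption | rule that)+
      obtain t where t: "\<And>i. t i \<in> int_lattice" "\<And>i. (\<lambda>x. \<phi> (x + t i)) ` V i = insert 0 (range (\<lambda>l. axis l 1))"
        using t by metis
      \<comment> \<open>The projections agree with the simplex only after an individual lattice
        translation of each polytope, which equivalence of tuples permits.\<close>
      define Q where "Q i = (\<lambda>x. x + t i) ` P i" for i
      have "surj \<phi>"
      proof -
        have "z \<in> range \<phi>" for z
        proof -
          have "axis l 1 \<in> range \<phi>" for l using \<phi>(2) int_lattice_axis[of l] by blast
          then have "(\<Sum>l\<in>UNIV. (z $ l) *\<^sub>R axis l 1) \<in> range \<phi>"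
            by (intro subspace_sum subspace_scale linear_subspace_image[OF \<phi>(1)] subspace_UNIV)
          then show ?thesis using basis_expansion[of z] unfolding scalar_mult_eq_scaleR by simp
        qed
        then show ?thesis by blast
      qed
      then have "lattice_projection \<phi>"
        using \<phi> by (auto simp: lattice_projection_def affine_map_def intro!: exI[of _ \<phi>] exI[of _ 0])
      moreover have "\<phi> ` Q i = unimodular_simplex" for i
      proof -
        have "Q i = (\<lambda>x. t i + x) ` (convex hull V i)"
          by (simp add: Q_def PV add.commute)
        then have "\<phi> ` Q i = \<phi> ` (convex hull ((\<lambda>x. t i + x) ` V i))"
          by (simp only: convex_hull_translation)
        also have "\<dots> = convex hull (\<phi> ` (\<lambda>x. t i + x) ` V i)"
          by (rule convex_hull_linear_image[OF \<phi>(1)])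
        also have "\<phi> ` (\<lambda>x. t i + x) ` V i = (\<lambda>x. \<phi> (x + t i)) ` V i"
          by (simp add: image_image add.commute)
        finally show ?thesis by (simp add: t(2) unimodular_simplex_def)
      qed
      moreover have "equivalent_tuples P Q"
        unfolding equivalent_tuples_def
      proof (intro exI conjI allI)
        show "bij (id :: 'n \<Rightarrow> 'n)" by simp
        show "lattice_preserving (id :: real^'n \<Rightarrow> real^'n)"
          using linear_id by (auto simp: lattice_preserving_def affine_map_def intro!: exI[of _ id] exI[of _ 0])
        show "- t i \<in> int_lattice" for i using t(1) by (rule int_lattice_minus)
        show "P i = (\<lambda>x. id x + - t i) ` Q (id i)" for i by (simp add: Q_def image_image)
      qed
      ultimately show ?thesis by blast
    next
      case False
      \<comment> \<open>The negated case condition, with the same length \<open>?K\<close>, is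
        exactly the absence of chords that bounds the determinants.\<close>
      then have "\<exists>T. bounded_frame ?C V T"
        using assms(1) V long_chord_pos by (intro bounded_frame_exists) auto
      then obtain V' U t where V': "V' \<in> L" "linear U" "bij U" "U ` int_lattice = int_lattice" "\<And>i. t i \<in> int_lattice"
        "\<And>i. V i = (\<lambda>x. U x + t i) ` V' i"
        using rep[of V] V by blast
      have "P i = (\<lambda>x. U x + t i) ` (convex hull V' i)" for i
      proof -
        have "P i = convex hull ((\<lambda>x. t i + x) ` U ` V' i)"
          by (simp add: PV V'(6) image_image add.commute)
        also have "\<dots> = (\<lambda>x. t i + x) ` U ` (convex hull V' i)"
          by (simp add: convex_hull_translation convex_hull_linear_image[OF V'(2)])
        finally show ?thesis by (simp add: image_image add.commute)
      qed
      moreover have "lattice_preserving U"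
        using V' by (auto simp: lattice_preserving_def affine_map_def intro!: exI[of _ U] exI[of _ 0])
      ultimately have "equivalent_tuples P (\<lambda>i. convex hull V' i)"
        unfolding equivalent_tuples_def using V'(5)
        by (intro exI[of _ id] exI[of _ U] exI[of _ t]) simp
      then show ?thesis using V'(1) by blast
    qed
  qed
  moreover have "\<forall>Q\<in>?L. \<forall>i. full_dim_lattice_polytope (Q i)"
    using L(2) lattice_body_polytope by blast
  ultimately show ?thesis using L(1) by (intro exI[of _ ?L]) blast
qed

end
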